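(* Let $p\ge2$ and let $\varphi:\partial\mathcal H_{\mathbb C}^p\to\partial\mathcal H_{\mathbb C}^q$ be a measurable map such that: (i) for almost every chain $C$ and almost every triple $(\xi,\eta,\zeta)$ of distinct points on $C$, the triple $\varphi(\xi),\varphi(\eta),\varphi(\zeta)$ consists also of distinct points which lie on a chain and have the same orientation as $(\xi,\eta,\zeta)$; (ii) for almost every triple of points $\xi,\eta,\zeta$ not on a chain, $\varphi(\xi),\varphi(\eta),\varphi(\zeta)$ are also not on a chain. Then there is an isometric holomorphic embedding $F:\mathcal H_{\mathbb C}^p\to\mathcal H_{\mathbb C}^q$ such that $\partial F$ coincides with $\varphi$ almost everywhere.
   Context: $\mathcal H_{\mathbb C}^\ell$ is complex hyperbolic $\ell$-space (metrics normalized to have the same holomorphic sectional curvature for all $\ell$), with ideal boundary $\partial\mathcal H_{\mathbb C}^\ell$. A chain in $\partial\mathcal H_{\mathbb C}^\ell$ is the boundary of a complex geodesic (a totally geodesic holomorphic isometric copy of $\mathcal H_{\mathbb C}^1$) in $\mathcal H_{\mathbb C}^\ell$; it is a circle with a canonical orientation, and any two distinct points of $\partial\mathcal H_{\mathbb C}^\ell$ lie on a unique chain. The set of chains in $\partial\mathcal H_{\mathbb C}^p$ is a homogeneous space of $\mathrm{SU}(p,1)$; "almost every" refers to the invariant Lebesgue measure class on it, to the Lebesgue measure class on chains, and to the Lebesgue measure class on $\partial\mathcal H_{\mathbb C}^p$. $\partial F$ is the extension of $F$ to the ideal boundaries. *)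

theory Defs
  imports "HOL-Analysis.Analysis"
begin

text \<open>
  Complex hyperbolic n-space is the open unit ball in \<open>complex^'n\<close> with the Bergman metric
  (n is the cardinality of \<open>'n\<close>), and its ideal boundary is the unit sphere.  The ball is identified
  with the set of negative lines in the Hermitian space of signature (n,1), which is realised on
  \<open>complex^('n option)\<close> with \<open>None\<close> as the negative coordinate.
\<close>

definition herm :: "complex^('n::finite option) \<Rightarrow> complex^('n option) \<Rightarrow> complex" where
  "herm x y = (\<Sum>i\<in>UNIV. x $ Some i * cnj (y $ Some i)) - x $ None * cnj (y $ None)"

definition homog :: "complex^'n::finite \<Rightarrow> complex^('n option)" where
  "homog z = (\<chi> k. case k of None \<Rightarrow> 1 | Some i \<Rightarrow> z $ i)"

definition dehomog :: "complex^('n::finite option) \<Rightarrow> complex^'n" where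
  "dehomog x = (\<chi> i. x $ Some i / x $ None)"

definition SU1 :: "(complex^('n::finite option)^('n option)) set" where
  "SU1 = {A. (\<forall>x y. herm (A *v x) (A *v y) = herm x y) \<and> det A = 1}"

definition SU1_act :: "complex^('n::finite option)^('n option) \<Rightarrow> complex^'n \<Rightarrow> complex^'n" where
  "SU1_act A z = dehomog (A *v homog z)"

text \<open>
  The distance, normalised by \<open>cosh (d / 2) ^ 2 = h(x,y) h(y,x) / (h(x,x) h(y,y))\<close>, so that the
  holomorphic sectional curvature is -1 in every dimension.
\<close>

definition hyp_dist :: "complex^'n::finite \<Rightarrow> complex^'n \<Rightarrow> real" where
  "hyp_dist z w = 2 * arcosh (cmod (herm (homog z) (homog w)) /
     sqrt (cmod (herm (homog z) (homog z)) * cmod (herm (homog w) (homog w))))"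

definition holomorphic_map_on :: "(complex^'m::finite \<Rightarrow> complex^'n::finite) \<Rightarrow> (complex^'m) set \<Rightarrow> bool" where
  "holomorphic_map_on F S \<longleftrightarrow>
     (\<forall>x\<in>S. \<exists>F'. (F has_derivative F') (at x within S) \<and> (\<forall>c v. F' (c *s v) = c *s F' v))"

definition isometric_holomorphic_embedding ::
    "(complex^'m::finite \<Rightarrow> complex^'n::finite) \<Rightarrow> bool" where
  "isometric_holomorphic_embedding F \<longleftrightarrow>
     F \<in> ball 0 1 \<rightarrow> ball 0 1 \<and> holomorphic_map_on F (ball 0 1) \<and>
     (\<forall>z\<in>ball 0 1. \<forall>w\<in>ball 0 1. hyp_dist (F z) (F w) = hyp_dist z w)"

text \<open>The limit below exists at every point of the sphere if \<open>F\<close> is an isometric embedding.\<close>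

definition boundary_map :: "(complex^'m::finite \<Rightarrow> complex^'n::finite) \<Rightarrow> complex^'m \<Rightarrow> complex^'n" where
  "boundary_map F \<xi> = Lim (at \<xi> within ball 0 1) F"

definition ideal_boundary :: "(complex^'n::finite) set \<Rightarrow> (complex^'n) set" where
  "ideal_boundary S = closure S \<inter> sphere 0 1"

definition chain_of :: "(complex^1 \<Rightarrow> complex^'n::finite) \<Rightarrow> (complex^'n) set" where
  "chain_of f = ideal_boundary (f ` ball 0 1)"

definition is_chain :: "(complex^'n::finite) set \<Rightarrow> bool" where
  "is_chain C \<longleftrightarrow> (\<exists>f :: complex^1 \<Rightarrow> complex^'n. isometric_holomorphic_embedding f \<and> C = chain_of f)"

definition on_common_chain :: "complex^'n::finite \<Rightarrow> complex^'n \<Rightarrow> complex^'n \<Rightarrow> bool" where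
  "on_common_chain \<xi> \<eta> \<zeta> \<longleftrightarrow> (\<exists>C. is_chain C \<and> \<xi> \<in> C \<and> \<eta> \<in> C \<and> \<zeta> \<in> C)"

text \<open>
  A chain carries the orientation of the counterclockwise unit circle, transported by the boundary
  map of any holomorphic parametrisation of the complex geodesic that it bounds.
\<close>

definition positively_oriented :: "complex^'n::finite \<Rightarrow> complex^'n \<Rightarrow> complex^'n \<Rightarrow> bool" where
  "positively_oriented \<xi> \<eta> \<zeta> \<longleftrightarrow>
     (\<exists>(f :: complex^1 \<Rightarrow> complex^'n) r s t. isometric_holomorphic_embedding f \<and>
        r < s \<and> s < t \<and> t < r + 2 * pi \<and>
        \<xi> = boundary_map f (vec (cis r)) \<and>
        \<eta> = boundary_map f (vec (cis s)) \<and>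
        \<zeta> = boundary_map f (vec (cis t)))"

text \<open>
  The rotation-invariant measure on the sphere, up to a constant factor: the measure of a set is the
  volume of the cone over it.
\<close>

definition sphere_lebesgue :: "(complex^'n::finite) measure" where
  "sphere_lebesgue =
     distr (restrict_space lborel (ball 0 1 - {0})) (restrict_space borel (sphere 0 1)) sgn"

text \<open>
  The Lebesgue measure class of a chain is the image of that of the circle under the boundary map of
  a parametrisation; all parametrisations give the same class.
\<close>

definition almost_every_triple_on ::
    "(complex^'n::finite) set \<Rightarrow> (complex^'n \<Rightarrow> complex^'n \<Rightarrow> complex^'n \<Rightarrow> bool) \<Rightarrow> bool" where
  "almost_every_triple_on C P \<longleftrightarrow>
     (\<forall>f :: complex^1 \<Rightarrow> complex^'n. isometric_holomorphic_embedding f \<and> chain_of f = C \<longrightarrow>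
        (AE (a, b, c) in sphere_lebesgue \<Otimes>\<^sub>M sphere_lebesgue \<Otimes>\<^sub>M sphere_lebesgue.
           P (boundary_map f a) (boundary_map f b) (boundary_map f c)))"

text \<open>
  The Effros sigma-algebra of closed subsets of the sphere, restricted to the chains.  It is the Borel
  sigma-algebra of the set of chains as a homogeneous space.
\<close>

definition chain_borel :: "(complex^'n::finite) set measure" where
  "chain_borel = sigma {C. is_chain C} {{C. is_chain C \<and> C \<inter> U \<noteq> {}} | U. open U}"

text \<open>
  The measures in the invariant measure class: a homogeneous space carries exactly one class of
  nonzero sigma-finite Borel measures whose null sets are preserved by the group.
\<close>

definition in_invariant_class :: "(complex^'n::finite) set measure \<Rightarrow> bool" where
  "in_invariant_class M \<longleftrightarrow>
     sets M = sets chain_borel \<and> sigma_finite_measure M \<and> emeasure M (space M) \<noteq> 0 \<and>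
     (\<forall>A\<in>SU1. \<forall>N\<in>null_sets M. (\<lambda>C. SU1_act A ` C) ` N \<in> null_sets M)"

definition almost_every_chain :: "((complex^'n::finite) set \<Rightarrow> bool) \<Rightarrow> bool" where
  "almost_every_chain P \<longleftrightarrow> (\<forall>M. in_invariant_class M \<longrightarrow> (AE C in M. P C))"

end

theory Submission
  imports Defs "HOL-Analysis.Analysis"
begin

text \<open>
  The chain through \<open>x\<close> and \<open>w\<close> is the orbit of \<open>x\<close> under the unipotent transvections
  \<open>v + i s h(v,w) w\<close> fixing \<open>w\<close>, together with \<open>w\<close>.  By (i), for generic \<open>w\<close>, \<open>x\<close> and \<open>s\<close> the map \<open>\<phi>\<close>
  takes the translate of \<open>x\<close> by the parameter \<open>s\<close> about \<open>w\<close> to the translate of \<open>\<phi> x\<close> by some parameter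
  \<open>d\<close> about \<open>\<phi> w\<close>.  Three points \<open>x\<close>, \<open>y\<close>, \<open>v\<close> of a chain and their translates about \<open>w\<close> have collinear
  images; as \<open>\<phi> w\<close>, \<open>\<phi> x\<close>, \<open>\<phi> y\<close> are not collinear by (ii), this forces the parameters at \<open>x\<close> and \<open>y\<close> to
  agree.  Hence \<open>d\<close> depends on \<open>w\<close> and \<open>s\<close> only; it is additive in \<open>s\<close> and has the sign of \<open>s\<close>, so
  \<open>d = q(w) s\<close>.  Comparing both ends of a chain gives \<open>q(w) q(x) |h(\<phi> w, \<phi> x)|^2 = |h(w,x)|^2\<close>, and
  expanding this relation along translates of \<open>x\<close> shows that triple products agree up to the factors \<open>q\<close>.
  Suitably scaled lifts of \<open>\<phi>\<close> therefore have the same Hermitian products as the lifts of the points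
  themselves, and such a map is linear almost everywhere.
\<close>

section \<open>The Hermitian form and its isometries\<close>

text \<open>Both hypotheses hold only off null sets, so no point may be chosen freely: auxiliary
  points are images of generic ones under maps that keep null sets, and each reordering of points
  and parameters is a use of Fubini. That needs Borel measurability, hence \<open>\<phi>\<close> is
  first replaced by a Borel version. Incidence and orientation become signs: the triple product
  \<open>tri\<close> of isotropic lifts has nonpositive real part, which vanishes exactly when the
  points lie on a chain, and there the sign of the imaginary part is the orientation. Orientation
  gives \<open>d\<close> the sign of \<open>s\<close>, and this positivity replaces measurability
  when the additive \<open>d\<close> is shown to be linear. The pairwise relation yields the modulus
  of a triple product and, through the part linear in the translation parameter, its imaginary part;
  as the sign of the real part is known, the whole number is determined. Chains are defined by
  arbitrary holomorphic isometries of the disc, so these must be shown to come from linear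
  isometries before the algebra applies. The bound on p makes generic triples noncollinear, so that
  (ii) speaks about them.\<close>

lemma herm_add_left: "herm (x + y) z = herm x z + herm y z"
  by (simp add: herm_def algebra_simps sum.distrib)

lemma herm_add_right: "herm x (y + z) = herm x y + herm x z"
  by (simp add: herm_def algebra_simps sum.distrib)

lemma herm_scale_left: "herm (c *s x) y = c * herm x y"
  by (simp add: herm_def algebra_simps sum_distrib_left)

lemma herm_scale_right: "herm x (c *s y) = cnj c * herm x y"
  by (simp add: herm_def algebra_simps sum_distrib_left)

lemma herm_diff_left: "herm (x - y) z = herm x z - herm y z"
  by (simp add: herm_def algebra_simps sum_subtractf)

lemma herm_diff_right: "herm x (y - z) = herm x y - herm x z"
  by (simp add: herm_def algebra_simps sum_subtractf)

lemma herm_zero_left [simp]: "herm 0 x = 0"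
  by (simp add: herm_def)

lemma herm_zero_right [simp]: "herm x 0 = 0"
  by (simp add: herm_def)

lemma herm_minus_left: "herm (- x) y = - herm x y"
  by (simp add: herm_def sum_negf)

lemma herm_minus_right: "herm x (- y) = - herm x y"
  by (simp add: herm_def sum_negf)

lemmas herm_linear = herm_minus_left herm_minus_right herm_add_left herm_add_right herm_diff_left herm_diff_right
  herm_scale_left herm_scale_right

lemma cnj_herm: "cnj (herm x y) = herm y x"
  by (simp add: herm_def mult.commute)

lemma herm_eq_0_commute: "herm x y = 0 \<longleftrightarrow> herm y x = 0"
  using cnj_herm complex_cnj_zero_iff by metis

lemma cmod_herm_sym: "cmod (herm x y) = cmod (herm y x)"
  by (metis cnj_herm complex_mod_cnj)

lemma herm_mult_commute: "herm x y * herm y x = of_real ((cmod (herm x y))\<^sup>2)"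
  by (metis cnj_herm complex_norm_square)

lemma norm_vec_sq: "(norm (z :: complex^'n::finite))\<^sup>2 = (\<Sum>i\<in>UNIV. (cmod (z $ i))\<^sup>2)"
  by (simp add: norm_vec_def L2_set_def sum_nonneg)

lemma herm_self:
  "herm x x = of_real ((norm (\<chi> i. x $ Some i))\<^sup>2 - (cmod (x $ None))\<^sup>2)"
  unfolding norm_vec_sq herm_def
  by (simp add: complex_norm_square[symmetric] del: of_real_power)

lemma Im_herm_self [simp]: "Im (herm x x) = 0"
  by (simp add: herm_self)

lemma herm_homog: "herm (homog z) (homog w) = (\<Sum>i\<in>UNIV. z $ i * cnj (w $ i)) - 1"
  by (simp add: herm_def homog_def)

lemma herm_homog_self: "herm (homog z) (homog z) = of_real ((norm z)\<^sup>2 - 1)"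
  by (simp add: herm_self homog_def)

lemma homog_None [simp]: "homog z $ None = 1"
  by (simp add: homog_def)

lemma homog_Some [simp]: "homog z $ Some i = z $ i"
  by (simp add: homog_def)

lemma homog_nonzero [simp]: "homog z \<noteq> 0"
  by (metis homog_None zero_index zero_neq_one)

lemma dehomog_homog [simp]: "dehomog (homog z) = z"
  by (simp add: dehomog_def vec_eq_iff)

lemma homog_dehomog: "v $ None \<noteq> 0 \<Longrightarrow> homog (dehomog v) = (1 / v $ None) *s v"
  by (auto simp: vec_eq_iff homog_def dehomog_def split: option.split)

lemma dehomog_scale: "c \<noteq> 0 \<Longrightarrow> dehomog (c *s v) = dehomog v"
  by (simp add: dehomog_def vec_eq_iff)

lemma norm_dehomog:
  assumes "v $ None \<noteq> 0"
  shows "(norm (dehomog v))\<^sup>2 = 1 + Re (herm v v) / (cmod (v $ None))\<^sup>2"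
proof -
  have "of_real ((norm (dehomog v))\<^sup>2 - 1) = herm (homog (dehomog v)) (homog (dehomog v))"
    by (simp add: herm_homog_self)
  also have "\<dots> = (1 / v $ None) * cnj (1 / v $ None) * herm v v"
    using assms by (simp add: homog_dehomog herm_linear)
  also have "\<dots> = of_real ((cmod (1 / v $ None))\<^sup>2) * herm v v"
    by (simp only: complex_norm_square)
  also have "\<dots> = of_real (Re (herm v v) / (cmod (v $ None))\<^sup>2)"
    by (simp add: complex_eq_iff norm_divide power_divide del: of_real_power)
  finally have "(norm (dehomog v))\<^sup>2 - 1 = Re (herm v v) / (cmod (v $ None))\<^sup>2"
    using of_real_eq_iff by blast
  then show ?thesis by simp
qed

lemma None_nonzero:
  assumes "Re (herm v v) \<le> 0" "v \<noteq> 0"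
  shows "v $ None \<noteq> 0"
proof
  assume v0: "v $ None = 0"
  with assms(1) have "(norm (\<chi> i. v $ Some i))\<^sup>2 \<le> 0"
    by (simp add: herm_self)
  then have "(\<chi> i. v $ Some i) = 0" by simp
  then have "v $ Some i = 0" for i
    by (metis vec_lambda_beta zero_index)
  with v0 have "v = 0"
    by (metis (no_types) not_None_eq vec_eq_iff zero_index)
  with assms show False by simp
qed

lemma dehomog_sphere:
  assumes "herm v v = 0" "v \<noteq> 0"
  shows "dehomog v \<in> sphere 0 1"
proof -
  have "(norm (dehomog v))\<^sup>2 = 1"
    using norm_dehomog[OF None_nonzero[OF _ assms(2)]] assms(1) by simp
  then show ?thesis
    using power2_eq_1_iff[of "norm (dehomog v)"] norm_ge_zero[of "dehomog v"] by auto
qed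

lemma dehomog_ball:
  assumes "Re (herm v v) < 0"
  shows "dehomog v \<in> ball 0 1"
proof -
  have "v \<noteq> 0" using assms by auto
  then have v0: "v $ None \<noteq> 0" using None_nonzero assms by force
  have "(norm (dehomog v))\<^sup>2 < 1"
    using norm_dehomog[OF v0] assms v0 by (simp add: divide_less_0_iff)
  then show ?thesis by (simp add: abs_square_less_1)
qed

lemma hp_self: "x \<in> sphere 0 1 \<Longrightarrow> herm (homog x) (homog x) = 0"
  by (simp add: herm_homog_self)

text \<open>Equality case of Cauchy-Schwarz: a vanishing product makes the real inner product of two
  unit vectors equal to 1, so they coincide.\<close>

lemma hp_nonzero:
  assumes "x \<in> sphere 0 1" "y \<in> sphere 0 1" "x \<noteq> y"
  shows "herm (homog x) (homog y) \<noteq> 0"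
proof
  assume "herm (homog x) (homog y) = 0"
  then have "(\<Sum>i\<in>UNIV. x $ i * cnj (y $ i)) = 1" by (simp add: herm_homog)
  then have "Re (\<Sum>i\<in>UNIV. x $ i * cnj (y $ i)) = 1" by simp
  then have "x \<bullet> y = 1"
    by (simp add: inner_vec_def inner_complex_def)
  then have "(norm (x - y))\<^sup>2 = 0"
    using assms by (simp add: power2_norm_eq_inner inner_diff inner_commute norm_eq_1)
  with assms(3) show False by simp
qed

lemma herm_homog_eq_0_iff:
  assumes "x \<in> sphere 0 1" "y \<in> sphere 0 1"
  shows "herm (homog x) (homog y) = 0 \<longleftrightarrow> x = y"
  using hp_nonzero[OF assms] hp_self[OF assms(1)] by auto

text \<open>In signature (n,1) a negative vector has a positive definite complement. Orthogonality
  equates the product of the \<open>None\<close> coordinates with the Euclidean product of the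
  others, to which Cauchy-Schwarz applies.\<close>

lemma orthogonal_to_timelike:
  assumes P: "Re (herm P P) < 0" and RP: "herm R P = 0"
  shows "Re (herm R R) \<ge> 0" "Re (herm R R) = 0 \<Longrightarrow> R = 0"
proof -
  let ?r = "(\<chi> i. R $ Some i)" and ?p = "(\<chi> i. P $ Some i)"
  have "(\<Sum>i\<in>UNIV. R $ Some i * cnj (P $ Some i)) = R $ None * cnj (P $ None)"
    using RP by (simp add: herm_def)
  then have "cmod (R $ None) * cmod (P $ None) = cmod (\<Sum>i\<in>UNIV. R $ Some i * cnj (P $ Some i))"
    by (simp add: norm_mult)
  also have "\<dots> \<le> (\<Sum>i\<in>UNIV. \<bar>cmod (R $ Some i) * cmod (P $ Some i)\<bar>)"
    by (rule order_trans[OF norm_sum]) (simp add: norm_mult)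
  also have "\<dots> \<le> norm ?r * norm ?p"
    using L2_set_mult_ineq[of "\<lambda>i. cmod (R $ Some i)" "\<lambda>i. cmod (P $ Some i)" UNIV]
    by (simp add: norm_vec_def)
  finally have le: "cmod (R $ None) * cmod (P $ None) \<le> norm ?r * norm ?p" .
  have "(norm ?p)\<^sup>2 < (cmod (P $ None))\<^sup>2" using P by (simp add: herm_self)
  then have p: "norm ?p < cmod (P $ None)"
    by (rule power_less_imp_less_base) simp
  have "cmod (R $ None) * cmod (P $ None) \<le> norm ?r * cmod (P $ None)"
    by (rule order_trans[OF le]) (use p in \<open>simp add: mult_left_mono\<close>)
  moreover have "cmod (P $ None) > 0" using p norm_ge_zero[of ?p] by linarith
  ultimately have r: "cmod (R $ None) \<le> norm ?r"
    by simp
  then show "Re (herm R R) \<ge> 0" by (simp add: herm_self power_mono)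
  assume "Re (herm R R) = 0"
  then have eq: "norm ?r = cmod (R $ None)" by (simp add: herm_self)
  have "norm ?r = 0"
  proof (rule ccontr)
    assume "norm ?r \<noteq> 0"
    then have "norm ?r * norm ?p < norm ?r * cmod (P $ None)"
      using p by simp
    with le eq show False by simp
  qed
  with eq have "R $ None = 0" "\<And>i. R $ Some i = 0"
     apply simp
    by (metis \<open>norm ?r = 0\<close> norm_eq_zero vec_lambda_beta zero_index)
  then show "R = 0" by (metis (no_types) not_None_eq vec_eq_iff zero_index)
qed

section \<open>Triple products of isotropic vectors (Cartan's angular invariant)\<close>

definition tri where
  "tri X Y Z = herm X Y * herm Y Z * herm Z X"

lemma tri_rotate: "tri X Y Z = tri Y Z X"
  by (simp add: tri_def)

lemma tri_swap: "tri X Z Y = cnj (tri X Y Z)"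
  by (simp add: tri_def cnj_herm)

text \<open>Nonzero rescalings contribute a positive factor, so the vanishing of the real part and
  the sign of the imaginary part belong to the points and not to their lifts.\<close>

lemma tri_scale:
  "tri (a *s X) (b *s Y) (c *s Z) = of_real ((cmod a)\<^sup>2 * (cmod b)\<^sup>2 * (cmod c)\<^sup>2) * tri X Y Z"
  by (simp add: tri_def herm_linear complex_norm_square del: of_real_power)

text \<open>The span of the two isotropic vectors contains the negative vector
  \<open>X - herm X Y *s Y\<close>, whose complement is definite.\<close>

lemma isotropic_pair_complement:
  assumes X: "herm X X = 0" and Y: "herm Y Y = 0" and XY: "herm X Y \<noteq> 0"
    and "herm R X = 0" "herm R Y = 0"
  shows "Re (herm R R) \<ge> 0" "Re (herm R R) = 0 \<Longrightarrow> R = 0"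
proof -
  let ?P = "X - herm X Y *s Y"
  have "herm ?P ?P = - 2 * (herm X Y * herm Y X)"
    using X Y by (simp add: herm_linear cnj_herm)
  also have "\<dots> = of_real (- 2 * (cmod (herm X Y))\<^sup>2)"
    by (simp add: herm_mult_commute)
  finally have "Re (herm ?P ?P) < 0" using XY by simp
  moreover have "herm R ?P = 0" using assms by (simp add: herm_linear)
  ultimately show "Re (herm R R) \<ge> 0" "Re (herm R R) = 0 \<Longrightarrow> R = 0"
    using orthogonal_to_timelike by blast+
qed

text \<open>Split \<open>Z\<close> into its projection to the span of \<open>X\<close> and
  \<open>Y\<close> and an orthogonal rest \<open>R\<close>. Isotropy of \<open>Z\<close> makes
  \<open>herm R R\<close> a negative multiple of the real part of the triple product, and
  \<open>herm R R\<close> is nonnegative and vanishes only for \<open>R = 0\<close>.\<close>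

lemma isotropic_triple:
  assumes X: "herm X X = 0" and Y: "herm Y Y = 0" and Z: "herm Z Z = 0" and XY: "herm X Y \<noteq> 0"
  shows "Re (tri X Y Z) \<le> 0"
    and "Re (tri X Y Z) = 0 \<longleftrightarrow> Z = (herm Z Y / herm X Y) *s X + (herm Z X / herm Y X) *s Y"
proof -
  define a b where "a = herm Z Y / herm X Y" and "b = herm Z X / herm Y X"
  define R where "R = Z - a *s X - b *s Y"
  have YX: "herm Y X \<noteq> 0" using XY herm_eq_0_commute by blast
  have RX: "herm R X = 0" and RY: "herm R Y = 0"
    using X Y XY YX by (simp_all add: R_def herm_linear a_def b_def)
  have XR: "herm X R = 0" "herm Y R = 0" using RX RY herm_eq_0_commute by blast+
  have Zeq: "Z = a *s X + b *s Y + R" by (simp add: R_def)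
  have "0 = herm (a *s X + b *s Y + R) (a *s X + b *s Y + R)" using Z Zeq by simp
  also have "\<dots> = a * cnj b * herm X Y + b * cnj a * herm Y X + herm R R"
    using X Y RX RY XR by (simp add: herm_linear algebra_simps)
  finally have RR: "herm R R = - (a * cnj b * herm X Y + cnj (a * cnj b * herm X Y))"
    by (simp add: cnj_herm algebra_simps eq_neg_iff_add_eq_0)
  have "a * cnj b * herm X Y = cnj (tri X Y Z) / of_real ((cmod (herm X Y))\<^sup>2)"
    unfolding a_def b_def tri_def herm_mult_commute[symmetric] using XY YX
    by (simp add: cnj_herm)
  then have R2: "Re (herm R R) = - 2 * Re (tri X Y Z) / (cmod (herm X Y))\<^sup>2"
    using RR by (simp del: of_real_power)
  have pos: "(cmod (herm X Y))\<^sup>2 > 0" using XY by simp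
  have "Re (herm R R) \<ge> 0" by (rule isotropic_pair_complement[OF X Y XY RX RY])
  then show "Re (tri X Y Z) \<le> 0" unfolding R2 using pos by (simp add: field_simps)
  have "Re (tri X Y Z) = 0 \<longleftrightarrow> Re (herm R R) = 0" unfolding R2 using pos by simp
  also have "\<dots> \<longleftrightarrow> R = 0"
    using isotropic_pair_complement(2)[OF X Y XY RX RY] by auto
  also have "\<dots> \<longleftrightarrow> Z = a *s X + b *s Y" unfolding R_def
    by (auto simp: vec_eq_iff algebra_simps)
  finally show "Re (tri X Y Z) = 0 \<longleftrightarrow> Z = (herm Z Y / herm X Y) *s X + (herm Z X / herm Y X) *s Y"
    by (simp add: a_def b_def)
qed

lemma Re_tri_span:
  assumes "herm X X = 0" "herm Y Y = 0" "herm Z Z = 0" "Z = a *s X + b *s Y"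
  shows "Re (tri X Y Z) = 0"
proof (cases "herm X Y = 0")
  case True
  then show ?thesis by (simp add: tri_def)
next
  case False
  then have "herm Y X \<noteq> 0" using herm_eq_0_commute by blast
  with False have "a = herm Z Y / herm X Y" "b = herm Z X / herm Y X"
    unfolding assms(4) using assms(1,2) by (simp_all add: herm_linear)
  with assms(4) show ?thesis
    unfolding isotropic_triple(2)[OF assms(1-3) False] by metis
qed

section \<open>Linear isometries, not necessarily onto, and their projective action\<close>

definition herm_iso :: "(complex^('m::finite option) \<Rightarrow> complex^('n::finite option)) \<Rightarrow> bool" where
  "herm_iso f \<longleftrightarrow> (\<forall>u v. f (u + v) = f u + f v) \<and> (\<forall>c v. f (c *s v) = c *s f v) \<and>
     (\<forall>u v. herm (f u) (f v) = herm u v)"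

definition proj_act :: "(complex^('m::finite option) \<Rightarrow> complex^('n::finite option)) \<Rightarrow> complex^'m \<Rightarrow> complex^'n"
  where "proj_act f z = dehomog (f (homog z))"

lemma scaleR_eq_smult: "r *\<^sub>R w = of_real r *s (w :: complex^'k)"
  by (simp add: vec_eq_iff) (simp add: scaleR_conv_of_real)

context
  fixes f :: "complex^('m::finite option) \<Rightarrow> complex^('n::finite option)"
  assumes f: "herm_iso f"
begin

lemma herm_iso_add: "f (u + v) = f u + f v"
  and herm_iso_scale: "f (c *s v) = c *s f v"
  and herm_iso_herm: "herm (f u) (f v) = herm u v"
  using f by (auto simp: herm_iso_def)

lemma bounded_linear_herm_iso: "bounded_linear f"
proof -
  have "linear f"
  proof
    fix r :: real and v
    show "f (r *\<^sub>R v) = r *\<^sub>R f v"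
      using herm_iso_scale[of "of_real r" v] by (simp add: scaleR_eq_smult)
  qed (rule herm_iso_add)
  then show ?thesis by (simp add: linear_conv_bounded_linear)
qed

lemma herm_iso_nonzero:
  assumes "v \<noteq> 0" shows "f v \<noteq> 0"
proof
  assume "f v = 0"
  then have orth: "herm v w = 0" for w using herm_iso_herm[of v w] by simp
  have "v $ k = 0" for k
    using orth[of "axis k 1"] by (cases k) (auto simp: herm_def axis_def if_distrib cong: if_cong)
  with assms show False by (simp add: vec_eq_iff)
qed

lemma herm_iso_None:
  assumes "norm z \<le> 1" shows "f (homog z) $ None \<noteq> 0"
proof (rule None_nonzero)
  show "Re (herm (f (homog z)) (f (homog z))) \<le> 0"
    using assms by (simp add: herm_iso_herm herm_homog_self power_le_one)
qed (simp add: herm_iso_nonzero)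

lemma homog_proj_act:
  assumes "norm z \<le> 1"
  shows "homog (proj_act f z) = (1 / f (homog z) $ None) *s f (homog z)"
  unfolding proj_act_def by (rule homog_dehomog[OF herm_iso_None[OF assms]])

lemma proj_act_ball: "z \<in> ball 0 1 \<Longrightarrow> proj_act f z \<in> ball 0 1"
  unfolding proj_act_def
  by (rule dehomog_ball) (simp add: herm_iso_herm herm_homog_self abs_square_less_1)

lemma proj_act_sphere: "z \<in> sphere 0 1 \<Longrightarrow> proj_act f z \<in> sphere 0 1"
  unfolding proj_act_def
  by (rule dehomog_sphere) (simp_all add: herm_iso_herm herm_homog_self herm_iso_nonzero)

end

section \<open>Isometries act by holomorphic embeddings\<close>

lemma bounded_bilinear_smult: "bounded_bilinear ((*s) :: complex \<Rightarrow> complex^'n::finite \<Rightarrow> complex^'n)"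
proof
  have "norm (c *s v) = cmod c * norm v" for c and v :: "complex^'n"
    by (simp add: norm_vec_def norm_mult L2_set_right_distrib)
  then show "\<exists>K. \<forall>(c::complex) v :: complex^'n. norm (c *s v) \<le> norm c * norm v * K"
    by (intro exI[of _ 1]) simp
qed (auto simp: vec_eq_iff algebra_simps)

text \<open>The part of \<open>Y\<close> orthogonal to the negative vector \<open>X\<close> has a
  nonnegative product with itself.\<close>

lemma reverse_Cauchy_Schwarz:
  assumes "Re (herm X X) < 0"
  shows "Re (herm X X) * Re (herm Y Y) \<le> (cmod (herm X Y))\<^sup>2"
proof -
  define a where "a = Re (herm X X)"
  have XX: "herm X X = of_real a" by (simp add: a_def complex_eq_iff)
  have a: "a < 0" using assms by (simp add: a_def)
  define R where "R = Y - (herm Y X / of_real a) *s X"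
  have RX: "herm R X = 0" using a by (simp add: R_def herm_linear XX)
  have "herm R R = herm R Y"
    unfolding R_def[of ] herm_diff_right herm_scale_right using RX
    by (simp add: R_def)
  also have "\<dots> = herm Y Y - herm Y X * herm X Y / of_real a"
    by (simp add: R_def herm_linear)
  also have "\<dots> = herm Y Y - of_real ((cmod (herm X Y))\<^sup>2 / a)"
    by (simp add: herm_mult_commute[of Y X] cmod_herm_sym[of Y X] del: of_real_power)
  finally have "Re (herm R R) = Re (herm Y Y) - (cmod (herm X Y))\<^sup>2 / a" by simp
  moreover have "Re (herm R R) \<ge> 0" by (rule orthogonal_to_timelike(1)[OF assms RX])
  moreover have "a * Re (herm R R) \<le> 0" using calculation a by (simp add: mult_nonpos_nonneg)
  ultimately show ?thesis using a unfolding a_def[symmetric] by (simp add: field_simps)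
qed

text \<open>Boundary points are included, as the denominator does not vanish on the sphere either.
  This yields the boundary values of the action and, through differentiability, its effect on null
  sets.\<close>

lemma has_derivative_proj_act:
  assumes f: "herm_iso f" and z: "norm z \<le> 1"
  shows "\<exists>D. (proj_act f has_derivative D) (at z) \<and> (\<forall>c v. D (c *s v) = c *s D v)"
proof -
  define h where "h v = (\<chi> k. case k of None \<Rightarrow> 0 | Some i \<Rightarrow> v $ i)" for v :: "complex^'a"
  have "linear h"
    by standard (auto simp: h_def vec_eq_iff split: option.split)
  then have hbl: "bounded_linear h" by (simp add: linear_conv_bounded_linear)
  have hs: "h (c *s v) = c *s h v" for c v by (auto simp: h_def vec_eq_iff split: option.split)
  have homog_eq: "homog v = homog 0 + h v" for v
    by (auto simp: h_def homog_def vec_eq_iff split: option.split)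
  define k where "k v = (\<chi> i. v $ Some i)" for v :: "complex^('b option)"
  have "linear k" by standard (auto simp: k_def vec_eq_iff)
  then have kbl: "bounded_linear k" by (simp add: linear_conv_bounded_linear)
  have ks: "k (c *s v) = c *s k v" for c v by (simp add: k_def vec_eq_iff)
  interpret f: bounded_linear f by (rule bounded_linear_herm_iso[OF f])
  interpret bb: bounded_bilinear "(*s) :: complex \<Rightarrow> complex^'b \<Rightarrow> complex^'b" by (rule bounded_bilinear_smult)
  have hd: "(homog has_derivative h) (at z)"
    using has_derivative_add[OF has_derivative_const[of "homog 0"] bounded_linear_imp_has_derivative[OF hbl]]
    by (simp flip: homog_eq)
  have fd: "((\<lambda>v. f (homog v)) has_derivative (\<lambda>v. f (h v))) (at z)"
    by (rule f.has_derivative[OF hd])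
  have Nd: "((\<lambda>v. f (homog v) $ None) has_derivative (\<lambda>v. f (h v) $ None)) (at z)"
    by (rule bounded_linear.has_derivative[OF bounded_linear_vec_nth fd])
  have Kd: "((\<lambda>v. k (f (homog v))) has_derivative (\<lambda>v. k (f (h v)))) (at z)"
    by (rule bounded_linear.has_derivative[OF kbl fd])
  have nz: "f (homog z) $ None \<noteq> 0" by (rule herm_iso_None[OF f z])
  have pe: "proj_act f = (\<lambda>v. inverse (f (homog v) $ None) *s k (f (homog v)))"
    by (auto simp: proj_act_def dehomog_def k_def vec_eq_iff divide_inverse)
  show ?thesis unfolding pe
  proof (intro exI conjI)
    show "((\<lambda>v. inverse (f (homog v) $ None) *s k (f (homog v))) has_derivative
      (\<lambda>v. inverse (f (homog z) $ None) *s k (f (h v)) +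
         - (inverse (f (homog z) $ None) * (f (h v) $ None) * inverse (f (homog z) $ None)) *s k (f (homog z)))) (at z)"
      by (rule bb.FDERIV[OF Deriv.has_derivative_inverse[OF nz Nd] Kd])
  qed (simp add: hs ks herm_iso_scale[OF f] vec_eq_iff algebra_simps)
qed

lemma embedding_proj_act:
  assumes f: "herm_iso f"
  shows "isometric_holomorphic_embedding (proj_act f)"
  unfolding isometric_holomorphic_embedding_def holomorphic_map_on_def
proof (intro conjI ballI)
  show "proj_act f \<in> ball 0 1 \<rightarrow> ball 0 1" using proj_act_ball[OF f] by blast
next
  fix z :: "complex^'a" assume "z \<in> ball 0 1"
  then obtain D where "(proj_act f has_derivative D) (at z)" "\<forall>c v. D (c *s v) = c *s D v"
    using has_derivative_proj_act[OF f, of z] by auto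
  then show "\<exists>F'. (proj_act f has_derivative F') (at z within ball 0 1) \<and> (\<forall>c v. F' (c *s v) = c *s F' v)"
    using has_derivative_at_withinI by blast
next
  fix z w :: "complex^'a" assume zw: "z \<in> ball 0 1" "w \<in> ball 0 1"
  define c d where "c = 1 / f (homog z) $ None" and "d = 1 / f (homog w) $ None"
  have "c \<noteq> 0" "d \<noteq> 0" using herm_iso_None[OF f] zw by (auto simp: c_def d_def)
  have hc: "homog (proj_act f z) = c *s f (homog z)" "homog (proj_act f w) = d *s f (homog w)"
    using homog_proj_act[OF f] zw by (simp_all add: c_def d_def)
  have "cmod (herm (homog (proj_act f z)) (homog (proj_act f w))) =
      (cmod c * cmod d) * cmod (herm (homog z) (homog w))"
    "cmod (herm (homog (proj_act f z)) (homog (proj_act f z))) *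
     cmod (herm (homog (proj_act f w)) (homog (proj_act f w))) =
     (cmod c * cmod d)\<^sup>2 * (cmod (herm (homog z) (homog z)) * cmod (herm (homog w) (homog w)))"
    unfolding hc by (simp_all add: herm_linear herm_iso_herm[OF f] norm_mult power2_eq_square)
  then show "hyp_dist (proj_act f z) (proj_act f w) = hyp_dist z w"
    unfolding hyp_dist_def using \<open>c \<noteq> 0\<close> \<open>d \<noteq> 0\<close> by (simp add: real_sqrt_mult)
qed

text \<open>The limit only sees the open ball, so agreement there suffices; continuity of
  \<open>proj_act f\<close> up to the sphere supplies the value.\<close>

lemma boundary_map_proj_act:
  assumes f: "herm_iso f" and eq: "\<And>z. z \<in> ball 0 1 \<Longrightarrow> F z = proj_act f z"
    and \<xi>: "\<xi> \<in> sphere 0 1"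
  shows "boundary_map F \<xi> = proj_act f \<xi>"
  unfolding boundary_map_def
proof (rule tendsto_Lim)
  have "\<xi> \<in> closure (ball 0 1)" "\<xi> \<notin> ball 0 1" using \<xi> by auto
  then have "\<xi> islimpt ball 0 1" by (metis closure_def UnE mem_Collect_eq)
  then show "\<not> trivial_limit (at \<xi> within ball 0 1)" by (simp add: trivial_limit_within)
  obtain D where "(proj_act f has_derivative D) (at \<xi>)"
    using has_derivative_proj_act[OF f, of \<xi>] \<xi> by auto
  then have "continuous (at \<xi>) (proj_act f)" using has_derivative_continuous by blast
  then have "(proj_act f \<longlongrightarrow> proj_act f \<xi>) (at \<xi> within ball 0 1)"
    by (simp add: isCont_def filterlim_at_within_If tendsto_within_subset continuous_at)
       (metis Lim_at_imp_Lim_at_within)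
  moreover have "eventually (\<lambda>z. F z = proj_act f z) (at \<xi> within ball 0 1)"
    by (auto simp: eventually_at_filter eq)
  ultimately show "(F \<longlongrightarrow> proj_act f \<xi>) (at \<xi> within ball 0 1)"
    using tendsto_cong by force
qed

lemma continuous_on_proj_act: "herm_iso f \<Longrightarrow> continuous_on (cball 0 1) (proj_act f)"
  by (metis continuous_at_imp_continuous_on has_derivative_continuous has_derivative_proj_act mem_cball_0)

text \<open>By compactness the closure of the image of the ball is the image of the closed ball;
  interior points stay interior, so only the image of the sphere meets the sphere.\<close>

lemma ideal_boundary_proj_act:
  assumes f: "herm_iso f" and eq: "\<And>z. z \<in> ball 0 1 \<Longrightarrow> F z = proj_act f z"
  shows "ideal_boundary (F ` ball 0 1) = proj_act f ` sphere 0 1"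
proof -
  have "F ` ball 0 1 = proj_act f ` ball 0 1" using eq by (intro image_cong) auto
  moreover have "closure (proj_act f ` ball 0 1) = proj_act f ` cball 0 1"
  proof
    have "closed (proj_act f ` cball 0 1)"
      by (intro compact_imp_closed compact_continuous_image continuous_on_proj_act f compact_cball)
    then show "closure (proj_act f ` ball 0 1) \<subseteq> proj_act f ` cball 0 1"
      by (intro closure_minimal image_mono) auto
    have "closure (ball 0 1) = cball (0 :: complex^'a) 1" by simp
    then show "proj_act f ` cball 0 1 \<subseteq> closure (proj_act f ` ball 0 1)"
      using image_closure_subset[of "ball 0 1" "proj_act f" "closure (proj_act f ` ball 0 1)"]
        continuous_on_proj_act[OF f] closure_subset[of "proj_act f ` ball 0 1"] by simp
  qed
  moreover have "proj_act f ` cball 0 1 \<inter> sphere 0 1 = proj_act f ` sphere 0 1"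
  proof -
    have "cball (0 :: complex^'a) 1 = ball 0 1 \<union> sphere 0 1" by auto
    then show ?thesis using proj_act_ball[OF f] proj_act_sphere[OF f] by fastforce
  qed
  ultimately show ?thesis by (simp add: ideal_boundary_def)
qed

lemma herm_iso_comp:
  "herm_iso f \<Longrightarrow> herm_iso g \<Longrightarrow> herm_iso (f \<circ> g)"
  by (simp add: herm_iso_def)

lemma proj_act_comp:
  assumes "herm_iso f" "herm_iso g" "norm z \<le> 1"
  shows "proj_act f (proj_act g z) = proj_act (f \<circ> g) z"
proof -
  have "g (homog z) $ None \<noteq> 0" by (rule herm_iso_None[OF assms(2,3)])
  then show ?thesis
    unfolding proj_act_def comp_def
    using homog_proj_act[OF assms(2,3)]
    by (simp add: proj_act_def herm_iso_scale[OF assms(1)] dehomog_scale)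
qed

section \<open>Triple products of points of the unit circle\<close>

lemma Re_tri_on_circle:
  assumes "norm a = 1" "norm b = 1" "norm c = 1"
  shows "Re (tri (homog (vec a :: complex^1)) (homog (vec b)) (homog (vec c))) = 0"
proof -
  define t where "t = (a * cnj b - 1) * (b * cnj c - 1) * (c * cnj a - 1)"
  have a: "a * cnj a = 1" and b: "b * cnj b = 1" and c: "c * cnj c = 1"
    using assms by (simp_all add: complex_norm_square[symmetric])
  \<comment> \<open>On the circle conjugation is inversion and multiplies a / b - 1 by - b / a; the
    three multipliers have product -1.\<close>
  have "cnj t + t = 0"
    unfolding t_def using a b c by simp algebra
  then have "Re (cnj t) + Re t = 0" by (metis plus_complex.sel(1) zero_complex.sel(1))
  then have "Re t = 0" by simp
  then show ?thesis by (simp add: tri_def herm_homog t_def)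
qed

text \<open>The sign fixes the dictionary for orientations: three angles in increasing order within
  one turn give a negative imaginary part.\<close>

lemma tri_on_circle:
  "tri (homog (vec (cis r) :: complex^1)) (homog (vec (cis s))) (homog (vec (cis t))) =
     - 8 * \<i> * of_real (sin ((r - s) / 2) * sin ((s - t) / 2) * sin ((t - r) / 2))"
proof -
  have cis1: "cis u - 1 = 2 * \<i> * of_real (sin (u / 2)) * cis (u / 2)" for u
  proof -
    have "cis u - 1 = (cis (u / 2) - cis (- (u / 2))) * cis (u / 2)"
      by (simp add: left_diff_distrib cis_mult)
    also have "cis (u / 2) - cis (- (u / 2)) = 2 * \<i> * of_real (sin (u / 2))"
      by (simp add: complex_eq_iff)
    finally show ?thesis .
  qed
  have "cis ((r - s) / 2) * cis ((s - t) / 2) * cis ((t - r) / 2) = 1"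
    by (simp add: cis_mult add_divide_distrib[symmetric])
  moreover have "tri (homog (vec (cis r) :: complex^1)) (homog (vec (cis s))) (homog (vec (cis t))) =
     (cis (r - s) - 1) * (cis (s - t) - 1) * (cis (t - r) - 1)"
    by (simp add: tri_def herm_homog cis_cnj cis_mult)
  ultimately show ?thesis unfolding cis1
    by (simp add: algebra_simps)
qed

section \<open>Classification of complex geodesics\<close>

lemma vec_of_index_1: "vec (z $ 1) = (z :: complex^1)"
  by (simp add: vec_eq_iff)

lemma norm_vec_1: "norm (vec a :: complex^1) = cmod a"
  by (simp add: norm_vector_1)

lemma Re_mult_cnj: "Re (a * cnj a) = (cmod a)\<^sup>2"
  by (metis Re_complex_of_real complex_norm_square)

lemma Re_cnj_mult_eqD:
  assumes "\<And>h. Re (cnj h * A) = Re (cnj h * B)"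
  shows "A = B"
  using assms[of 1] assms[of \<i>] by (simp add: complex_eq_iff)

lemma herm_iso_frame:
  assumes "herm P P = -1" "herm Q Q = 1" "herm P Q = 0"
  shows "herm_iso (\<lambda>v :: complex^(1 option). v $ None *s P + v $ Some 1 *s Q)"
proof -
  have "herm Q P = 0" using assms(3) herm_eq_0_commute by blast
  with assms show ?thesis
    unfolding herm_iso_def
    by (auto simp: vec_eq_iff algebra_simps herm_linear herm_def[where 'n = 1])
qed

text \<open>\<open>q\<close> is the hyperbolic cosine of half the distance; \<open>q \<ge> 1\<close>
  is what allows \<open>arcosh\<close> to be cancelled.\<close>

lemma cosh_ratio:
  fixes x y :: "complex^'n::finite"
  assumes x: "x \<in> ball 0 1" and y: "y \<in> ball 0 1"
  defines "q \<equiv> cmod (herm (homog x) (homog y)) /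
    sqrt (cmod (herm (homog x) (homog x)) * cmod (herm (homog y) (homog y)))"
  shows "q \<ge> 1"
    and "q\<^sup>2 * ((1 - (norm x)\<^sup>2) * (1 - (norm y)\<^sup>2)) = (cmod (herm (homog x) (homog y)))\<^sup>2"
proof -
  have self: "cmod (herm (homog z) (homog z)) = 1 - (norm z)\<^sup>2" if "z \<in> ball 0 1" for z :: "complex^'n"
  proof -
    have "(norm z)\<^sup>2 < 1" using that by (simp add: abs_square_less_1)
    then show ?thesis unfolding herm_homog_self norm_of_real by simp
  qed
  have pos: "(1 - (norm x)\<^sup>2) * (1 - (norm y)\<^sup>2) > 0"
    using x y by (simp add: abs_square_less_1)
  have q: "q = cmod (herm (homog x) (homog y)) / sqrt ((1 - (norm x)\<^sup>2) * (1 - (norm y)\<^sup>2))"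
    by (simp add: q_def self[OF x] self[OF y])
  have "(1 - (norm x)\<^sup>2) * (1 - (norm y)\<^sup>2) \<le> (cmod (herm (homog x) (homog y)))\<^sup>2"
    using reverse_Cauchy_Schwarz[of "homog x" "homog y"] x y
    unfolding herm_homog_self Re_complex_of_real by (simp add: abs_square_less_1 algebra_simps)
  then have "sqrt ((1 - (norm x)\<^sup>2) * (1 - (norm y)\<^sup>2)) \<le> cmod (herm (homog x) (homog y))"
    by (simp add: real_le_lsqrt)
  then show "q \<ge> 1" unfolding q using pos by simp
  show "q\<^sup>2 * ((1 - (norm x)\<^sup>2) * (1 - (norm y)\<^sup>2)) = (cmod (herm (homog x) (homog y)))\<^sup>2"
    unfolding q power_divide real_sqrt_pow2[OF less_imp_le[OF pos]] using pos by auto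
qed

context
  fixes f :: "complex^1 \<Rightarrow> complex^'n::finite"
  assumes f: "isometric_holomorphic_embedding f"
begin

text \<open>The isometry condition without root, \<open>arcosh\<close> and denominators, so that
  both sides can be differentiated.\<close>

lemma embedding_herm_eq:
  assumes z: "z \<in> ball 0 1" and w: "w \<in> ball 0 1"
  shows "(cmod (herm (homog (f z)) (homog (f w))))\<^sup>2 * ((1 - (norm z)\<^sup>2) * (1 - (norm w)\<^sup>2)) =
    (cmod (herm (homog z) (homog w)))\<^sup>2 * ((1 - (norm (f z))\<^sup>2) * (1 - (norm (f w))\<^sup>2))"
proof -
  have fb: "f z \<in> ball 0 1" "f w \<in> ball 0 1"
    using f z w by (auto simp: isometric_holomorphic_embedding_def)
  define q1 where "q1 = cmod (herm (homog z) (homog w)) /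
    sqrt (cmod (herm (homog z) (homog z)) * cmod (herm (homog w) (homog w)))"
  define q2 where "q2 = cmod (herm (homog (f z)) (homog (f w))) /
    sqrt (cmod (herm (homog (f z)) (homog (f z))) * cmod (herm (homog (f w)) (homog (f w))))"
  have "hyp_dist (f z) (f w) = hyp_dist z w"
    using f z w by (auto simp: isometric_holomorphic_embedding_def)
  then have "arcosh q2 = arcosh q1"
    unfolding hyp_dist_def q1_def q2_def by simp
  then have "q2 = q1"
    using cosh_ratio(1)[OF z w, folded q1_def] cosh_ratio(1)[OF fb, folded q2_def] cosh_arcosh_real by metis
  then show ?thesis
    unfolding cosh_ratio(2)[OF z w, folded q1_def, symmetric] cosh_ratio(2)[OF fb, folded q2_def, symmetric]
    by simp
qed

text \<open>Both sides of the isometry identity are differentiated with respect to the second point at \<open>0\<close>.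
  The result determines the product of the lift of \<open>f z\<close> with the derivative vector; the component
  orthogonal to the plane spanned by \<open>f 0\<close> and that vector then has length 0.\<close>

lemma embedding_eq_proj_act:
  "\<exists>g. herm_iso g \<and> (\<forall>z\<in>ball 0 1. f z = proj_act g z)"
proof -
  let ?F = "\<lambda>z. homog (f z)"
  let ?N = "\<lambda>z. 1 - (norm (f z))\<^sup>2"
  define F0 where "F0 = ?F 0"
  have FF: "herm (?F z) (?F z) = - of_real (?N z)" for z by (simp add: herm_homog_self)
  have Npos: "?N z > 0" if "z \<in> ball 0 1" for z
    using f that by (auto simp: isometric_holomorphic_embedding_def abs_square_less_1)
  obtain f' where f'0: "(f has_derivative f') (at 0 within ball 0 1)" and f's: "\<And>c v. f' (c *s v) = c *s f' v"
    using f unfolding isometric_holomorphic_embedding_def holomorphic_map_on_def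
    by (metis centre_in_ball zero_less_one)
  then have f': "(f has_derivative f') (at 0)" by (simp add: at_within_open[of 0 "ball 0 1"])
  define u where "u = f' (vec 1)"
  \<comment> \<open>The derivative of the lift of \<open>f\<close> at 0; its \<open>None\<close>
    coordinate is 0 because that of a lift is constant.\<close>
  define U where "U = (\<chi> k. case k of None \<Rightarrow> 0 | Some i \<Rightarrow> u $ i)"
  have hsum: "herm v (?F w) = (\<Sum>i\<in>UNIV. v $ Some i * cnj (f w $ i)) - v $ None" for v w
    by (simp add: herm_def homog_def)
  have vecl: "bounded_linear (vec :: complex \<Rightarrow> complex^1)"
  proof -
    have "linear (vec :: complex \<Rightarrow> complex^1)" by standard (auto simp: vec_eq_iff)
    then show ?thesis by (simp add: linear_conv_bounded_linear)
  qed
  have fd: "((\<lambda>c. f (vec c)) has_derivative (\<lambda>c. f' (vec c))) (at 0)"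
    using has_derivative_compose[OF bounded_linear_imp_has_derivative[OF vecl], of f f' 0 UNIV] f' by simp
  have f'vec: "f' (vec c) = c *s u" for c
    unfolding u_def by (subst f's[symmetric], rule arg_cong[of _ _ f']) (simp add: vec_eq_iff)
  have fid: "((\<lambda>c. f (vec c) $ i) has_derivative (\<lambda>c. c * u $ i)) (at 0)" for i
    using bounded_linear.has_derivative[OF bounded_linear_vec_nth fd, of i] unfolding f'vec by simp
  have dR: "((\<lambda>c. herm v (?F (vec c))) has_derivative (\<lambda>h. cnj h * herm v U)) (at 0)" for v
    unfolding hsum
    by (rule derivative_eq_intros has_derivative_cnj fid refl)+
       (simp add: herm_def U_def sum_distrib_left mult_ac)
  have dL: "((\<lambda>c. herm (?F (vec c)) v) has_derivative (\<lambda>h. h * herm U v)) (at 0)" for v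
    using has_derivative_cnj[OF dR[of v]] by (simp add: cnj_herm)
  have dN: "((\<lambda>c. ?N (vec c)) has_derivative (\<lambda>h. - 2 * Re (cnj h * herm F0 U))) (at 0)"
  proof -
    have Neq: "?N w = 1 - (\<Sum>i\<in>UNIV. Re (f w $ i * cnj (f w $ i)))" for w
      unfolding norm_vec_sq Re_mult_cnj ..
    have "((\<lambda>c. ?N (vec c)) has_derivative (\<lambda>h. 0 - (\<Sum>i\<in>UNIV. Re (f (vec 0) $ i * cnj (h * u $ i) + h * u $ i * cnj (f (vec 0) $ i))))) (at 0)"
      unfolding Neq
      by (intro has_derivative_diff has_derivative_const has_derivative_sum has_derivative_Re
          has_derivative_mult has_derivative_cnj fid)
    moreover have "0 - (\<Sum>i\<in>UNIV. Re (f (vec 0) $ i * cnj (h * u $ i) + h * u $ i * cnj (f (vec 0) $ i)))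
       = - 2 * Re (cnj h * herm F0 U)" for h
    proof -
      have "Re (a * cnj b + b * cnj a) = 2 * Re (a * cnj b)" for a b by simp
      then have "(\<Sum>i\<in>UNIV. Re (f (vec 0) $ i * cnj (h * u $ i) + h * u $ i * cnj (f (vec 0) $ i)))
         = 2 * Re (\<Sum>i\<in>UNIV. f (vec 0) $ i * cnj (h * u $ i))"
        by (simp only: sum_distrib_left Re_sum)
      also have "(\<Sum>i\<in>UNIV. f (vec 0) $ i * cnj (h * u $ i)) = cnj h * herm F0 U"
        by (simp add: herm_def F0_def U_def sum_distrib_left mult_ac)
      finally show ?thesis by simp
    qed
    ultimately show ?thesis by (simp only:)
  qed
  define N0 where "N0 = ?N 0"
  have N0: "N0 > 0" unfolding N0_def by (rule Npos) simp
  have F0F0: "herm F0 F0 = - of_real N0" unfolding F0_def N0_def by (rule FF)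
  have key: "of_real N0 * herm (?F z) U = - (herm (?F z) F0 * (z $ 1 * of_real N0 + herm F0 U))"
    if z: "z \<in> ball 0 1" for z
  proof -
    define r where "r = 1 - (norm z)\<^sup>2"
    have r: "r > 0" using z by (simp add: r_def abs_square_less_1)
    have eq: "Re (herm (?F z) (?F (vec c)) * cnj (herm (?F z) (?F (vec c)))) * (r * (1 - Re (c * cnj c))) =
      Re ((z $ 1 * cnj c - 1) * cnj (z $ 1 * cnj c - 1)) * (?N z * ?N (vec c))" if "c \<in> ball 0 1" for c
    proof -
      have "vec c \<in> ball (0 :: complex^1) 1" using that by (simp add: norm_vec_1)
      from embedding_herm_eq[OF z this] show ?thesis
        unfolding Re_mult_cnj by (simp add: r_def herm_homog norm_vec_1)
    qed
    define L where "L c = Re (herm (?F z) (?F (vec c)) * cnj (herm (?F z) (?F (vec c)))) * (r * (1 - Re (c * cnj c)))" for c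
    define R where "R c = Re ((z $ 1 * cnj c - 1) * cnj (z $ 1 * cnj c - 1)) * (?N z * ?N (vec c))" for c
    have id: "((\<lambda>c. c) has_derivative (\<lambda>h. h)) (at (0::complex))" by (rule has_derivative_ident)
    have "(L has_derivative (\<lambda>h. Re (herm (?F z) (?F (vec 0)) * cnj (herm (?F z) (?F (vec 0)))) * (r * (0 - Re (0 * cnj h + h * cnj 0))) +
        Re (herm (?F z) (?F (vec 0)) * cnj (cnj h * herm (?F z) U) + (cnj h * herm (?F z) U) * cnj (herm (?F z) (?F (vec 0)))) * (r * (1 - Re (0 * cnj 0))))) (at 0)"
      unfolding L_def
      by (intro has_derivative_mult has_derivative_Re has_derivative_cnj dR has_derivative_mult_right
          has_derivative_diff has_derivative_const id)
    then have Ld: "(L has_derivative (\<lambda>h. Re (cnj h * (2 * of_real r * cnj (herm (?F z) F0) * herm (?F z) U)))) (at 0)"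
      by (rule has_derivative_eq_rhs) (auto simp: F0_def algebra_simps)
    have "(R has_derivative (\<lambda>h. Re ((z $ 1 * cnj 0 - 1) * cnj (z $ 1 * cnj 0 - 1)) * (?N z * (- 2 * Re (cnj h * herm F0 U))) +
        Re ((z $ 1 * cnj 0 - 1) * cnj (z $ 1 * cnj h - 0) + (z $ 1 * cnj h - 0) * cnj (z $ 1 * cnj 0 - 1)) * (?N z * ?N (vec 0)))) (at 0)"
      unfolding R_def
      by (intro has_derivative_mult has_derivative_Re has_derivative_cnj dN has_derivative_mult_right
          has_derivative_diff has_derivative_const id)
    then have Rd: "(R has_derivative (\<lambda>h. Re (cnj h * (- 2 * of_real (?N z) * (z $ 1 * of_real N0 + herm F0 U))))) (at 0)"
      by (rule has_derivative_eq_rhs) (auto simp: N0_def algebra_simps)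
    have "(R has_derivative (\<lambda>h. Re (cnj h * (2 * of_real r * cnj (herm (?F z) F0) * herm (?F z) U)))) (at 0)"
      by (rule has_derivative_transform_within_open[OF Ld, of "ball 0 1"]) (use eq in \<open>auto simp: L_def R_def\<close>)
    from fun_cong[OF has_derivative_unique[OF this Rd]]
    have "2 * of_real r * cnj (herm (?F z) F0) * herm (?F z) U = - 2 * of_real (?N z) * (z $ 1 * of_real N0 + herm F0 U)"
      by (rule Re_cnj_mult_eqD)
    \<comment> \<open>This factor completes the conjugate one to a squared modulus, which times
      \<open>r\<close> equals \<open>?N z * N0\<close> by the isometry identity at 0.\<close>
    then have "herm (?F z) F0 * (of_real r * cnj (herm (?F z) F0) * herm (?F z) U) =
       herm (?F z) F0 * (- of_real (?N z) * (z $ 1 * of_real N0 + herm F0 U))"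
      by (metis (no_types, opaque_lifting) mult.assoc mult_cancel_left mult_minus_left mult_minus_right zero_neq_numeral)
    moreover have "herm (?F z) F0 * cnj (herm (?F z) F0) * of_real r = of_real (?N z * N0)"
    proof -
      have "(cmod (herm (?F z) F0))\<^sup>2 * r = ?N z * N0"
        using embedding_herm_eq[OF z, of 0] by (simp add: F0_def N0_def r_def herm_homog)
      then show ?thesis by (metis complex_norm_square of_real_mult)
    qed
    ultimately have "of_real (?N z) * (of_real N0 * herm (?F z) U) =
       of_real (?N z) * - (herm (?F z) F0 * (z $ 1 * of_real N0 + herm F0 U))"
      by (simp only: of_real_mult) algebra
    then show ?thesis using Npos[OF z] by (metis less_irrefl mult_cancel_left of_real_eq_0_iff)
  qed
  \<comment> \<open>Gram-Schmidt: the part of \<open>U\<close> orthogonal to \<open>F0\<close>, with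
    a plus sign because \<open>herm F0 F0\<close> is negative.\<close>
  define U' where "U' = U + (herm U F0 / of_real N0) *s F0"
  have U'F0: "herm U' F0 = 0" using N0 by (simp add: U'_def herm_linear F0F0)
  have FU': "herm (?F z) U' = - (z $ 1 * herm (?F z) F0)" if "z \<in> ball 0 1" for z
  proof -
    have "of_real N0 * herm (?F z) U' = of_real N0 * herm (?F z) U + herm F0 U * herm (?F z) F0"
      using N0 by (simp add: U'_def herm_linear cnj_herm algebra_simps)
    also have "\<dots> = of_real N0 * - (z $ 1 * herm (?F z) F0)"
      unfolding key[OF that] by (simp add: algebra_simps)
    finally show ?thesis using N0 by (metis less_irrefl mult_cancel_left of_real_eq_0_iff)
  qed
  \<comment> \<open>The formula for \<open>herm (?F z) U'\<close> is differentiated at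
    \<open>z = 0\<close>.\<close>
  have "herm U U' = of_real N0"
  proof -
    have "((\<lambda>c. - (c * herm (?F (vec c)) F0)) has_derivative (\<lambda>h. - (0 * (h * herm U F0) + h * herm (?F (vec 0)) F0))) (at 0)"
      by (intro has_derivative_minus has_derivative_mult dL has_derivative_ident)
    moreover have "((\<lambda>c. - (c * herm (?F (vec c)) F0)) has_derivative (\<lambda>h. h * herm U U')) (at 0)"
      by (rule has_derivative_transform_within_open[OF dL, of "ball 0 1"]) (auto simp: FU' norm_vec_1)
    ultimately have "(\<lambda>h. - (0 * (h * herm U F0) + h * herm (?F (vec 0)) F0)) = (\<lambda>h. h * herm U U')"
      by (rule has_derivative_unique)
    from fun_cong[OF this, of 1] show ?thesis using F0F0 by (simp add: F0_def)
  qed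
  moreover have "herm F0 U' = 0" using U'F0 herm_eq_0_commute by blast
  ultimately have U'U': "herm U' U' = of_real N0"
    unfolding U'_def herm_add_left herm_scale_left by (simp add: U'_def)
  \<comment> \<open>\<open>F0\<close> and \<open>U'\<close> have products \<open>- N0\<close> and
    \<open>N0\<close> with themselves; this factor makes them a frame for
    \<open>herm_iso_frame\<close>.\<close>
  define s where "s = complex_of_real (1 / sqrt N0)"
  have s: "s * cnj s * of_real N0 = 1" "s \<noteq> 0"
    using N0 by (simp_all add: s_def flip: of_real_mult)
  define g where "g = (\<lambda>v :: complex^(1 option). v $ None *s (s *s F0) + v $ Some 1 *s (s *s U'))"
  have g: "herm_iso g" unfolding g_def
    by (rule herm_iso_frame)
       (use s \<open>herm F0 U' = 0\<close> in \<open>simp_all add: herm_linear F0F0 U'U' algebra_simps\<close>)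
  have "f z = proj_act g z" if z: "z \<in> ball 0 1" for z
  proof -
    define l where "l = - (herm (?F z) F0 / of_real N0)"
    have abs: "(cmod (herm (?F z) F0))\<^sup>2 * (1 - (norm z)\<^sup>2) = ?N z * N0"
      using embedding_herm_eq[OF z, of 0] by (simp add: F0_def N0_def herm_homog)
    then have "herm (?F z) F0 \<noteq> 0" using Npos[OF z] N0 by auto
    then have l: "l \<noteq> 0" using N0 by (simp add: l_def)
    define R where "R = ?F z - l *s (F0 + z $ 1 *s U')"
    have RF0: "herm R F0 = 0" using N0 by (simp add: R_def herm_linear F0F0 U'F0 l_def)
    have RU': "herm R U' = 0"
      using N0 by (simp add: R_def herm_linear U'U' \<open>herm F0 U' = 0\<close> FU'[OF z] l_def)
    have Feq: "?F z = l *s (F0 + z $ 1 *s U') + R" by (simp add: R_def)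
    have RR0: "herm F0 R = 0" "herm U' R = 0" using RF0 RU' herm_eq_0_commute by blast+
    have "- of_real (?N z) = herm (?F z) (?F z)" by (simp only: FF)
    also have "\<dots> = l * cnj l * (- of_real N0 + z $ 1 * cnj (z $ 1) * of_real N0) + herm R R"
      unfolding Feq by (simp add: herm_linear RF0 RU' RR0 F0F0 U'U' U'F0 \<open>herm F0 U' = 0\<close> algebra_simps)
    also have "\<dots> = - of_real ((cmod l)\<^sup>2 * N0 * (1 - (norm z)\<^sup>2)) + herm R R"
      by (simp add: complex_norm_square[symmetric] norm_vector_1 algebra_simps)
    also have "(cmod l)\<^sup>2 * N0 * (1 - (norm z)\<^sup>2) = ?N z"
    proof -
      have "(cmod l)\<^sup>2 * N0\<^sup>2 = (cmod (herm (?F z) F0))\<^sup>2"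
        using N0 by (simp add: l_def norm_divide power_divide)
      note A = this
      have "N0 * ((cmod l)\<^sup>2 * N0 * (1 - (norm z)\<^sup>2)) = N0 * ?N z"
        using abs[folded A] by (simp only: power2_eq_square mult_ac)
      then show ?thesis using N0 by (metis less_irrefl mult_cancel_left)
    qed
    finally have "herm R R = 0" by simp
    moreover have "Re (herm F0 F0) < 0" using N0 by (simp add: F0F0)
    ultimately have "R = 0" using orthogonal_to_timelike(2) RF0 by (metis zero_complex.sel(1))
    then have "?F z = (l / s) *s g (homog z)" using Feq s(2)
      by (simp add: g_def vec_eq_iff algebra_simps)
    then have "dehomog (?F z) = dehomog ((l / s) *s g (homog z))" by simp
    then show ?thesis using l s(2) by (simp add: proj_act_def dehomog_scale)
  qed
  with g show ?thesis by blast
qed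

end

section \<open>Triple products, transvections and chains\<close>

abbreviation hp where "hp x y \<equiv> herm (homog x) (homog y)"

definition trip where "trip x y z = tri (homog x) (homog y) (homog z)"

lemma trip_rotate: "trip x y z = trip y z x"
  unfolding trip_def by (rule tri_rotate)

lemma trip_swap: "trip x z y = cnj (trip x y z)"
  unfolding trip_def by (rule tri_swap)

lemma trip_proj_act:
  assumes g: "herm_iso g" and "norm a \<le> 1" "norm b \<le> 1" "norm c \<le> 1"
  obtains k where "k > 0" "trip (proj_act g a) (proj_act g b) (proj_act g c) = of_real k * trip a b c"
proof -
  let ?n = "\<lambda>z. 1 / g (homog z) $ None"
  have "?n a \<noteq> 0" "?n b \<noteq> 0" "?n c \<noteq> 0" using herm_iso_None[OF g] assms by auto
  then have "(cmod (?n a))\<^sup>2 * (cmod (?n b))\<^sup>2 * (cmod (?n c))\<^sup>2 > 0" by simp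
  moreover have "trip (proj_act g a) (proj_act g b) (proj_act g c) =
    of_real ((cmod (?n a))\<^sup>2 * (cmod (?n b))\<^sup>2 * (cmod (?n c))\<^sup>2) * trip a b c"
    using assms unfolding trip_def by (simp only: homog_proj_act[OF g] tri_scale)
      (simp only: tri_def herm_iso_herm[OF g])
  ultimately show ?thesis by (rule that)
qed

lemma proj_act_circleE:
  fixes g :: "complex^(1 option) \<Rightarrow> complex^('n::finite option)"
  assumes "z \<in> proj_act g ` sphere 0 1"
  obtains a where "cmod a = 1" "z = proj_act g (vec a)"
proof -
  obtain v where v: "v \<in> sphere 0 1" "z = proj_act g v" using assms by blast
  show ?thesis
    by (rule that[of "v $ 1"]) (use v in \<open>simp_all add: vec_of_index_1 norm_vector_1\<close>)
qed

lemma trip_same: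
  assumes "x \<in> sphere 0 1" "y \<in> sphere 0 1"
  shows "trip x y x = 0" "trip x y y = 0"
  using assms by (simp_all add: trip_def tri_def hp_self)

lemma Re_trip_nonpos:
  assumes "x \<in> sphere 0 1" "y \<in> sphere 0 1" "z \<in> sphere 0 1"
  shows "Re (trip x y z) \<le> 0"
proof (cases "x = y")
  case True
  then show ?thesis using assms by (simp add: trip_def tri_def hp_self)
next
  case False
  then show ?thesis
    unfolding trip_def by (intro isotropic_triple(1) hp_self hp_nonzero assms)
qed

section \<open>Unipotent transvections and the coordinate they give on a chain\<close>

definition tvec :: "complex^('n::finite option) \<Rightarrow> real \<Rightarrow> complex^('n option) \<Rightarrow> complex^('n option)" where
  "tvec Y s v = v + (\<i> * of_real s * herm v Y) *s Y"

text \<open>The two cross terms carry \<i> and its conjugate and cancel.\<close>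

lemma herm_iso_tvec:
  assumes "herm Y Y = 0"
  shows "herm_iso (tvec Y s)"
  using assms unfolding herm_iso_def tvec_def
  by (auto simp: herm_linear vec_eq_iff algebra_simps cnj_herm)

lemma tvec_add: "herm Y Y = 0 \<Longrightarrow> tvec Y s (tvec Y t v) = tvec Y (s + t) v"
  by (simp add: tvec_def herm_linear vec_eq_iff algebra_simps)

definition transv where "transv y s x = proj_act (tvec (homog y) s) x"

lemma transv_sphere: "x \<in> sphere 0 1 \<Longrightarrow> y \<in> sphere 0 1 \<Longrightarrow> transv y s x \<in> sphere 0 1"
  unfolding transv_def
  by (rule proj_act_sphere[OF herm_iso_tvec[OF hp_self]])

lemma transv_0 [simp]: "transv y 0 x = x"
  by (simp add: transv_def proj_act_def tvec_def)

lemma transv_add: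
  assumes "x \<in> sphere 0 1" "y \<in> sphere 0 1"
  shows "transv y s (transv y t x) = transv y (s + t) x"
proof -
  note Y = hp_self[OF assms(2)]
  have "transv y s (transv y t x) = proj_act (tvec (homog y) s \<circ> tvec (homog y) t) x"
    unfolding transv_def using assms by (intro proj_act_comp herm_iso_tvec Y) auto
  also have "tvec (homog y) s \<circ> tvec (homog y) t = tvec (homog y) (s + t)"
    by (simp add: fun_eq_iff tvec_add[OF Y])
  finally show ?thesis by (simp add: transv_def)
qed

lemma homog_transv:
  assumes "x \<in> sphere 0 1" "y \<in> sphere 0 1"
  obtains c where "c \<noteq> 0" "homog (transv y s x) = c *s tvec (homog y) s (homog x)"
proof (rule that)
  note g = herm_iso_tvec[OF hp_self[OF assms(2)], of s]
  show "1 / tvec (homog y) s (homog x) $ None \<noteq> 0"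
    using herm_iso_None[OF g, of x] assms(1) by simp
  show "homog (transv y s x) = (1 / tvec (homog y) s (homog x) $ None) *s tvec (homog y) s (homog x)"
    unfolding transv_def using homog_proj_act[OF g, of x] assms(1) by simp
qed

text \<open>Conjugation carries a transvection about \<open>y\<close> to one about the image of
  \<open>y\<close>. The lift \<open>g (homog y)\<close> differs from the normalised lift by its
  \<open>None\<close> coordinate, whose squared modulus goes into the parameter.\<close>

lemma proj_act_transv:
  assumes g: "herm_iso g" and x: "x \<in> sphere 0 1" and y: "y \<in> sphere 0 1"
  shows "proj_act g (transv y s x) =
    transv (proj_act g y) (s * (cmod (g (homog y) $ None))\<^sup>2) (proj_act g x)"
proof -
  let ?l = "g (homog y) $ None" and ?m = "g (homog x) $ None"
  have l: "?l \<noteq> 0" and m: "?m \<noteq> 0" using herm_iso_None[OF g] x y by auto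
  have hx: "homog (proj_act g x) = (1 / ?m) *s g (homog x)"
    and hy: "homog (proj_act g y) = (1 / ?l) *s g (homog y)"
    using homog_proj_act[OF g] x y by auto
  have "of_real ((cmod ?l)\<^sup>2) * (1 / cnj ?l * (1 / ?l)) = 1"
    using l unfolding complex_norm_square by simp
  then have "tvec (homog (proj_act g y)) (s * (cmod ?l)\<^sup>2) (homog (proj_act g x)) =
     (1 / ?m) *s tvec (g (homog y)) s (g (homog x))"
    unfolding hx hy tvec_def by (simp add: herm_linear vec_eq_iff algebra_simps del: of_real_power)
  also have "tvec (g (homog y)) s (g (homog x)) = g (tvec (homog y) s (homog x))"
    by (simp add: tvec_def herm_iso_add[OF g] herm_iso_scale[OF g] herm_iso_herm[OF g])
  finally have "transv (proj_act g y) (s * (cmod ?l)\<^sup>2) (proj_act g x) =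
      proj_act (g \<circ> tvec (homog y) s) x"
    using m by (simp add: transv_def proj_act_def dehomog_scale)
  also have "\<dots> = proj_act g (transv y s x)"
    unfolding transv_def using x y
    by (intro proj_act_comp[symmetric] g herm_iso_tvec hp_self) auto
  finally show ?thesis by simp
qed

text \<open>The parameter that takes \<open>x\<close> to \<open>z\<close> along their chain with
  \<open>y\<close>. The powers in the denominator make it independent of the lifts of
  \<open>x\<close> and \<open>z\<close>, while it scales with the lift of \<open>y\<close> as a
  transvection parameter does.\<close>

definition tcoef where
  "tcoef y x z = Im (trip x y z) / ((cmod (hp z y))\<^sup>2 * (cmod (hp y x))\<^sup>2)"

lemma transv_ne:
  assumes "x \<in> sphere 0 1" "y \<in> sphere 0 1" "x \<noteq> y"
  shows "transv y s x \<noteq> y"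
proof -
  obtain c where c: "c \<noteq> 0" "homog (transv y s x) = c *s tvec (homog y) s (homog x)"
    using homog_transv assms(1,2) by blast
  then have "hp (transv y s x) y = c * hp x y"
    using hp_self[OF assms(2)] by (simp add: tvec_def herm_linear)
  then show ?thesis
    using c hp_nonzero[OF assms] hp_self[OF assms(2)] by auto
qed

lemma trip_transv:
  assumes "x \<in> sphere 0 1" "y \<in> sphere 0 1" "x \<noteq> y"
  shows "Re (trip x y (transv y s x)) = 0" "tcoef y x (transv y s x) = s"
proof -
  obtain c where c: "c \<noteq> 0" "homog (transv y s x) = c *s tvec (homog y) s (homog x)"
    using homog_transv assms(1,2) by blast
  note X = hp_self[OF assms(1)] and Y = hp_self[OF assms(2)]
  have xy: "hp x y \<noteq> 0" by (rule hp_nonzero[OF assms])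
  have 1: "hp (transv y s x) y = c * hp x y" "hp y (transv y s x) = cnj c * hp y x"
    "hp (transv y s x) x = c * (\<i> * s * hp x y * hp y x)"
    unfolding c(2) using X Y by (simp_all add: tvec_def herm_linear)
  have "trip x y (transv y s x) = hp x y * (cnj c * hp y x) * (c * (\<i> * s * hp x y * hp y x))"
    unfolding trip_def tri_def 1 by simp
  also have "\<dots> = \<i> * s * ((c * cnj c) * (hp x y * hp y x) * (hp x y * hp y x))"
    by (simp add: algebra_simps)
  also have "\<dots> = \<i> * of_real (s * ((cmod c)\<^sup>2 * (cmod (hp x y))\<^sup>2 * (cmod (hp x y))\<^sup>2))"
    unfolding herm_mult_commute complex_norm_square[symmetric] by simp
  finally have t: "trip x y (transv y s x) = \<dots>" .
  then show "Re (trip x y (transv y s x)) = 0" by simp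
  show "tcoef y x (transv y s x) = s"
    unfolding tcoef_def t 1 using xy c(1)
    by (simp add: cmod_herm_sym[of "homog y" "homog x"] norm_mult power_mult_distrib)
qed

lemma transv_tcoef:
  assumes x: "x \<in> sphere 0 1" and y: "y \<in> sphere 0 1" and z: "z \<in> sphere 0 1"
    and ne: "x \<noteq> y" "z \<noteq> y" and Re0: "Re (trip x y z) = 0"
  shows "z = transv y (tcoef y x z) x"
proof -
  let ?X = "homog x" and ?Y = "homog y" and ?Z = "homog z"
  have nz: "hp x y \<noteq> 0" "hp z y \<noteq> 0" "hp y x \<noteq> 0" "hp y z \<noteq> 0"
    using hp_nonzero x y z ne by (metis, metis, metis, metis)
  have Z: "?Z = (hp z y / hp x y) *s ?X + (hp z x / hp y x) *s ?Y"
    using isotropic_triple(2)[OF hp_self[OF x] hp_self[OF y] hp_self[OF z] nz(1)]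
      Re0 by (simp add: trip_def)
  have "\<i> * of_real (tcoef y x z) = trip x y z / (of_real ((cmod (hp z y))\<^sup>2) * of_real ((cmod (hp y x))\<^sup>2))"
    unfolding tcoef_def using Re0 by (simp add: complex_eq_iff del: of_real_power)
  also have "\<dots> = hp z x * hp x y / (hp y x * hp x y * hp z y)"
    unfolding herm_mult_commute[symmetric] trip_def tri_def using nz by simp
  finally have "\<i> * of_real (tcoef y x z) * hp x y = (hp x y / hp z y) * (hp z x / hp y x)"
    using nz by (simp add: mult.commute)
  then have "tvec ?Y (tcoef y x z) ?X = (hp x y / hp z y) *s ((hp z y / hp x y) *s ?X + (hp z x / hp y x) *s ?Y)"
    using nz by (simp add: tvec_def vec_eq_iff algebra_simps)
  also have "\<dots> = (hp x y / hp z y) *s ?Z" by (simp only: Z[symmetric])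
  finally show ?thesis
    using nz by (simp add: transv_def proj_act_def dehomog_scale)
qed

section \<open>Chains: equation, parametrisation and comparison with geodesics\<close>

definition chain_through :: "complex^'n::finite \<Rightarrow> complex^'n \<Rightarrow> (complex^'n) set" where
  "chain_through x y = {z \<in> sphere 0 1. Re (trip x y z) = 0}"

lemma chain_through_eq:
  assumes "x \<in> sphere 0 1" "y \<in> sphere 0 1" "x \<noteq> y"
  shows "chain_through x y = insert y (range (\<lambda>s. transv y s x))"
proof
  show "chain_through x y \<subseteq> insert y (range (\<lambda>s. transv y s x))"
    using transv_tcoef[OF assms(1,2) _ assms(3)] by (auto simp: chain_through_def)
  show "insert y (range (\<lambda>s. transv y s x)) \<subseteq> chain_through x y"
    using assms trip_transv[OF assms] transv_sphere[OF assms(1,2)] trip_same[OF assms(1,2)]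
    by (auto simp: chain_through_def)
qed

text \<open>Parametrises the unit circle without -1 by the real line; the missing point corresponds
  to the end about which a chain is translated.\<close>

definition cayley :: "real \<Rightarrow> complex" where
  "cayley l = (1 + \<i> * of_real l) / (1 - \<i> * of_real l)"

lemma cayley_denom: "1 - \<i> * of_real l \<noteq> 0"
  by (simp add: complex_eq_iff)

lemma norm_cayley: "cmod (cayley l) = 1"
proof -
  have "cmod (1 + \<i> * of_real l) = cmod (1 - \<i> * of_real l)"
    by (simp add: cmod_def)
  then show ?thesis using cayley_denom[of l] by (simp add: cayley_def norm_divide)
qed

text \<open>The Cayley coordinate becomes the transvection parameter up to a constant, so null sets
  of a circle can be read as null sets of parameters.\<close>

lemma chain_parametrisation:
  assumes x: "x \<in> sphere 0 1" and y: "y \<in> sphere 0 1" and ne: "x \<noteq> y"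
  obtains g where "herm_iso g"
    "\<And>l. proj_act g (vec (cayley l) :: complex^1) = transv y (2 * l / (cmod (hp x y))\<^sup>2) x"
    "proj_act g (vec (- 1)) = y"
proof -
  let ?X = "homog x"
  \<comment> \<open>With \<open>herm ?X Y = - 2\<close>, half the sum and half the difference of
    \<open>?X\<close> and \<open>Y\<close> are orthogonal with products -1 and 1.\<close>
  define Y where "Y = (- 2 / hp y x) *s homog y"
  have nz: "hp x y \<noteq> 0" "hp y x \<noteq> 0" using hp_nonzero x y ne by metis+
  have XX: "herm ?X ?X = 0" and YY: "herm Y Y = 0"
    using x y by (simp_all add: Y_def herm_linear hp_self)
  have XY: "herm ?X Y = - 2" "herm Y ?X = - 2"
    using nz by (simp_all add: Y_def herm_linear cnj_herm)
  define g where "g = (\<lambda>v :: complex^(1 option). v $ None *s ((1/2) *s (?X + Y)) + v $ Some 1 *s ((1/2) *s (?X - Y)))"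
  have g: "herm_iso g" unfolding g_def
    by (rule herm_iso_frame) (simp_all add: herm_linear XX YY XY)
  have gh: "g (homog (vec a)) = ((1 + a) / 2) *s ?X + ((1 - a) / 2) *s Y" for a
    by (simp add: g_def vec_eq_iff field_simps)
  show ?thesis
  proof (rule that[OF g])
    fix l :: real
    let ?d = "1 - \<i> * of_real l"
    have d: "?d \<noteq> 0" by (rule cayley_denom)
    have a: "(1 + cayley l) / 2 = 1 / ?d" "(1 - cayley l) / 2 = - (\<i> * of_real l) / ?d"
      using d by (simp_all add: cayley_def field_simps)
    have c: "- (\<i> * of_real l) * (- 2 / hp y x) = \<i> * of_real (2 * l / (cmod (hp x y))\<^sup>2) * hp x y"
    proof -
      have "of_real (2 * l / (cmod (hp x y))\<^sup>2) * hp x y = 2 * l / (hp x y * hp y x) * hp x y"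
        unfolding herm_mult_commute by simp
      then have "\<i> * (of_real (2 * l / (cmod (hp x y))\<^sup>2) * hp x y) = - (\<i> * of_real l) * (- 2 / hp y x)"
        using nz by simp
      then show ?thesis by (simp only: mult.assoc)
    qed
    have "g (homog (vec (cayley l))) = (1 / ?d) *s (?X + (- (\<i> * of_real l) * (- 2 / hp y x)) *s homog y)"
      unfolding gh a Y_def by (simp add: vec_eq_iff field_simps d)
    also have "\<dots> = (1 / ?d) *s tvec (homog y) (2 * l / (cmod (hp x y))\<^sup>2) ?X"
      unfolding c tvec_def ..
    finally show "proj_act g (vec (cayley l)) = transv y (2 * l / (cmod (hp x y))\<^sup>2) x"
      using d by (simp add: proj_act_def transv_def dehomog_scale)
  next
    have "g (homog (vec (- 1))) = (- 2 / hp y x) *s homog y" unfolding gh by (simp add: Y_def vec_eq_iff)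
    then show "proj_act g (vec (- 1)) = y"
      unfolding proj_act_def using dehomog_scale[of "- 2 / hp y x" "homog y"] nz by simp
  qed
qed

lemma chain_through_image:
  assumes x: "x \<in> sphere 0 1" and y: "y \<in> sphere 0 1" and ne: "x \<noteq> y"
    and g: "herm_iso g"
    "\<And>l. proj_act g (vec (cayley l) :: complex^1) = transv y (2 * l / (cmod (hp x y))\<^sup>2) x"
    "proj_act g (vec (- 1)) = y"
  shows "proj_act g ` sphere 0 1 = chain_through x y"
proof
  have x1: "proj_act g (vec 1) = x" using g(2)[of 0] by (simp add: cayley_def)
  show "proj_act g ` sphere 0 1 \<subseteq> chain_through x y"
  proof
    fix z assume "z \<in> proj_act g ` sphere 0 1"
    then obtain a where a: "cmod a = 1" "z = proj_act g (vec a)" by (rule proj_act_circleE)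
    then have "Re (trip (vec 1 :: complex^1) (vec (- 1)) (vec a)) = 0"
      unfolding trip_def by (intro Re_tri_on_circle) simp_all
    moreover have n: "norm (vec 1 :: complex^1) \<le> 1" "norm (vec (- 1) :: complex^1) \<le> 1" "norm (vec a :: complex^1) \<le> 1"
      using a by (simp_all add: norm_vector_1)
    moreover obtain k where "k > 0" "trip (proj_act g (vec 1)) (proj_act g (vec (- 1))) (proj_act g (vec a)) =
        of_real k * trip (vec 1 :: complex^1) (vec (- 1)) (vec a)"
      by (rule trip_proj_act[OF g(1) n])
    moreover have "z \<in> sphere 0 1" using a proj_act_sphere[OF g(1)] by (simp add: norm_vec_1)
    ultimately show "z \<in> chain_through x y"
      using a x1 g(3) by (simp add: chain_through_def)
  qed
  show "chain_through x y \<subseteq> proj_act g ` sphere 0 1"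
    unfolding chain_through_eq[OF x y ne]
  proof (safe)
    show "y \<in> proj_act g ` sphere 0 1"
      by (rule image_eqI[of _ _ "vec (- 1)"]) (simp_all add: norm_vector_1 g(3))
  next
    fix s
    have "transv y s x = proj_act g (vec (cayley (s * (cmod (hp x y))\<^sup>2 / 2)))"
      using hp_nonzero[OF x y ne] by (simp add: g(2))
    then show "transv y s x \<in> proj_act g ` sphere 0 1"
      by (rule image_eqI[of _ _ "vec (cayley (s * (cmod (hp x y))\<^sup>2 / 2))"])
         (simp add: norm_vector_1 norm_cayley)
  qed
qed

lemma chain_of_proj_act: "herm_iso g \<Longrightarrow> chain_of (proj_act g) = proj_act g ` sphere 0 1"
  unfolding chain_of_def by (rule ideal_boundary_proj_act) auto

lemma is_chain_iff:
  "is_chain C \<longleftrightarrow> (\<exists>g :: complex^(1 option) \<Rightarrow> _. herm_iso g \<and> C = proj_act g ` sphere 0 1)"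
proof
  assume "is_chain C"
  then obtain f :: "complex^1 \<Rightarrow> _" where f: "isometric_holomorphic_embedding f" "C = chain_of f"
    by (auto simp: is_chain_def)
  obtain g where g: "herm_iso g" "\<forall>z\<in>ball 0 1. f z = proj_act g z"
    using embedding_eq_proj_act[OF f(1)] by blast
  show "\<exists>g :: complex^(1 option) \<Rightarrow> _. herm_iso g \<and> C = proj_act g ` sphere 0 1"
    using g f(2) ideal_boundary_proj_act[OF g(1), of f] by (auto simp: chain_of_def)
next
  assume "\<exists>g :: complex^(1 option) \<Rightarrow> _. herm_iso g \<and> C = proj_act g ` sphere 0 1"
  then show "is_chain C"
    unfolding is_chain_def using chain_of_proj_act embedding_proj_act by metis
qed

lemma is_chain_through:
  assumes "x \<in> sphere 0 1" "y \<in> sphere 0 1" "x \<noteq> y"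
  shows "is_chain (chain_through x y)"
  unfolding is_chain_iff
  by (rule chain_parametrisation[OF assms]) (use chain_through_image[OF assms] in blast)

lemma on_common_chainD:
  assumes "on_common_chain x y z"
  shows "x \<in> sphere 0 1" "y \<in> sphere 0 1" "z \<in> sphere 0 1" "Re (trip x y z) = 0"
proof -
  obtain g :: "complex^(1 option) \<Rightarrow> _" where g: "herm_iso g"
    and xyz: "x \<in> proj_act g ` sphere 0 1" "y \<in> proj_act g ` sphere 0 1" "z \<in> proj_act g ` sphere 0 1"
    using assms by (auto simp: on_common_chain_def is_chain_iff)
  then show "x \<in> sphere 0 1" "y \<in> sphere 0 1" "z \<in> sphere 0 1"
    using proj_act_sphere[OF g] by blast+
  obtain a b c where abc: "a \<in> sphere 0 1" "b \<in> sphere 0 1" "c \<in> sphere 0 1"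
      "x = proj_act g a" "y = proj_act g b" "z = proj_act g c"
    using xyz by blast
  obtain k where "k > 0" "trip x y z = of_real k * trip a b c"
    unfolding abc by (rule trip_proj_act[OF g, of a b c]) (use abc in auto)
  moreover have "Re (trip a b c) = 0"
    using Re_tri_on_circle[of "a $ 1" "b $ 1" "c $ 1"] abc(1-3)
    by (simp add: trip_def vec_of_index_1 norm_vector_1)
  ultimately show "Re (trip x y z) = 0" by simp
qed

lemma boundary_map_embedding:
  fixes f :: "complex^1 \<Rightarrow> complex^'n::finite"
  assumes "isometric_holomorphic_embedding f"
  obtains g :: "complex^(1 option) \<Rightarrow> complex^('n option)"
    where "herm_iso g" "\<And>a. a \<in> sphere 0 1 \<Longrightarrow> boundary_map f a = proj_act g a"
proof -
  obtain g :: "complex^(1 option) \<Rightarrow> complex^('n option)"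
    where g: "herm_iso g" "\<forall>z\<in>ball 0 1. f z = proj_act g z"
    using embedding_eq_proj_act[OF assms] by blast
  with boundary_map_proj_act[OF g(1), of f] show ?thesis by (intro that[of g]) auto
qed

section \<open>Orientation as the sign of an imaginary part\<close>

lemma positively_orientedD:
  assumes "positively_oriented x y z"
  shows "Im (trip x y z) < 0"
proof -
  obtain f :: "complex^1 \<Rightarrow> _" and r s t where f: "isometric_holomorphic_embedding f"
    and rst: "r < s" "s < t" "t < r + 2 * pi"
    and xyz: "x = boundary_map f (vec (cis r))" "y = boundary_map f (vec (cis s))" "z = boundary_map f (vec (cis t))"
    using assms by (auto simp: positively_oriented_def)
  obtain g where g: "herm_iso g" "\<And>a. a \<in> sphere 0 1 \<Longrightarrow> boundary_map f a = proj_act g a"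
    using boundary_map_embedding[OF f] by blast
  have xyz': "x = proj_act g (vec (cis r))" "y = proj_act g (vec (cis s))" "z = proj_act g (vec (cis t))"
    using xyz g(2) by (simp_all add: norm_vec_1)
  obtain k where k: "k > 0" "trip x y z = of_real k * trip (vec (cis r) :: complex^1) (vec (cis s)) (vec (cis t))"
    unfolding xyz' by (rule trip_proj_act[OF g(1), of "vec (cis r)" "vec (cis s)" "vec (cis t)"])
      (simp_all add: norm_vec_1)
  have "sin ((r - s) / 2) < 0" "sin ((s - t) / 2) < 0" "sin ((t - r) / 2) > 0"
    using rst sin_gt_zero[of "(s - r) / 2"] sin_gt_zero[of "(t - s) / 2"] sin_gt_zero[of "(t - r) / 2"]
      sin_minus[of "(s - r) / 2"] sin_minus[of "(t - s) / 2"]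
    by (simp_all add: minus_divide_left)
  then have "sin ((r - s) / 2) * sin ((s - t) / 2) * sin ((t - r) / 2) > 0"
    by (simp add: mult_neg_neg)
  then show ?thesis
    using k by (simp add: trip_def tri_on_circle zero_less_mult_iff mult_less_0_iff)
qed

text \<open>For the converse the three angles are taken in one turn that starts at \<open>x\<close>.
  In the wrong order the swapped triple would be positively oriented, but swapping conjugates the
  triple product.\<close>

lemma positively_oriented_iff:
  assumes "on_common_chain x y z" "distinct [x, y, z]"
  shows "positively_oriented x y z \<longleftrightarrow> Im (trip x y z) < 0"
proof
  assume neg: "Im (trip x y z) < 0"
  obtain g :: "complex^(1 option) \<Rightarrow> _" where g: "herm_iso g"
    and xyz: "x \<in> proj_act g ` sphere 0 1" "y \<in> proj_act g ` sphere 0 1" "z \<in> proj_act g ` sphere 0 1"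
    using assms by (auto simp: on_common_chain_def is_chain_iff)
  have param: "\<exists>s. r \<le> s \<and> s < r + 2 * pi \<and> w = proj_act g (vec (cis s))"
    if "w \<in> proj_act g ` sphere 0 1" for w r
  proof -
    obtain a where a: "cmod a = 1" "w = proj_act g (vec a)"
      using \<open>w \<in> proj_act g ` sphere 0 1\<close> by (rule proj_act_circleE)
    then have n1: "cmod (a * cis (- r)) = 1" by (simp add: norm_mult)
    define t where "t = Arg2pi (a * cis (- r))"
    have t: "0 \<le> t" "t < 2 * pi" "a * cis (- r) = cis t"
      using Arg2pi[of "a * cis (- r)"] n1 by (simp_all add: t_def is_Arg_def cis_conv_exp)
    have "a = a * (cis (- r) * cis r)" by (simp add: cis_mult)
    also have "\<dots> = a * cis (- r) * cis r" by (simp only: mult.assoc)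
    also have "\<dots> = cis (r + t)" unfolding t(3) by (simp add: cis_mult add.commute)
    finally show ?thesis using t a(2) by (intro exI[of _ "r + t"]) auto
  qed
  obtain r where r: "x = proj_act g (vec (cis r))" using param[OF xyz(1)] by blast
  obtain s where s: "r \<le> s" "s < r + 2 * pi" "y = proj_act g (vec (cis s))" using param[OF xyz(2)] by blast
  obtain t where t: "r \<le> t" "t < r + 2 * pi" "z = proj_act g (vec (cis t))" using param[OF xyz(3)] by blast
  have ne: "r \<noteq> s" "r \<noteq> t" "s \<noteq> t" using assms(2) r s t by auto
  have bm: "proj_act g (vec (cis u)) = boundary_map (proj_act g) (vec (cis u))" for u
    by (rule boundary_map_proj_act[OF g, symmetric]) (simp_all add: norm_vec_1)
  have "s < t"
  proof (rule ccontr)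
    assume "\<not> s < t"
    then have "positively_oriented x z y"
      unfolding positively_oriented_def r s(3) t(3) bm
      using embedding_proj_act[OF g] ne s t
      by (intro exI[of _ "proj_act g"] exI[of _ r] exI[of _ t] exI[of _ s]) auto
    then have "Im (trip x z y) < 0" by (rule positively_orientedD)
    then show False using neg by (simp add: trip_swap[of x z y])
  qed
  then show "positively_oriented x y z"
    unfolding positively_oriented_def r s(3) t(3) bm
    using embedding_proj_act[OF g] ne s t
    by (intro exI[of _ "proj_act g"] exI[of _ r] exI[of _ s] exI[of _ t]) auto
qed (rule positively_orientedD)

section \<open>Null sets of the sphere\<close>

text \<open>The measure \<open>sphere_lebesgue\<close> extended by 0 to the Borel sets of the whole space.\<close>

definition sph :: "(complex^'n::finite) measure" where
  "sph = distr (restrict_space lborel (ball 0 1 - {0})) borel sgn"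

lemma sets_sph [simp, measurable_cong]: "sets sph = sets borel"
  by (simp add: sph_def)

lemma space_sph [simp]: "space sph = UNIV"
  by (simp add: sph_def)

lemma sgn_borel [measurable]: "(sgn :: complex^'n::finite \<Rightarrow> _) \<in> borel_measurable borel"
  unfolding sgn_div_norm[abs_def] by measurable

lemma sgn_measurable_ball:
  "(sgn :: complex^'n::finite \<Rightarrow> _) \<in> restrict_space lborel (ball 0 1 - {0}) \<rightarrow>\<^sub>M borel"
  by (intro measurable_restrict_space1) simp

lemma emeasure_sph:
  assumes "N \<in> sets borel"
  shows "emeasure sph N = emeasure lborel {z \<in> ball 0 1 - {0}. sgn z \<in> N}"
proof -
  have "sgn -` N \<inter> (ball 0 1 - {0}) = {z \<in> ball 0 1 - {0}. sgn z \<in> N}" by auto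
  then show ?thesis
    unfolding sph_def using assms
    by (subst emeasure_distr[OF sgn_measurable_ball])
       (auto simp: space_restrict_space intro!: emeasure_restrict_space)
qed

text \<open>Nullity becomes negligibility of a cone in the ambient space, where differentiable maps
  keep negligible sets.\<close>

lemma null_sets_sph_iff:
  assumes "N \<in> sets borel"
  shows "N \<in> null_sets sph \<longleftrightarrow> negligible {z \<in> ball 0 1 - {0}. sgn z \<in> N}"
proof -
  have "{z \<in> ball 0 1 - {0}. sgn z \<in> N} \<in> sets borel"
    using assms by measurable
  then show ?thesis
    using assms by (simp add: null_sets_def emeasure_sph negligible_iff_emeasure0)
qed

lemma sphere_lebesgue_eq: "sphere_lebesgue = restrict_space sph (sphere 0 1)"
proof (rule measure_eqI)
  fix A :: "(complex^'n) set" assume "A \<in> sets sphere_lebesgue"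
  then have A: "A \<in> sets borel" "A \<subseteq> sphere 0 1"
    by (auto simp: sphere_lebesgue_def sets_restrict_space)
  have m: "sgn \<in> restrict_space lborel (ball 0 1 - {0 :: complex^'n}) \<rightarrow>\<^sub>M restrict_space borel (sphere 0 1)"
    by (rule measurable_restrict_space2) (auto simp: space_restrict_space norm_sgn sgn_measurable_ball)
  have "emeasure sphere_lebesgue A = emeasure sph A"
    unfolding sphere_lebesgue_def sph_def using A
    by (simp add: emeasure_distr[OF m] emeasure_distr[OF sgn_measurable_ball] sets_restrict_space_iff)
  also have "\<dots> = emeasure (restrict_space sph (sphere 0 1)) A"
    using A by (subst emeasure_restrict_space) auto
  finally show "emeasure sphere_lebesgue A = emeasure (restrict_space sph (sphere 0 1)) A" .
qed (simp add: sphere_lebesgue_def sets_restrict_space)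

lemma AE_sphere: "AE x in sph. x \<in> sphere 0 1"
proof -
  have "- sphere (0 :: complex^'n) 1 \<in> null_sets sph"
    by (subst null_sets_sph_iff) (auto simp: norm_sgn)
  then show ?thesis by (rule AE_I') auto
qed

lemma AE_sphere_lebesgue_iff: "(AE x in sphere_lebesgue. P x) \<longleftrightarrow> (AE x in sph. P x)"
  unfolding sphere_lebesgue_eq using AE_sphere
  by (subst AE_restrict_space_iff) auto

lemma finite_measure_sph: "finite_measure (sph :: (complex^'n::finite) measure)"
proof
  have "emeasure lborel {z \<in> ball (0 :: complex^'n) 1 - {0}. sgn z \<in> UNIV} \<le> emeasure lborel (ball (0 :: complex^'n) 1)"
    by (intro emeasure_mono) auto
  also have "\<dots> < \<infinity>" by (rule emeasure_lborel_ball_finite)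
  finally show "emeasure (sph :: (complex^'n) measure) (space sph) \<noteq> \<infinity>"
    by (simp add: emeasure_sph)
qed

interpretation sph: finite_measure "sph :: (complex^'n::finite) measure"
  by (rule finite_measure_sph)

lemma sph_nonzero: "emeasure (sph :: (complex^'n::finite) measure) UNIV \<noteq> 0"
proof
  assume "emeasure (sph :: (complex^'n) measure) UNIV = 0"
  then have "(UNIV :: (complex^'n) set) \<in> null_sets sph" by (simp add: null_sets_def)
  then have "negligible {z \<in> ball (0 :: complex^'n) 1 - {0}. sgn z \<in> UNIV}"
    by (intro iffD1[OF null_sets_sph_iff]) auto
  also have "{z \<in> ball (0 :: complex^'n) 1 - {0}. sgn z \<in> UNIV} = ball 0 1 - {0}" by auto
  finally have "negligible (ball (0 :: complex^'n) 1 - {0})" .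
  then have "negligible (insert 0 (ball (0 :: complex^'n) 1 - {0}))" by (simp only: negligible_insert)
  then have "negligible (ball (0 :: complex^'n) 1)" by (rule negligible_subset) auto
  then show False using open_not_negligible[of "ball (0 :: complex^'n) 1"] by simp
qed

text \<open>Drops the quantifier over an auxiliary generic point that the conclusion no longer
  mentions.\<close>

lemma sph_AE_const: "(AE x in (sph :: (complex^'n::finite) measure). P) \<longleftrightarrow> P"
proof
  assume "AE x in (sph :: (complex^'n) measure). P"
  then show P
    using sph_nonzero[where 'n = 'n] by (cases P) (auto simp: AE_iff_null null_sets_def)
qed simp

lemma AE_sph_ex: "AE x in (sph :: (complex^'n::finite) measure). P x \<Longrightarrow> \<exists>x. P x"
  using sph_AE_const by (metis (mono_tags, lifting) AE_mp AE_I2 sph_AE_const)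

lemma lborel_AE_const: "(AE x in (lborel :: 'a::euclidean_space measure). P) \<longleftrightarrow> P"
proof
  assume "AE x in (lborel :: 'a measure). P"
  moreover have "ae_filter (lborel :: 'a measure) \<noteq> bot"
    by (simp add: ae_filter_eq_bot_iff)
  ultimately show P by simp
qed simp

lemma AE_null_preserving:
  assumes T: "T \<in> M \<rightarrow>\<^sub>M N"
    and null: "\<And>A. A \<in> null_sets N \<Longrightarrow> T -` A \<inter> space M \<in> null_sets M"
    and AE: "AE x in N. P x"
  shows "AE x in M. P (T x)"
proof -
  obtain A where A: "A \<in> null_sets N" "{x \<in> space N. \<not> P x} \<subseteq> A"
    using AE by (auto elim!: AE_E simp: null_sets_def)
  show ?thesis
    by (rule AE_I'[OF null[OF A(1)]]) (use A measurable_space[OF T] in auto)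
qed

section \<open>Borel measurability of the geometric functions\<close>

lemma borel_measurable_vec:
  assumes "\<And>i. (\<lambda>x. f x $ i) \<in> borel_measurable M"
  shows "(f :: _ \<Rightarrow> complex^'n::finite) \<in> borel_measurable M"
proof -
  have "linear (axis i :: complex \<Rightarrow> complex^'n)" for i
    by standard (auto simp: vec_eq_iff axis_def)
  then have ax: "continuous_on UNIV (axis i :: complex \<Rightarrow> complex^'n)" for i
    by (simp add: linear_continuous_on linear_conv_bounded_linear)
  have "(\<lambda>x. \<Sum>i\<in>UNIV. axis i (f x $ i)) \<in> borel_measurable M"
    by (intro borel_measurable_sum borel_measurable_continuous_on[OF ax] assms)
  also have "(\<lambda>x. \<Sum>i\<in>UNIV. axis i (f x $ i)) = f"
    by (auto simp: fun_eq_iff vec_eq_iff axis_def if_distrib cong: if_cong)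
  finally show ?thesis .
qed

lemma borel_measurable_vec_nth [measurable (raw)]:
  "f \<in> borel_measurable M \<Longrightarrow> (\<lambda>x. (f x :: complex^'n::finite) $ i) \<in> borel_measurable M"
  by (rule borel_measurable_continuous_on[OF linear_continuous_on[OF bounded_linear_vec_nth]])

lemma borel_measurable_cnj [measurable (raw)]:
  "f \<in> borel_measurable M \<Longrightarrow> (\<lambda>x. cnj (f x)) \<in> borel_measurable M"
  by (rule borel_measurable_continuous_on[of cnj]) (auto intro: continuous_intros)

lemma borel_measurable_hp [measurable (raw)]:
  assumes [measurable]: "f \<in> borel_measurable M" "g \<in> borel_measurable M"
  shows "(\<lambda>x. hp (f x) (g x)) \<in> borel_measurable M"
  unfolding herm_homog by measurable

lemma borel_measurable_trip [measurable (raw)]: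
  assumes [measurable]: "f \<in> borel_measurable M" "g \<in> borel_measurable M" "h \<in> borel_measurable M"
  shows "(\<lambda>x. trip (f x) (g x) (h x)) \<in> borel_measurable M"
  unfolding trip_def tri_def by measurable

lemma borel_measurable_tcoef [measurable (raw)]:
  assumes [measurable]: "f \<in> borel_measurable M" "g \<in> borel_measurable M" "h \<in> borel_measurable M"
  shows "(\<lambda>x. tcoef (f x) (g x) (h x)) \<in> borel_measurable M"
  unfolding tcoef_def by measurable

lemma borel_measurable_transv [measurable (raw)]:
  assumes [measurable]: "f \<in> borel_measurable M" "g \<in> borel_measurable M" "h \<in> borel_measurable M"
  shows "(\<lambda>x. transv (f x) (g x) (h x)) \<in> borel_measurable M"
proof (rule borel_measurable_vec)
  fix i
  have "(\<lambda>x. (h x $ i + \<i> * of_real (g x) * hp (h x) (f x) * f x $ i) /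
      (1 + \<i> * of_real (g x) * hp (h x) (f x))) \<in> borel_measurable M"
    by measurable
  then show "(\<lambda>x. transv (f x) (g x) (h x) $ i) \<in> borel_measurable M"
    by (simp add: transv_def proj_act_def dehomog_def tvec_def)
qed

lemma borel_measurable_proj_act:
  assumes f: "herm_iso f"
  shows "proj_act f \<in> borel_measurable borel"
proof (rule borel_measurable_vec)
  fix i
  have h: "continuous_on UNIV homog"
    unfolding continuous_on_eq_continuous_at[OF open_UNIV] continuous_at homog_def
    by (auto intro!: tendsto_vec_lambda tendsto_intros split: option.split)
  have c: "continuous_on UNIV (\<lambda>z. f (homog z) $ k)" for k
    by (intro linear_continuous_on_compose[OF h, of "\<lambda>v. f v $ k"] bounded_linear.linear
        bounded_linear_compose[OF bounded_linear_vec_nth bounded_linear_herm_iso[OF f]])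
  show "(\<lambda>x. proj_act f x $ i) \<in> borel_measurable borel"
    unfolding proj_act_def dehomog_def using c
    by (simp add: borel_measurable_divide borel_measurable_continuous_onI)
qed

text \<open>The action is extended homogeneously to the cone, where it is differentiable off the origin.\<close>

lemma AE_proj_act:
  fixes g h :: "complex^('n::finite option) \<Rightarrow> complex^('n option)"
  assumes g: "herm_iso g" and h: "herm_iso h" and hg: "\<And>v. h (g v) = v"
    and AE: "AE x in sph. P x"
  shows "AE x in sph. P (proj_act g x)"
proof (rule AE_null_preserving[OF _ _ AE])
  have gm [measurable]: "proj_act g \<in> borel_measurable borel" by (rule borel_measurable_proj_act[OF g])
  then show "proj_act g \<in> sph \<rightarrow>\<^sub>M sph" by simp
  fix A :: "(complex^'n) set" assume A: "A \<in> null_sets sph"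
  then have [measurable]: "A \<in> sets borel" by auto
  have negA: "negligible {z \<in> ball 0 1 - {0}. sgn z \<in> A}" using A by (intro iffD1[OF null_sets_sph_iff]) auto
  have A': "proj_act g -` A \<in> sets borel" using measurable_sets[OF gm, of A] by simp
  \<comment> \<open>\<open>\<Psi>\<close> extends the inverse \<open>h\<close>, so the cone over the
    preimage of \<open>A\<close> lies in a differentiable image of the cone over
    \<open>A\<close>.\<close>
  define \<Psi> where "\<Psi> z = norm z *\<^sub>R proj_act h (inverse (norm z) *\<^sub>R z)" for z :: "complex^'n"
  have "\<Psi> differentiable (at z)" if "z \<noteq> 0" for z
  proof -
    have n: "norm differentiable (at z)" using that by simp
    have "(\<lambda>z. inverse (norm z) *\<^sub>R z) differentiable (at z)"
      using that n by (intro differentiable_scaleR differentiable_inverse) auto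
    moreover have "proj_act h differentiable (at (inverse (norm z) *\<^sub>R z))"
      using has_derivative_proj_act[OF h, of "inverse (norm z) *\<^sub>R z"] that
      by (auto simp: differentiable_def)
    ultimately have "(\<lambda>z. proj_act h (inverse (norm z) *\<^sub>R z)) differentiable (at z)"
      using differentiable_chain_at[of "\<lambda>z. inverse (norm z) *\<^sub>R z" z "proj_act h"] by (simp add: comp_def)
    then show ?thesis unfolding \<Psi>_def using n by (intro differentiable_scaleR) auto
  qed
  then have "\<Psi> differentiable_on {z \<in> ball 0 1 - {0}. sgn z \<in> A}"
    by (intro differentiable_at_imp_differentiable_on) auto
  with negA have "negligible (\<Psi> ` {z \<in> ball 0 1 - {0}. sgn z \<in> A})"
    by (intro negligible_differentiable_image_negligible) auto
  moreover have "{z \<in> ball 0 1 - {0}. sgn z \<in> proj_act g -` A} \<subseteq> \<Psi> ` {z \<in> ball 0 1 - {0}. sgn z \<in> A}"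
  proof
    fix z assume z: "z \<in> {z \<in> ball 0 1 - {0}. sgn z \<in> proj_act g -` A}"
    define w where "w = proj_act g (sgn z)"
    have sz: "norm (sgn z) = 1" using z by (simp add: norm_sgn)
    then have w: "norm w = 1" using proj_act_sphere[OF g, of "sgn z"] by (simp add: w_def)
    have hw: "proj_act h w = sgn z"
      unfolding w_def using sz by (subst proj_act_comp[OF h g]) (simp_all add: proj_act_def hg)
    have nz: "norm z > 0" using z by simp
    have "\<Psi> (norm z *\<^sub>R w) = norm z *\<^sub>R proj_act h w"
      using w nz by (simp add: \<Psi>_def)
    also have "\<dots> = z" using hw nz by (simp add: sgn_div_norm)
    finally have "z = \<Psi> (norm z *\<^sub>R w)" ..
    moreover have "sgn (norm z *\<^sub>R w) = w" using w nz by (simp add: sgn_div_norm)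
    then have "norm z *\<^sub>R w \<in> {z \<in> ball 0 1 - {0}. sgn z \<in> A}"
      using z w by (auto simp: w_def)
    ultimately show "z \<in> \<Psi> ` {z \<in> ball 0 1 - {0}. sgn z \<in> A}" by (rule image_eqI)
  qed
  ultimately have "negligible {z \<in> ball 0 1 - {0}. sgn z \<in> proj_act g -` A}"
    by (rule negligible_subset)
  then show "proj_act g -` A \<inter> space sph \<in> null_sets sph"
    using A' by (simp add: null_sets_sph_iff)
qed

lemma AE_transv:
  assumes y: "y \<in> sphere 0 1" and AE: "AE x in sph. P x"
  shows "AE x in sph. P (transv y s x)"
  unfolding transv_def
  by (rule AE_proj_act[OF _ _ _ AE, where h = "tvec (homog y) (- s)"])
     (simp_all add: herm_iso_tvec tvec_add hp_self[OF y], simp add: tvec_def)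

text \<open>On the cone over the zero set a nonzero real linear functional vanishes, since the norm is real.\<close>

lemma AE_herm_nonzero:
  fixes n :: "complex^('n::finite option)"
  assumes n: "n \<noteq> 0"
  shows "AE y in sph. herm (homog y) n \<noteq> 0"
proof -
  let ?N = "{y :: complex^'n. herm (homog y) n = 0}"
  have eq: "herm (homog y) n = (\<Sum>i\<in>UNIV. y $ i * cnj (n $ Some i)) - cnj (n $ None)" for y
    by (simp add: herm_def)
  have N: "?N \<in> sets borel" unfolding eq by measurable
  \<comment> \<open>Divided by \<open>c\<close> the sum is real on the cone over the zero set, hence
    imaginary after multiplication by \<i>. If the \<open>None\<close> coordinate vanishes the sum
    is 0 there, and 1 serves as well as any nonzero value.\<close>
  define c where "c = (if n $ None = 0 then 1 else cnj (n $ None))"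
  have c: "c \<noteq> 0" by (simp add: c_def)
  define m where "m = (\<chi> i. cnj (\<i> * cnj (n $ Some i) / c))"
  have inner: "m \<bullet> z = Re ((\<Sum>i\<in>UNIV. z $ i * cnj (n $ Some i)) * \<i> / c)" for z
  proof -
    have q: "cnj q \<bullet> w = Re (q * w)" for q w by (simp add: inner_complex_def)
    have "m \<bullet> z = (\<Sum>i\<in>UNIV. Re (\<i> * cnj (n $ Some i) / c * z $ i))"
      unfolding inner_vec_def m_def vec_lambda_beta q ..
    also have "\<dots> = Re ((\<Sum>i\<in>UNIV. z $ i * cnj (n $ Some i)) * \<i> / c)"
      unfolding Re_sum[symmetric] sum_distrib_right sum_divide_distrib
      by (intro arg_cong[of _ _ Re] sum.cong) (simp_all add: mult_ac)
    finally show ?thesis .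
  qed
  have sub: "{z \<in> ball 0 1 - {0}. sgn z \<in> ?N} \<subseteq> {z. m \<bullet> z = 0}"
  proof
    fix z :: "complex^'n" assume "z \<in> {z \<in> ball 0 1 - {0}. sgn z \<in> ?N}"
    then have z: "z \<noteq> 0" "herm (homog (sgn z)) n = 0" by auto
    have "(\<Sum>i\<in>UNIV. sgn z $ i * cnj (n $ Some i)) = cnj (n $ None)" using z(2) by (simp add: eq)
    moreover have "(\<Sum>i\<in>UNIV. z $ i * cnj (n $ Some i)) = of_real (norm z) * (\<Sum>i\<in>UNIV. sgn z $ i * cnj (n $ Some i))"
    proof -
      have "z $ i * w = of_real (norm z) * (sgn z $ i * w)" for i w
        unfolding sgn_div_norm scaleR_eq_smult using z(1) by simp
      then show ?thesis unfolding sum_distrib_left by (intro sum.cong) auto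
    qed
    ultimately have "(\<Sum>i\<in>UNIV. z $ i * cnj (n $ Some i)) = of_real (norm z) * cnj (n $ None)" by simp
    then show "z \<in> {z. m \<bullet> z = 0}" unfolding inner by (simp add: c_def)
  qed
  have neg: "negligible {z \<in> ball 0 1 - {0}. sgn z \<in> ?N}"
  proof (cases "m = 0")
    case False
    then show ?thesis using sub negligible_hyperplane[of m 0] negligible_subset by auto
  next
    case True
    then have "n $ Some i = 0" for i
      using c by (auto simp: m_def vec_eq_iff)
    with n have "n $ None \<noteq> 0"
      by (metis (no_types) not_None_eq vec_eq_iff zero_index)
    with \<open>\<And>i. n $ Some i = 0\<close> have "?N = {}" by (simp add: eq)
    then show ?thesis by simp
  qed
  then have "?N \<in> null_sets sph" by (simp add: null_sets_sph_iff N)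
  then show ?thesis by (rule AE_I') auto
qed

lemma AE_sph_neq: "AE y in sph. y \<noteq> x"
proof (cases "x \<in> sphere 0 1")
  case True
  then show ?thesis
    by (intro eventually_mono[OF AE_herm_nonzero[OF homog_nonzero[of x]]]) (auto simp: hp_self)
next
  case False
  then show ?thesis by (intro eventually_mono[OF AE_sphere]) auto
qed

section \<open>Parameters of a chain\<close>

lemma AE_lborel_iff_negligible:
  "(AE x in lborel. P x) \<longleftrightarrow> negligible {x :: 'a::euclidean_space. \<not> P x}"
proof -
  have "(AE x in lborel. P x) \<longleftrightarrow> (AE x in (lebesgue :: 'a measure). P x)"
    by (simp add: AE_completion_iff)
  also have "\<dots> \<longleftrightarrow> {x. \<not> P x} \<in> null_sets lebesgue"
    by (simp add: completion.AE_iff_null_sets)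
  finally show ?thesis by (simp add: negligible_iff_null_sets)
qed

text \<open>Points where the substituted statement fails lie outside \<open>S\<close> or in the
  image under \<open>g\<close> of the points where \<open>P\<close> fails.\<close>

lemma AE_lborel_substitution:
  fixes f g :: "'a::euclidean_space \<Rightarrow> 'a"
  assumes P: "AE x in lborel. P x" and S: "AE x in lborel. x \<in> S"
    and gf: "\<And>x. x \<in> S \<Longrightarrow> g (f x) = x" and g: "g differentiable_on f ` S"
  shows "AE x in lborel. P (f x)"
proof -
  have "negligible (g ` ({x. \<not> P x} \<inter> f ` S))"
    using P g unfolding AE_lborel_iff_negligible
    by (intro negligible_differentiable_image_negligible)
       (auto intro: differentiable_on_subset negligible_subset)
  moreover have "negligible {x. x \<notin> S}" using S by (simp add: AE_lborel_iff_negligible)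
  ultimately have "negligible (g ` ({x. \<not> P x} \<inter> f ` S) \<union> {x. x \<notin> S})" by (rule negligible_Un)
  then show ?thesis unfolding AE_lborel_iff_negligible
    by (rule negligible_subset) (use gf in force)
qed

lemma AE_lborel_translate: "AE s in lborel. P s \<Longrightarrow> AE s in lborel. P (a + s :: real)"
  by (rule AE_lborel_substitution[where S = UNIV and g = "\<lambda>s. s - a"])
     (auto intro!: derivative_intros)

lemma AE_lborel_scale: "AE s in lborel. P s \<Longrightarrow> c \<noteq> 0 \<Longrightarrow> AE s in lborel. P (c * s :: real)"
  by (rule AE_lborel_substitution[where S = UNIV and g = "\<lambda>s. s / c"])
     (auto intro!: derivative_intros simp: divide_inverse)

lemma AE_lborel_nonzero: "AE s in lborel. (s :: real) \<noteq> 0"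
  by (rule AE_lborel_singleton)

lemma AE_lborel_reciprocal:
  assumes "AE s in lborel. P s" "c \<noteq> 0"
  shows "AE s in lborel. P (c / s :: real)"
proof (rule AE_lborel_substitution[where S = "- {0}" and g = "\<lambda>s. c / s"])
  show "AE x in lborel. x \<in> - {0 :: real}" using AE_lborel_nonzero by eventually_elim auto
  show "(\<lambda>s. c / s) differentiable_on (\<lambda>s. c / s) ` (- {0})"
    using assms(2) by (intro differentiable_at_imp_differentiable_on)
      (auto intro!: derivative_intros differentiable_divide)
qed (use assms in auto)

lemma AE_lborel_ex_in_interval:
  assumes "AE s in lborel. P (s :: real)" "r > 0"
  obtains s where "0 < s" "s < r" "P s"
proof -
  have "\<exists>s\<in>{0<..<r}. P s"
  proof (rule ccontr)
    assume "\<not> ?thesis"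
    then have "{0<..<r} \<subseteq> {s. \<not> P s}" by auto
    moreover have "negligible {s. \<not> P s}" using assms(1) by (simp add: AE_lborel_iff_negligible)
    ultimately have "negligible {0<..<r}" by (rule negligible_subset[rotated])
    then show False using open_not_negligible[of "{0<..<r}"] assms(2) by auto
  qed
  then show ?thesis using that by auto
qed

lemma AE_ex_lborel: "AE s in (lborel :: real measure). P s \<Longrightarrow> \<exists>s. P s"
  using AE_lborel_ex_in_interval[of P 1] by auto

text \<open>The cone over a null set of the circle is negligible in the plane. In the coordinates
  parameter and radius it covers the product of the parameter set \<open>L\<close> with an interval,
  so \<open>L\<close> is null.\<close>

lemma AE_circle:
  assumes "AE a in (sph :: (complex^1) measure). P a"
  shows "AE l in lborel. P (vec (cayley l))"
proof -
  have [measurable]: "cayley \<in> borel_measurable borel"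
    unfolding cayley_def[abs_def] by measurable
  have vm [measurable]: "(\<lambda>l. vec (cayley l) :: complex^1) \<in> borel_measurable borel"
    by (rule borel_measurable_vec) simp
  show ?thesis
  proof (rule AE_null_preserving[OF _ _ assms])
    show "(\<lambda>l. vec (cayley l)) \<in> lborel \<rightarrow>\<^sub>M (sph :: (complex^1) measure)"
      by (subst measurable_cong_sets[OF sets_lborel sets_sph]) (rule vm)
    fix A :: "(complex^1) set" assume A: "A \<in> null_sets sph"
    then have Ab [measurable]: "A \<in> sets borel" by auto
    have negA: "negligible {z \<in> ball 0 1 - {0}. sgn z \<in> A}"
      using A by (intro iffD1[OF null_sets_sph_iff]) auto
    define L where "L = (\<lambda>l. vec (cayley l)) -` A"
    have L: "L \<in> sets borel" using measurable_sets[OF vm Ab] by (simp add: L_def)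
    \<comment> \<open>Inverse of the map from (l, r) to \<open>of_real r * cayley l\<close>: the
      first coordinate is the tangent of half the argument.\<close>
    define \<Theta> where "\<Theta> z = (Im (z $ 1) / (norm (z $ 1) + Re (z $ 1)), norm (z $ 1))" for z :: "complex^1"
    \<comment> \<open>Excludes 0 and the negative real axis, where that tangent is
      undefined.\<close>
    define D where "D = {z :: complex^1. norm (z $ 1) + Re (z $ 1) \<noteq> 0 \<and> z $ 1 \<noteq> 0}"
    have "\<Theta> differentiable (at z)" if "z \<in> D" for z
    proof -
      have c: "(\<lambda>z :: complex^1. z $ 1) differentiable (at z)"
        by (rule bounded_linear_imp_differentiable[OF bounded_linear_vec_nth])
      have r: "(\<lambda>z :: complex^1. Re (z $ 1)) differentiable (at z)" "(\<lambda>z :: complex^1. Im (z $ 1)) differentiable (at z)"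
        by (intro bounded_linear_imp_differentiable bounded_linear_compose[OF bounded_linear_Re bounded_linear_vec_nth]
            bounded_linear_compose[OF bounded_linear_Im bounded_linear_vec_nth])+
      have n: "(\<lambda>z :: complex^1. norm (z $ 1)) differentiable (at z)"
        using differentiable_chain_at[OF c, of norm] that by (simp add: D_def comp_def)
      have q: "(\<lambda>z. Im (z $ 1) / (norm (z $ 1) + Re (z $ 1))) differentiable (at z)"
        using that by (intro differentiable_divide differentiable_add r n) (auto simp: D_def)
      then obtain q' n' where "((\<lambda>z. Im (z $ 1) / (norm (z $ 1) + Re (z $ 1))) has_derivative q') (at z)"
        "((\<lambda>z. norm (z $ 1)) has_derivative n') (at z)"
        using n by (auto simp: differentiable_def)
      from has_derivative_Pair[OF this] show ?thesis
        unfolding \<Theta>_def[abs_def] differentiable_def by blast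
    qed
    then have "\<Theta> differentiable_on ({z \<in> ball 0 1 - {0}. sgn z \<in> A} \<inter> D)"
      by (intro differentiable_at_imp_differentiable_on) auto
    then have "negligible (\<Theta> ` ({z \<in> ball 0 1 - {0}. sgn z \<in> A} \<inter> D))"
      by (intro negligible_differentiable_image_negligible negligible_subset[OF negA]) (auto simp: DIM_complex)
    moreover have "L \<times> {0<..<1} \<subseteq> \<Theta> ` ({z \<in> ball 0 1 - {0}. sgn z \<in> A} \<inter> D)"
    proof safe
      fix l r :: real assume lr: "l \<in> L" "r \<in> {0<..<1}"
      let ?z = "vec (of_real r * cayley l) :: complex^1"
      have nz: "norm (of_real r * cayley l) = r" using lr by (simp add: norm_mult norm_cayley)
      have ca: "cayley l = Complex ((1 - l\<^sup>2) / (1 + l\<^sup>2)) (2 * l / (1 + l\<^sup>2))"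
      proof -
        define d where "d = 1 + l\<^sup>2"
        have d: "d \<noteq> 0" unfolding d_def by (smt (verit) zero_le_power2)
        have "u / d + v / d * l = (u + v * l) / d" "u / d - v / d * l = (u - v * l) / d" for u v
          by (simp_all add: add_divide_distrib diff_divide_distrib)
        moreover have "(1 - l\<^sup>2) + 2 * l * l = d" "2 * l - (1 - l\<^sup>2) * l = l * d"
          by (simp_all add: d_def power2_eq_square algebra_simps)
        ultimately have "Complex ((1 - l\<^sup>2) / (1 + l\<^sup>2)) (2 * l / (1 + l\<^sup>2)) * (1 - \<i> * of_real l) = 1 + \<i> * of_real l"
          using d by (simp add: complex_eq_iff flip: d_def)
        then show ?thesis unfolding cayley_def using cayley_denom[of l] by (metis nonzero_eq_divide_eq)
      qed
      have l2: "1 + l\<^sup>2 > 0" by (simp add: add_pos_nonneg)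
      have re: "r + Re (of_real r * cayley l) = 2 * r / (1 + l\<^sup>2)"
        using l2 by (simp add: ca field_simps)
      have "Im (of_real r * cayley l) / (r + Re (of_real r * cayley l)) = l"
        unfolding re using l2 lr by (simp add: ca)
      then have "(l, r) = \<Theta> ?z" unfolding \<Theta>_def using nz by simp
      moreover have sz: "sgn ?z = vec (cayley l)"
        using lr by (simp add: sgn_div_norm norm_vec_1 nz vec_eq_iff) (simp add: scaleR_conv_of_real)
      have "?z \<in> {z \<in> ball 0 1 - {0}. sgn z \<in> A} \<inter> D"
      proof -
        have "sgn ?z \<in> A" unfolding sz using lr by (simp add: L_def)
        moreover have nz': "norm ?z = r" unfolding norm_vec_1 by (rule nz)
        moreover from this have "?z \<noteq> 0" using lr by auto
        moreover have "?z \<in> D" using lr re l2 nz by (auto simp: D_def)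
        ultimately show ?thesis using lr by auto
      qed
      ultimately show "(l, r) \<in> \<Theta> ` ({z \<in> ball 0 1 - {0}. sgn z \<in> A} \<inter> D)" by (rule image_eqI)
    qed
    ultimately have neg: "negligible (L \<times> {0<..<1 :: real})" by (rule negligible_subset)
    have "L \<times> {0<..<1 :: real} \<in> sets borel" using L by (intro borel_Times) auto
    then have "L \<times> {0<..<1 :: real} \<in> null_sets lborel"
      using neg null_sets_completion_iff[of "L \<times> {0<..<1 :: real}" lborel]
      unfolding negligible_iff_null_sets sets_lborel by (simp only:)
    then have "emeasure lborel (L \<times> {0<..<1 :: real}) = 0" by (rule null_setsD1)
    moreover have "emeasure (lborel :: (real \<times> real) measure) (L \<times> {0<..<1}) = emeasure lborel L * emeasure lborel {0<..<1 :: real}"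
      unfolding lborel_prod[symmetric] using L
      by (intro lborel.emeasure_pair_measure_Times) auto
    ultimately have "emeasure lborel L = 0" by simp
    then show "(\<lambda>l. vec (cayley l)) -` A \<inter> space lborel \<in> null_sets lborel"
      using L by (simp add: null_sets_def L_def)
  qed
qed

lemma finite_measure_sphere_lebesgue: "finite_measure (sphere_lebesgue :: (complex^'n::finite) measure)"
proof
  have "emeasure (sphere_lebesgue :: (complex^'n) measure) (sphere 0 1) = emeasure (sph :: (complex^'n) measure) (sphere 0 1)"
    unfolding sphere_lebesgue_eq by (subst emeasure_restrict_space) auto
  then show "emeasure (sphere_lebesgue :: (complex^'n) measure) (space sphere_lebesgue) \<noteq> \<infinity>"
    by (simp add: sphere_lebesgue_def space_restrict_space[of borel])
qed

lemma AE_sphere_lebesgue_triple: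
  fixes P :: "complex^'n::finite \<Rightarrow> complex^'n \<Rightarrow> complex^'n \<Rightarrow> bool"
  assumes "AE (a, b, c) in sphere_lebesgue \<Otimes>\<^sub>M sphere_lebesgue \<Otimes>\<^sub>M sphere_lebesgue. P a b c"
  shows "AE a in sph. AE b in sph. AE c in sph. P a b c"
proof -
  interpret S: finite_measure "sphere_lebesgue :: (complex^'n) measure" by (rule finite_measure_sphere_lebesgue)
  interpret S2: pair_sigma_finite "sphere_lebesgue :: (complex^'n) measure" "sphere_lebesgue :: (complex^'n) measure" ..
  interpret S3: pair_sigma_finite "sphere_lebesgue :: (complex^'n) measure" "(sphere_lebesgue :: (complex^'n) measure) \<Otimes>\<^sub>M (sphere_lebesgue :: (complex^'n) measure)"
    by (intro pair_sigma_finite.intro sigma_finite_pair_measure S.sigma_finite_measure_axioms)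
  have "AE a in sphere_lebesgue. AE p in sphere_lebesgue \<Otimes>\<^sub>M sphere_lebesgue. (case p of (b, c) \<Rightarrow> P a b c)"
    using S3.AE_pair[OF assms] by simp
  then have "AE a in sphere_lebesgue. AE b in sphere_lebesgue. AE c in sphere_lebesgue. P a b c"
  proof eventually_elim
    case (elim a)
    from S2.AE_pair[OF elim] show ?case by simp
  qed
  then show ?thesis by (simp add: AE_sphere_lebesgue_iff)
qed

text \<open>A translate of \<open>x\<close> about \<open>y\<close> combines the two lifts; divided
  by its coefficient at the lift of \<open>y\<close> it is a translate of \<open>y\<close> about
  \<open>x\<close>. This exchanges the ends of a chain.\<close>

lemma transv_reciprocal:
  assumes "x \<in> sphere 0 1" "y \<in> sphere 0 1" "x \<noteq> y" "s \<noteq> 0"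
  shows "transv y s x = transv x (- 1 / (cmod (hp x y))\<^sup>2 / s) y"
proof -
  have h: "hp x y \<noteq> 0" "hp y x \<noteq> 0" using hp_nonzero assms by metis+
  have "\<i> * of_real (- 1 / (cmod (hp x y))\<^sup>2 / s) * hp y x = - \<i> / of_real s * (hp y x / (hp x y * hp y x))"
    unfolding herm_mult_commute by simp
  also have "\<dots> = 1 / (\<i> * of_real s * hp x y)" using h assms(4) by (simp add: field_simps)
  finally have "tvec (homog x) (- 1 / (cmod (hp x y))\<^sup>2 / s) (homog y) =
      (1 / (\<i> * of_real s * hp x y)) *s tvec (homog y) s (homog x)"
    unfolding tvec_def using h assms(4) by (simp add: vec_eq_iff field_simps)
  then show ?thesis using h assms(4) by (simp add: transv_def proj_act_def dehomog_scale)
qed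

lemma continuous_on_transv:
  assumes "x \<in> sphere 0 1" "y \<in> sphere 0 1"
  shows "continuous_on UNIV (\<lambda>s. transv y s x)"
proof -
  have "1 + \<i> * of_real s * hp x y \<noteq> 0" for s
    using herm_iso_None[OF herm_iso_tvec[OF hp_self[OF assms(2)]], of x s] assms(1)
    by (simp add: tvec_def)
  then have "continuous_on UNIV (\<lambda>s. (x $ i + \<i> * of_real s * hp x y * y $ i) / (1 + \<i> * of_real s * hp x y))" for i
    by (intro continuous_intros) auto
  then show ?thesis
    unfolding transv_def proj_act_def dehomog_def tvec_def
    by (intro continuous_on_vec_lambda) simp
qed

text \<open>Translates with rational parameters are dense in the chain. Meeting an open set thus
  becomes a countable condition, and the chain depends measurably on the two points.\<close>

lemma chain_through_meets_open:
  assumes x: "x \<in> sphere 0 1" and y: "y \<in> sphere 0 1" and ne: "x \<noteq> y" and U: "open U"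
  shows "chain_through x y \<inter> U \<noteq> {} \<longleftrightarrow> (\<exists>q\<in>\<rat>. transv y q x \<in> U)"
proof
  assume "chain_through x y \<inter> U \<noteq> {}"
  then consider "y \<in> U" | s where "transv y s x \<in> U"
    unfolding chain_through_eq[OF x y ne] by auto
  then obtain s where s: "transv y s x \<in> U"
  proof cases
    \<comment> \<open>\<open>y\<close> is no translate of \<open>x\<close> but the limit of
      translates for large parameters, as is seen from the other end.\<close>
    case 1
    have c: "isCont (\<lambda>s. transv x s y) 0"
      using continuous_on_transv[OF y x] by (simp add: continuous_on_eq_continuous_at)
    have h: "(cmod (hp x y))\<^sup>2 > 0" using hp_nonzero[OF x y ne] by simp
    have "((\<lambda>s. - 1 / (cmod (hp x y))\<^sup>2 / s) \<longlongrightarrow> 0) at_top"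
      by (intro tendsto_divide_0[OF tendsto_const] filterlim_at_top_imp_at_infinity filterlim_ident)
    then have "((\<lambda>s. transv x (- 1 / (cmod (hp x y))\<^sup>2 / s) y) \<longlongrightarrow> transv x 0 y) at_top"
      by (rule isCont_tendsto_compose[OF c])
    then have "eventually (\<lambda>s. transv x (- 1 / (cmod (hp x y))\<^sup>2 / s) y \<in> U) at_top"
      using U 1 by (intro topological_tendstoD) auto
    then have "eventually (\<lambda>s. transv x (- 1 / (cmod (hp x y))\<^sup>2 / s) y \<in> U \<and> s > 0) at_top"
      using eventually_gt_at_top[of 0] by eventually_elim auto
    then obtain s where "transv x (- 1 / (cmod (hp x y))\<^sup>2 / s) y \<in> U" "s > 0"
      using eventually_happens'[OF trivial_limit_at_top_linorder] by blast
    then show ?thesis using transv_reciprocal[OF x y ne, of s] that[of s] by simp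
  next
    case 2
    then show ?thesis by (rule that)
  qed
  have "open ((\<lambda>s. transv y s x) -` U)"
    by (rule open_vimage[OF U continuous_on_transv[OF x y]])
  moreover have "s \<in> (\<lambda>s. transv y s x) -` U" using s by simp
  ultimately obtain e where e: "e > 0" "ball s e \<subseteq> (\<lambda>s. transv y s x) -` U"
    by (meson open_contains_ball)
  obtain q where "q \<in> \<rat>" "s < q" "q < s + e" using Rats_dense_in_real[of s "s + e"] e(1) by auto
  then show "\<exists>q\<in>\<rat>. transv y q x \<in> U" using e(2) by (intro bexI[of _ q]) (auto simp: dist_real_def subset_eq)
next
  assume "\<exists>q\<in>\<rat>. transv y q x \<in> U"
  then show "chain_through x y \<inter> U \<noteq> {}" unfolding chain_through_eq[OF x y ne] by auto
qed

section \<open>The invariant measure class on chains\<close>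

text \<open>Junk value of \<open>chain_map\<close> on the diagonal, a null set.\<close>

definition base_chain :: "(complex^'n::finite) set" where
  "base_chain = chain_through (axis undefined 1) (- axis undefined 1)"

definition chain_map :: "(complex^'n::finite) \<times> (complex^'n) \<Rightarrow> (complex^'n) set" where
  "chain_map p = (if fst p \<in> sphere 0 1 \<and> snd p \<in> sphere 0 1 \<and> fst p \<noteq> snd p
     then chain_through (fst p) (snd p) else base_chain)"

text \<open>An explicit member of the invariant class, carried by the chains through two independent
  generic points; the hypothesis on almost every chain is read off at this measure.\<close>

definition chain_measure :: "(complex^'n::finite) set measure" where
  "chain_measure = distr (sph \<Otimes>\<^sub>M sph) chain_borel chain_map"

lemma is_chain_base_chain: "is_chain (base_chain :: (complex^'n::finite) set)"
proof -
  have "norm (axis undefined 1 :: complex^'n) = 1" by simp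
  moreover have "axis undefined 1 \<noteq> (- axis undefined 1 :: complex^'n)"
  proof
    assume "axis undefined 1 = (- axis undefined 1 :: complex^'n)"
    from arg_cong[OF this, of "\<lambda>v. v $ undefined"] show False by simp
  qed
  ultimately show ?thesis
    unfolding base_chain_def by (intro is_chain_through) auto
qed

lemma space_chain_borel: "space chain_borel = {C. is_chain C}"
  unfolding chain_borel_def by (rule space_measure_of) auto

lemma meets_open_in_chain_borel: "open U \<Longrightarrow> {C. is_chain C \<and> C \<inter> U \<noteq> {}} \<in> sets chain_borel"
  unfolding chain_borel_def by (auto intro: in_measure_of)

lemma measurable_chain_borelI:
  fixes f :: "'a \<Rightarrow> (complex^'n::finite) set"
  assumes "\<And>w. w \<in> space M \<Longrightarrow> is_chain (f w)"
    and "\<And>U. open U \<Longrightarrow> {w \<in> space M. f w \<inter> U \<noteq> {}} \<in> sets M"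
  shows "f \<in> M \<rightarrow>\<^sub>M chain_borel"
  unfolding chain_borel_def
proof (rule measurable_measure_of)
  fix Y :: "(complex^'n) set set" assume "Y \<in> {{C. is_chain C \<and> C \<inter> U \<noteq> {}} | U. open U}"
  then obtain U where U: "open U" "Y = {C. is_chain C \<and> C \<inter> U \<noteq> {}}" by auto
  have "f -` Y \<inter> space M = {w \<in> space M. f w \<inter> U \<noteq> {}}" using assms(1) U(2) by auto
  then show "f -` Y \<inter> space M \<in> sets M" using assms(2)[OF U(1)] by simp
qed (use assms(1) in auto)

lemma is_chain_map: "is_chain (chain_map p)"
  by (simp add: chain_map_def is_chain_through is_chain_base_chain)

lemma measurable_chain_map: "chain_map \<in> (sph \<Otimes>\<^sub>M sph) \<rightarrow>\<^sub>M (chain_borel :: (complex^'n::finite) set measure)"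
proof (rule measurable_chain_borelI)
  fix U :: "(complex^'n) set" assume U: "open U"
  then have [measurable]: "U \<in> sets borel" by simp
  have [measurable]: "sphere (0 :: complex^'n) 1 \<in> sets borel" by (simp add: borel_closed)
  let ?g = "\<lambda>p :: (complex^'n) \<times> (complex^'n). fst p \<in> sphere 0 1 \<and> snd p \<in> sphere 0 1 \<and> fst p \<noteq> snd p"
  have "{p. chain_map p \<inter> U \<noteq> {}} =
     {p. (?g p \<and> (\<exists>q\<in>\<rat>. transv (snd p) q (fst p) \<in> U)) \<or> (\<not> ?g p \<and> base_chain \<inter> U \<noteq> {})}"
    unfolding chain_map_def using chain_through_meets_open[OF _ _ _ U] by auto
  also have "\<dots> = {p \<in> space (sph \<Otimes>\<^sub>M sph). (?g p \<and> (\<exists>q\<in>\<rat>. transv (snd p) q (fst p) \<in> U)) \<or> (\<not> ?g p \<and> base_chain \<inter> U \<noteq> {})}"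
    by (simp add: space_pair_measure)
  also have "\<dots> \<in> sets (sph \<Otimes>\<^sub>M sph)"
  proof -
    have "{p \<in> space (sph \<Otimes>\<^sub>M sph). \<exists>q\<in>\<rat>. transv (snd p) q (fst p) \<in> U} =
        (\<Union>q\<in>\<rat>. {p \<in> space (sph \<Otimes>\<^sub>M (sph :: (complex^'n) measure)). transv (snd p) q (fst p) \<in> U})" by auto
    also have "\<dots> \<in> sets (sph \<Otimes>\<^sub>M sph)" by (intro sets.countable_UN'' countable_rat) measurable
    finally have [measurable]: "{p \<in> space (sph \<Otimes>\<^sub>M sph). \<exists>q\<in>\<rat>. transv (snd p) q (fst p) \<in> U} \<in> sets (sph \<Otimes>\<^sub>M (sph :: (complex^'n) measure))" .
    show ?thesis by measurable
  qed
  finally show "{w \<in> space (sph \<Otimes>\<^sub>M sph). chain_map w \<inter> U \<noteq> {}} \<in> sets (sph \<Otimes>\<^sub>M sph)"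
    by (simp add: space_pair_measure)
qed (rule is_chain_map)

lemma is_chain_subset: "is_chain C \<Longrightarrow> C \<subseteq> sphere 0 1"
  by (auto simp: is_chain_def chain_of_def ideal_boundary_def)

lemma is_chain_proj_act_image:
  assumes "herm_iso f" "is_chain C"
  shows "is_chain (proj_act f ` C)"
proof -
  obtain g :: "complex^(1 option) \<Rightarrow> _" where g: "herm_iso g" "C = proj_act g ` sphere 0 1"
    using assms(2) by (auto simp: is_chain_iff)
  have "proj_act f ` C = proj_act (f \<circ> g) ` sphere 0 1"
    unfolding g(2) image_image using proj_act_comp[OF assms(1) g(1)] by (intro image_cong) auto
  then show ?thesis unfolding is_chain_iff using herm_iso_comp[OF assms(1) g(1)] by blast
qed

lemma measurable_chain_image:
  assumes f: "herm_iso f"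
  shows "(\<lambda>C. proj_act f ` C) \<in> chain_borel \<rightarrow>\<^sub>M chain_borel"
proof (rule measurable_chain_borelI)
  fix U :: "(complex^'b) set" assume U: "open U"
  have "continuous_on (sphere 0 1) (proj_act f)"
    using continuous_on_proj_act[OF f] by (rule continuous_on_subset) auto
  \<comment> \<open>Chains lie in the sphere, so it is enough that the preimage of \<open>U\<close>
    is relatively open there.\<close>
  then obtain V where V: "open V" "V \<inter> sphere 0 1 = proj_act f -` U \<inter> sphere 0 1"
    using U by (auto simp: continuous_on_open_invariant)
  have "{C \<in> space chain_borel. proj_act f ` C \<inter> U \<noteq> {}} = {C. is_chain C \<and> C \<inter> V \<noteq> {}}"
    unfolding space_chain_borel using V(2) is_chain_subset by blast
  then show "{C \<in> space chain_borel. proj_act f ` C \<inter> U \<noteq> {}} \<in> sets chain_borel"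
    using meets_open_in_chain_borel[OF V(1)] by simp
qed (simp add: space_chain_borel is_chain_proj_act_image f)

lemma proj_act_chain_through:
  assumes g: "herm_iso g" and h: "herm_iso h" and hg: "\<And>v. h (g v) = v" "\<And>v. g (h v) = v"
    and x: "x \<in> sphere 0 1" and y: "y \<in> sphere 0 1"
  shows "proj_act g ` chain_through x y = chain_through (proj_act g x) (proj_act g y)"
proof -
  have inv: "proj_act g (proj_act h z) = z" if "z \<in> sphere 0 1" for z
    using that by (subst proj_act_comp[OF g h]) (simp_all add: proj_act_def hg)
  have iff: "Re (trip (proj_act g x) (proj_act g y) (proj_act g z)) = 0 \<longleftrightarrow> Re (trip x y z) = 0"
    if "z \<in> sphere 0 1" for z
  proof -
    have n: "norm x \<le> 1" "norm y \<le> 1" "norm z \<le> 1" using x y that by auto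
    obtain k where "k > 0" "trip (proj_act g x) (proj_act g y) (proj_act g z) = of_real k * trip x y z"
      by (rule trip_proj_act[OF g n])
    then show ?thesis by simp
  qed
  show ?thesis
  proof (intro equalityI subsetI)
    fix z assume "z \<in> proj_act g ` chain_through x y"
    then show "z \<in> chain_through (proj_act g x) (proj_act g y)"
      using iff proj_act_sphere[OF g] by (auto simp: chain_through_def simp del: mem_sphere)
  next
    fix z assume "z \<in> chain_through (proj_act g x) (proj_act g y)"
    then have z: "z \<in> sphere 0 1" "Re (trip (proj_act g x) (proj_act g y) z) = 0"
      by (auto simp: chain_through_def)
    then have "proj_act h z \<in> chain_through x y"
      using iff[of "proj_act h z"] proj_act_sphere[OF h z(1)] inv[OF z(1)]
      by (simp add: chain_through_def del: mem_sphere)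
    then show "z \<in> proj_act g ` chain_through x y"
      using inv[OF z(1)] by (metis imageI)
  qed
qed

lemma SU1_isometry:
  assumes "A \<in> SU1"
  obtains h where "herm_iso ((*v) A)" "herm_iso h" "\<And>v. h (A *v v) = v" "\<And>v. A *v h v = v"
    "SU1_act A = proj_act ((*v) A)"
proof -
  have A: "herm (A *v x) (A *v y) = herm x y" "det A = 1" for x y using assms by (auto simp: SU1_def)
  then have "invertible A" by (simp add: invertible_det_nz)
  then obtain B where B: "A ** B = mat 1" "B ** A = mat 1" by (auto simp: invertible_def)
  have BA: "B *v (A *v v) = v" and AB: "A *v (B *v v) = v" for v
    using B by (simp_all add: matrix_vector_mul_assoc)
  have lin: "M *v (u + v) = M *v u + M *v v" "M *v (c *s v) = c *s (M *v v)" for M :: "complex^('a option)^('a option)" and u v c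
    by (simp_all add: matrix_vector_right_distrib vector_scalar_commute)
  show ?thesis
  proof (rule that)
    show "herm_iso ((*v) A)" using A lin by (simp add: herm_iso_def)
    have "herm (B *v u) (B *v v) = herm u v" for u v
      using A(1)[of "B *v u" "B *v v"] by (simp add: AB)
    then show "herm_iso ((*v) B)" using lin by (simp add: herm_iso_def)
    show "SU1_act A = proj_act ((*v) A)" by (simp add: fun_eq_iff SU1_act_def proj_act_def)
  qed (simp_all add: AB BA)
qed

interpretation sph2: pair_sigma_finite "sph :: (complex^'n::finite) measure" "sph :: (complex^'m::finite) measure" ..

text \<open>\<open>chain_map\<close> is equivariant, so a group element moves both defining points;
  it keeps null sets in each variable, and Fubini combines the two.\<close>

lemma in_invariant_class_chain_measure: "in_invariant_class (chain_measure :: (complex^'n::finite) set measure)"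
  unfolding in_invariant_class_def
proof (intro conjI ballI)
  interpret P: finite_measure "(sph :: (complex^'n) measure) \<Otimes>\<^sub>M (sph :: (complex^'n) measure)"
    by (intro finite_measure_pair_measure finite_measure_sph)
  show "sets chain_measure = sets (chain_borel :: (complex^'n) set measure)" by (simp add: chain_measure_def)
  interpret M: finite_measure "chain_measure :: (complex^'n) set measure"
    unfolding chain_measure_def by (rule P.finite_measure_distr[OF measurable_chain_map])
  show "sigma_finite_measure (chain_measure :: (complex^'n) set measure)" ..
  have "emeasure (chain_measure :: (complex^'n) set measure) (space chain_measure) =
      emeasure (sph \<Otimes>\<^sub>M sph) (UNIV :: ((complex^'n) \<times> (complex^'n)) set)"
    unfolding chain_measure_def
    by (subst emeasure_distr[OF measurable_chain_map])
       (use sets.top[of "chain_borel :: (complex^'n) set measure"] in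
         \<open>auto simp: space_chain_borel is_chain_map space_pair_measure intro!: arg_cong2[of _ _ _ _ emeasure]\<close>)
  also have "\<dots> = emeasure (sph \<Otimes>\<^sub>M sph) ((UNIV :: (complex^'n) set) \<times> (UNIV :: (complex^'n) set))" by simp
  also have "\<dots> = emeasure sph (UNIV :: (complex^'n) set) * emeasure sph (UNIV :: (complex^'n) set)"
    by (rule sph.emeasure_pair_measure_Times) auto
  also have "\<dots> \<noteq> 0" using sph_nonzero by simp
  finally show "emeasure (chain_measure :: (complex^'n) set measure) (space chain_measure) \<noteq> 0" .
next
  fix A :: "complex^('n option)^('n option)" and N
  assume A: "A \<in> SU1" and N: "N \<in> null_sets (chain_measure :: (complex^'n) set measure)"
  obtain h where g: "herm_iso ((*v) A)" and h: "herm_iso h"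
    and hg: "\<And>v. h (A *v v) = v" "\<And>v. A *v h v = v" and SA: "SU1_act A = proj_act ((*v) A)"
    using SU1_isometry[OF A] by metis
  have Ns: "N \<in> sets chain_borel" using N by (auto simp: chain_measure_def)
  have inv: "proj_act ((*v) A) ` proj_act h ` C = C" "proj_act h ` proj_act ((*v) A) ` C = C" if "is_chain C" for C
  proof -
    have "proj_act ((*v) A) (proj_act h z) = z" "proj_act h (proj_act ((*v) A) z) = z" if "z \<in> C" for z
      using that is_chain_subset[OF \<open>is_chain C\<close>] hg
      by (subst proj_act_comp[OF g h] proj_act_comp[OF h g]; force simp: proj_act_def)+
    then show "proj_act ((*v) A) ` proj_act h ` C = C" "proj_act h ` proj_act ((*v) A) ` C = C"
      by (force simp: image_image)+
  qed
  let ?N' = "(\<lambda>C. SU1_act A ` C) ` N"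
  have Nc: "is_chain C" if "C \<in> N" for C
    using sets.sets_into_space[OF Ns] that by (auto simp: space_chain_borel)
  \<comment> \<open>Written as a preimage under the inverse, the image is seen to be
    measurable.\<close>
  have N'eq: "?N' = (\<lambda>C. proj_act h ` C) -` N \<inter> space chain_borel"
  proof (intro equalityI subsetI)
    fix C assume "C \<in> ?N'"
    then show "C \<in> (\<lambda>C. proj_act h ` C) -` N \<inter> space chain_borel"
      using inv(2) Nc is_chain_proj_act_image[OF g] by (auto simp: SA space_chain_borel)
  next
    fix C assume "C \<in> (\<lambda>C. proj_act h ` C) -` N \<inter> space chain_borel"
    then show "C \<in> ?N'" using inv(1) unfolding SA space_chain_borel
      by (intro image_eqI[of _ _ "proj_act h ` C"]) auto
  qed
  have N's: "?N' \<in> sets chain_borel"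
    unfolding N'eq by (rule measurable_sets[OF measurable_chain_image[OF h] Ns])
  have [measurable]: "proj_act h \<in> borel_measurable borel" by (rule borel_measurable_proj_act[OF h])
  have "AE C in chain_measure. C \<notin> N" by (rule AE_not_in[OF N])
  then have "AE p in sph \<Otimes>\<^sub>M sph. chain_map p \<notin> N"
    unfolding chain_measure_def by (rule AE_distrD[OF measurable_chain_map])
  then have "AE x in sph. AE y in sph. chain_map (x, y) \<notin> N" by (rule sph2.AE_pair)
  then have "AE x in sph. AE y in sph. chain_map (proj_act h x, y) \<notin> N"
    by (rule AE_proj_act[OF h g hg(2)])
  then have "AE x in sph. AE y in sph. chain_map (proj_act h x, proj_act h y) \<notin> N"
    by (rule eventually_mono) (rule AE_proj_act[OF h g hg(2)])
  then have "AE x in sph. AE y in sph. chain_map (x, y) \<notin> ?N'"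
    using AE_sphere
  proof eventually_elim
    case (elim x)
    show ?case using elim(1) AE_sphere AE_sph_neq[of x]
    proof eventually_elim
      case (elim y)
      note x = \<open>x \<in> sphere 0 1\<close>
      have "chain_map (proj_act h x, proj_act h y) = proj_act h ` chain_map (x, y)"
      proof -
        have "proj_act h x \<noteq> proj_act h y"
        proof
          assume "proj_act h x = proj_act h y"
          then have "proj_act ((*v) A) (proj_act h x) = proj_act ((*v) A) (proj_act h y)" by simp
          then have "x = y" using x elim hg(2) by (simp add: proj_act_comp[OF g h]) (simp add: proj_act_def)
          then show False using elim by simp
        qed
        then show ?thesis
          using x elim proj_act_sphere[OF h] proj_act_chain_through[OF h g hg(2) hg(1), of x y]
          by (simp add: chain_map_def del: mem_sphere)
      qed
      then show ?case using elim(1) unfolding N'eq by auto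
    qed
  qed
  moreover have "{p \<in> space (sph \<Otimes>\<^sub>M sph). chain_map p \<notin> ?N'} =
      chain_map -` (space chain_borel - ?N') \<inter> space (sph \<Otimes>\<^sub>M sph)"
    using is_chain_map by (auto simp: space_chain_borel)
  then have "{p \<in> space (sph \<Otimes>\<^sub>M sph). chain_map p \<notin> ?N'} \<in> sets (sph \<Otimes>\<^sub>M sph)"
    using measurable_sets[OF measurable_chain_map sets.compl_sets[OF N's]] by simp
  ultimately have AE: "AE p in sph \<Otimes>\<^sub>M sph. chain_map p \<notin> ?N'"
    by (intro sph2.AE_pair_measure)
  have "{C \<in> space chain_borel. C \<notin> ?N'} = space chain_borel - ?N'" by auto
  then have "{C \<in> space chain_borel. C \<notin> ?N'} \<in> sets chain_borel" using N's by simp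
  with AE have "AE C in chain_measure. C \<notin> ?N'"
    unfolding chain_measure_def by (subst AE_distr_iff[OF measurable_chain_map])
  then show "?N' \<in> null_sets chain_measure"
    using N's by (subst AE_iff_null_sets) (auto simp: chain_measure_def)
qed

text \<open>Fubini for \<open>chain_measure\<close> draws the chain by two generic points, and the
  Cayley coordinate turns a generic triple on it into three generic parameters.\<close>

lemma AE_chain_triples:
  fixes R :: "complex^'n::finite \<Rightarrow> complex^'n \<Rightarrow> complex^'n \<Rightarrow> bool"
  assumes "almost_every_chain (\<lambda>C. almost_every_triple_on C R)"
  shows "AE x in sph. AE y in sph. AE s1 in lborel. AE s2 in lborel. AE s3 in lborel.
    R (transv y s1 x) (transv y s2 x) (transv y s3 x)"
proof -
  have "AE C in chain_measure. almost_every_triple_on C R"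
    using assms in_invariant_class_chain_measure by (auto simp: almost_every_chain_def)
  then have "AE p in sph \<Otimes>\<^sub>M sph. almost_every_triple_on (chain_map p) R"
    unfolding chain_measure_def by (rule AE_distrD[OF measurable_chain_map])
  then have "AE x in sph. AE y in sph. almost_every_triple_on (chain_map (x, y)) R" by (rule sph2.AE_pair)
  then show ?thesis using AE_sphere
  proof eventually_elim
    case (elim x)
    show ?case using elim(1) AE_sphere AE_sph_neq[of x]
    proof eventually_elim
      case (elim y)
      have x: "x \<in> sphere 0 1" and y: "y \<in> sphere 0 1" and ne: "x \<noteq> y"
        using elim \<open>x \<in> sphere 0 1\<close> by auto
      obtain g :: "complex^(1 option) \<Rightarrow> _" where g: "herm_iso g"
        "\<And>l. proj_act g (vec (cayley l) :: complex^1) = transv y (2 * l / (cmod (hp x y))\<^sup>2) x"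
        "proj_act g (vec (- 1)) = y"
        by (rule chain_parametrisation[OF x y ne]) blast
      have "chain_of (proj_act g) = chain_map (x, y)"
        using chain_through_image[OF x y ne g] x y ne by (simp add: chain_of_proj_act[OF g(1)] chain_map_def)
      then have "AE (a, b, c) in sphere_lebesgue \<Otimes>\<^sub>M sphere_lebesgue \<Otimes>\<^sub>M sphere_lebesgue.
          R (boundary_map (proj_act g) a) (boundary_map (proj_act g) b) (boundary_map (proj_act g) c)"
        using elim(1) embedding_proj_act[OF g(1)] unfolding almost_every_triple_on_def by blast
      then have "AE a in sph. AE b in sph. AE c in sph.
          R (boundary_map (proj_act g) a) (boundary_map (proj_act g) b) (boundary_map (proj_act g) c)"
        by (rule AE_sphere_lebesgue_triple)
      moreover have bm: "boundary_map (proj_act g) (vec (cayley l)) = transv y (2 / (cmod (hp x y))\<^sup>2 * l) x" for l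
        using boundary_map_proj_act[OF g(1), of "proj_act g" "vec (cayley l)"] g(2)[of l]
        by (simp add: norm_vec_1 norm_cayley)
      let ?k = "(cmod (hp x y))\<^sup>2 / 2"
      have k: "?k \<noteq> 0" using hp_nonzero[OF x y ne] by simp
      have line: "AE s in lborel. Q (transv y s x)" if "AE a in sph. Q (boundary_map (proj_act g) a)" for Q
      proof -
        have "AE l in lborel. Q (transv y (2 / (cmod (hp x y))\<^sup>2 * l) x)"
          using AE_circle[OF that] by (simp add: bm)
        from AE_lborel_scale[OF this k] show ?thesis using k by simp
      qed
      ultimately have "AE s1 in lborel. AE b in sph. AE c in sph.
          R (transv y s1 x) (boundary_map (proj_act g) b) (boundary_map (proj_act g) c)"
        by (intro line)
      then show ?case
      proof eventually_elim
        case (elim s1)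
        then have "AE s2 in lborel. AE c in sph. R (transv y s1 x) (transv y s2 x) (boundary_map (proj_act g) c)"
          by (rule line)
        then show ?case by eventually_elim (rule line)
      qed
    qed
  qed
qed

section \<open>Reduction to Borel maps\<close>

text \<open>Nested almost-everywhere statements become measurable conditions on their free
  variables, the side condition of every exchange of quantifiers.\<close>

lemma pred_AE:
  assumes M: "sigma_finite_measure M" and P: "Measurable.pred (N \<Otimes>\<^sub>M M) (case_prod P)"
  shows "Measurable.pred N (\<lambda>x. AE y in M. P x y)"
proof -
  interpret sigma_finite_measure M by (rule M)
  let ?Q = "{p \<in> space (N \<Otimes>\<^sub>M M). \<not> case_prod P p}"
  have Q: "?Q \<in> sets (N \<Otimes>\<^sub>M M)" using P by measurable
  have [measurable]: "(\<lambda>x. emeasure M (Pair x -` ?Q)) \<in> borel_measurable N"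
    by (rule measurable_emeasure_Pair[OF Q])
  have "Measurable.pred N (\<lambda>x. emeasure M (Pair x -` ?Q) = 0)" by measurable
  moreover have "(AE y in M. P x y) \<longleftrightarrow> emeasure M (Pair x -` ?Q) = 0" if "x \<in> space N" for x
  proof -
    have "Pair x -` ?Q = {y \<in> space M. \<not> P x y}" using that by (auto simp: space_pair_measure)
    then show ?thesis using sets_Pair1[OF Q, of x] by (subst AE_iff_measurable[OF _ refl]) simp_all
  qed
  ultimately show ?thesis by (subst measurable_cong) auto
qed

lemmas pred_AE_sph [measurable (raw)] = pred_AE[OF sph.sigma_finite_measure_axioms]
lemmas pred_AE_lborel [measurable (raw)] = pred_AE[OF sigma_finite_lborel]

lemma AE_swap:
  assumes "sigma_finite_measure M" "sigma_finite_measure N"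
    and "Measurable.pred (M \<Otimes>\<^sub>M N) (\<lambda>p. P (fst p) (snd p))"
    and "AE x in M. AE y in N. P x y"
  shows "AE y in N. AE x in M. P x y"
proof -
  interpret pair_sigma_finite M N by (rule pair_sigma_finite.intro[OF assms(1,2)])
  show ?thesis using assms(3,4) by (subst AE_commute[symmetric]) (auto simp: pred_def)
qed

lemmas AE_swap_sph_sph = AE_swap[OF sph.sigma_finite_measure_axioms sph.sigma_finite_measure_axioms]
lemmas AE_swap_sph_lborel = AE_swap[OF sph.sigma_finite_measure_axioms sigma_finite_lborel]
lemmas AE_swap_lborel_sph = AE_swap[OF sigma_finite_lborel sph.sigma_finite_measure_axioms]

text \<open>Collinearity of the images is the vanishing of the real part.  The second condition says that the
  orientation is kept, and it forces the images to be distinct.\<close>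

definition good where
  "good \<phi> x y z \<longleftrightarrow> Re (trip (\<phi> x) (\<phi> y) (\<phi> z)) = 0 \<and> Im (trip (\<phi> x) (\<phi> y) (\<phi> z)) * Im (trip x y z) > 0"

lemma good_rotate: "good \<phi> x y z \<longleftrightarrow> good \<phi> y z x"
  unfolding good_def trip_rotate[of x y z] trip_rotate[of "\<phi> x" "\<phi> y" "\<phi> z"] ..

text \<open>Both triple products are conjugated, so the product of the imaginary parts keeps its
  sign.\<close>

lemma good_swap: "good \<phi> x z y \<longleftrightarrow> good \<phi> x y z"
  unfolding good_def trip_swap[of _ z y] trip_swap[of _ "\<phi> z" "\<phi> y"] by simp

lemma pred_good [measurable (raw)]:
  assumes [measurable]: "\<phi> \<in> borel_measurable borel"
    "f \<in> borel_measurable M" "g \<in> borel_measurable M" "h \<in> borel_measurable M"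
  shows "Measurable.pred M (\<lambda>w. good \<phi> (f w) (g w) (h w))"
  unfolding good_def by measurable

text \<open>The hypothesis concerns three translates of \<open>x\<close> about a fourth point
  \<open>y\<close>. Fixing the first parameter and translating \<open>x\<close> back makes the first
  point itself generic; reading the chain from that point and repeating the argument does the same
  for the second.\<close>

lemma AE_good_reduce:
  assumes \<phi> [measurable]: "\<phi> \<in> borel_measurable borel"
    and *: "AE x in sph. AE y in sph. AE s1 in lborel. AE s2 in lborel. AE s3 in lborel.
      good \<phi> (transv y s1 x) (transv y s2 x) (transv y s3 x)"
  shows "AE x in sph. AE y in sph. AE t in lborel. good \<phi> x y (transv x t y)"
proof -
  have "AE y in sph. AE x in sph. AE s1 in lborel. AE s2 in lborel. AE s3 in lborel.
      good \<phi> (transv y s1 x) (transv y s2 x) (transv y s3 x)"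
    by (rule AE_swap_sph_sph[OF _ *]) measurable
  then have "AE y in sph. AE x in sph. AE s2 in lborel. AE s3 in lborel.
      good \<phi> x (transv y s2 x) (transv y s3 x)"
    using AE_sphere
  proof eventually_elim
    case (elim y)
    have "AE s1 in lborel. AE x in sph. AE s2 in lborel. AE s3 in lborel.
      good \<phi> (transv y s1 x) (transv y s2 x) (transv y s3 x)"
      by (rule AE_swap_sph_lborel[OF _ elim(1)]) measurable
    then obtain s1 where "AE x in sph. AE s2 in lborel. AE s3 in lborel.
      good \<phi> (transv y s1 x) (transv y s2 x) (transv y s3 x)"
      using AE_ex_lborel by blast
    then have "AE x in sph. AE s2 in lborel. AE s3 in lborel.
      good \<phi> (transv y s1 (transv y (- s1) x)) (transv y s2 (transv y (- s1) x)) (transv y s3 (transv y (- s1) x))"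
      by (rule AE_transv[OF elim(2)])
    then show ?case using AE_sphere
    proof eventually_elim
      case (elim x)
      have "AE s2 in lborel. AE s3 in lborel. good \<phi> x (transv y (s2 - s1) x) (transv y (s3 - s1) x)"
        using elim(1) unfolding transv_add[OF elim(2) \<open>y \<in> sphere 0 1\<close>] by simp
      then have "AE s2 in lborel. AE s3 in lborel. good \<phi> x (transv y (s2 - s1) x) (transv y s3 x)"
        by (rule eventually_mono) (drule AE_lborel_translate[of _ s1], simp)
      then show ?case by (drule_tac AE_lborel_translate[of _ s1]) simp
    qed
  qed
  then have "AE x in sph. AE y in sph. AE s2 in lborel. AE s3 in lborel.
      good \<phi> x (transv y s2 x) (transv y s3 x)"
    by (rule AE_swap_sph_sph[rotated]) measurable
  then show ?thesis using AE_sphere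
  proof eventually_elim
    case (elim x)
    have "AE y in sph. AE t2 in lborel. AE t3 in lborel. good \<phi> x (transv x t2 y) (transv x t3 y)"
      using elim(1) AE_sphere AE_sph_neq[of x]
    proof eventually_elim
      case (elim y)
      have h: "- 1 / (cmod (hp x y))\<^sup>2 \<noteq> 0"
        using hp_nonzero[OF \<open>x \<in> sphere 0 1\<close> elim(2)] elim(3) by auto
      have eq: "transv y (- 1 / (cmod (hp x y))\<^sup>2 / t) x = transv x t y" if "t \<noteq> 0" for t
        using transv_reciprocal[OF \<open>x \<in> sphere 0 1\<close> elim(2), of "- 1 / (cmod (hp x y))\<^sup>2 / t"] elim(3) that h
        by auto
      \<comment> \<open>Parameters about \<open>y\<close> and about \<open>x\<close> are reciprocal
        up to a constant, so they have the same null sets.\<close>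
      have line: "AE t in lborel. Q (transv x t y)" if "AE s in lborel. Q (transv y s x)" for Q
        using AE_lborel_reciprocal[OF that h] AE_lborel_nonzero by eventually_elim (metis eq)
      have "AE t2 in lborel. AE s3 in lborel. good \<phi> x (transv x t2 y) (transv y s3 x)"
        by (rule line[OF elim(1)])
      then show ?case by eventually_elim (rule line)
    qed
    then have "AE t2 in lborel. AE y in sph. AE t3 in lborel. good \<phi> x (transv x t2 y) (transv x t3 y)"
      by (rule AE_swap_sph_lborel[rotated]) measurable
    then obtain t2 where "AE y in sph. AE t3 in lborel. good \<phi> x (transv x t2 y) (transv x t3 y)"
      using AE_ex_lborel by blast
    then have "AE y in sph. AE t3 in lborel. good \<phi> x (transv x t2 (transv x (- t2) y)) (transv x t3 (transv x (- t2) y))"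
      by (rule AE_transv[OF elim(2)])
    then show ?case using AE_sphere
    proof eventually_elim
      case (elim y)
      have "AE t3 in lborel. good \<phi> x y (transv x (t3 - t2) y)"
        using elim(1) unfolding transv_add[OF elim(2) \<open>x \<in> sphere 0 1\<close>] by simp
      then show ?case by (drule_tac AE_lborel_translate[of _ t2]) simp
    qed
  qed
qed

text \<open>\<open>\<phi>\<close> is only Lebesgue measurable, but each of its real coordinates
  agrees almost everywhere with a Borel function.\<close>

lemma measurable_completion_sphere:
  fixes \<phi> :: "complex^'p::finite \<Rightarrow> complex^'q::finite"
  assumes "\<phi> \<in> completion sphere_lebesgue \<rightarrow>\<^sub>M restrict_space borel (sphere 0 1)"
  obtains \<psi> where "\<psi> \<in> borel_measurable borel" "\<And>x. \<psi> x \<in> sphere 0 1" "AE x in sph. \<phi> x = \<psi> x"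
proof -
  have \<phi>m: "\<phi> \<in> borel_measurable (completion sphere_lebesgue)" and \<phi>s: "\<And>x. x \<in> sphere 0 1 \<Longrightarrow> \<phi> x \<in> sphere 0 1"
    using assms measurable_space[OF assms]
    by (auto simp: measurable_restrict_space2_iff sphere_lebesgue_def space_restrict_space)
  have S: "sphere (0 :: complex^'p) 1 \<in> sets borel" by (simp add: borel_closed)
  have "\<exists>g\<in>borel_measurable borel. AE x in sph. \<phi> x \<bullet> b = (g x :: real)" for b
  proof -
    have "(\<lambda>x. \<phi> x \<bullet> b) \<in> borel_measurable (completion sphere_lebesgue)" using \<phi>m by measurable
    then obtain g where g: "g \<in> borel_measurable sphere_lebesgue" "AE x in sphere_lebesgue. \<phi> x \<bullet> b = g x"
      using completion_ex_borel_measurable_real by blast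
    have "(\<lambda>x. if x \<in> sphere 0 1 then g x else 0) \<in> borel_measurable sph"
      using g(1) unfolding sphere_lebesgue_eq
      by (subst (asm) measurable_restrict_space_iff[where c = 0]) (use S in auto)
    moreover have "AE x in sph. \<phi> x \<bullet> b = (if x \<in> sphere 0 1 then g x else 0)"
      using g(2)[unfolded AE_sphere_lebesgue_iff] AE_sphere by eventually_elim simp
    ultimately show ?thesis by (intro bexI[of _ "\<lambda>x. if x \<in> sphere 0 1 then g x else 0"]) auto
  qed
  then obtain g where g [measurable]: "\<And>b. g b \<in> borel_measurable borel" and AE: "\<And>b. AE x in sph. \<phi> x \<bullet> b = (g b x :: real)"
    by metis
  define \<psi>1 where "\<psi>1 x = (\<Sum>b\<in>Basis. g b x *\<^sub>R b)" for x
  define e where "e = (axis undefined 1 :: complex^'q)"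
  \<comment> \<open>The assembled coordinates may leave the sphere on a null set, where a fixed unit
    vector is the default.\<close>
  define \<psi> where "\<psi> x = (if \<psi>1 x \<in> sphere 0 1 then \<psi>1 x else e)" for x
  have [measurable]: "\<psi>1 \<in> borel_measurable borel" unfolding \<psi>1_def[abs_def] by measurable
  have [measurable]: "sphere (0 :: complex^'q) 1 \<in> sets borel" by (simp add: borel_closed)
  show ?thesis
  proof (rule that)
    show "\<psi> \<in> borel_measurable borel" unfolding \<psi>_def[abs_def] by measurable
    show "\<psi> x \<in> sphere 0 1" for x by (simp add: \<psi>_def e_def)
    have "AE x in sph. \<forall>b\<in>Basis. \<phi> x \<bullet> b = g b x"
      by (intro AE_finite_allI AE) simp
    then show "AE x in sph. \<phi> x = \<psi> x" using AE_sphere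
    proof eventually_elim
      case (elim x)
      then have "\<psi>1 x = (\<Sum>b\<in>Basis. (\<phi> x \<bullet> b) *\<^sub>R b)" by (simp add: \<psi>1_def)
      then have "\<psi>1 x = \<phi> x" by (simp add: euclidean_representation)
      then show ?case using \<phi>s elim by (simp add: \<psi>_def)
    qed
  qed
qed

lemma AE_good:
  fixes \<phi> \<psi> :: "complex^'p::finite \<Rightarrow> complex^'q::finite"
  assumes chains: "almost_every_chain (\<lambda>C. almost_every_triple_on C (\<lambda>\<xi> \<eta> \<zeta>. distinct [\<xi>, \<eta>, \<zeta>] \<longrightarrow>
           distinct [\<phi> \<xi>, \<phi> \<eta>, \<phi> \<zeta>] \<and> on_common_chain (\<phi> \<xi>) (\<phi> \<eta>) (\<phi> \<zeta>) \<and>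
           (positively_oriented (\<phi> \<xi>) (\<phi> \<eta>) (\<phi> \<zeta>) \<longleftrightarrow> positively_oriented \<xi> \<eta> \<zeta>)))"
    and \<psi> [measurable]: "\<psi> \<in> borel_measurable borel" and eq: "AE x in sph. \<phi> x = \<psi> x"
  shows "AE x in sph. AE y in sph. AE t in lborel. good \<psi> x y (transv x t y)"
proof -
  obtain N where N: "N \<in> null_sets sph" "{x. \<phi> x \<noteq> \<psi> x} \<subseteq> N"
    using eq by (auto elim!: AE_E simp: null_sets_def)
  then have [measurable]: "N \<in> sets borel" by auto
  have notN: "AE x in sph. x \<notin> N" by (rule AE_not_in[OF N(1)])
  \<comment> \<open>A null set of the sphere need not meet every chain in a null set. Fubini over
    translations shows that it does for generic chains, so the hypothesis passes from
    \<open>\<phi>\<close> to \<open>\<psi>\<close>.\<close>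
  have "AE y in sph. AE x in sph. AE s in lborel. transv y s x \<notin> N"
    using AE_sphere
  proof eventually_elim
    case (elim y)
    have "AE s in lborel. AE x in sph. transv y s x \<notin> N"
      using AE_transv[OF elim notN] by simp
    then show ?case by (rule AE_swap_lborel_sph[rotated]) measurable
  qed
  then have tN: "AE x in sph. AE y in sph. AE s in lborel. transv y s x \<notin> N"
    by (rule AE_swap_sph_sph[rotated]) measurable
  have "AE x in sph. AE y in sph. AE s1 in lborel. AE s2 in lborel. AE s3 in lborel.
      good \<psi> (transv y s1 x) (transv y s2 x) (transv y s3 x)"
    using AE_chain_triples[OF chains] tN AE_sphere
  proof eventually_elim
    case (elim x)
    note x = elim(3)
    show ?case using elim(1,2) AE_sphere AE_sph_neq[of x]
    proof eventually_elim
      case (elim y)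
      note y = elim(3) and ne = elim(4)[symmetric] and tN = elim(2)
      have inj: "s = s'" if "transv y s x = transv y s' x" for s s'
        using trip_transv(2)[OF x y ne] that by metis
      have step: "good \<psi> (transv y s1 x) (transv y s2 x) (transv y s3 x)"
        if s: "s1 \<noteq> s2" "s1 \<noteq> s3" "s2 \<noteq> s3"
          and nN: "transv y s1 x \<notin> N" "transv y s2 x \<notin> N" "transv y s3 x \<notin> N"
          and R: "distinct [transv y s1 x, transv y s2 x, transv y s3 x] \<longrightarrow>
           distinct [\<phi> (transv y s1 x), \<phi> (transv y s2 x), \<phi> (transv y s3 x)] \<and>
           on_common_chain (\<phi> (transv y s1 x)) (\<phi> (transv y s2 x)) (\<phi> (transv y s3 x)) \<and>
           (positively_oriented (\<phi> (transv y s1 x)) (\<phi> (transv y s2 x)) (\<phi> (transv y s3 x)) \<longleftrightarrow>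
            positively_oriented (transv y s1 x) (transv y s2 x) (transv y s3 x))" for s1 s2 s3
      proof -
        define a b c where "a = transv y s1 x" and "b = transv y s2 x" and "c = transv y s3 x"
        have d: "distinct [a, b, c]" using s inj by (auto simp: a_def b_def c_def)
        have eqs: "\<phi> a = \<psi> a" "\<phi> b = \<psi> b" "\<phi> c = \<psi> c" using nN N(2) by (auto simp: a_def b_def c_def)
        have R': "distinct [\<psi> a, \<psi> b, \<psi> c]" "on_common_chain (\<psi> a) (\<psi> b) (\<psi> c)"
          "positively_oriented (\<psi> a) (\<psi> b) (\<psi> c) \<longleftrightarrow> positively_oriented a b c"
          using R[folded a_def b_def c_def] d unfolding eqs by auto
        have occ: "on_common_chain a b c"
          unfolding on_common_chain_def a_def b_def c_def
          using is_chain_through[OF x y ne] chain_through_eq[OF x y ne] by blast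
        have nz: "Im (trip u v w) \<noteq> 0" if "on_common_chain u v w" "distinct [u, v, w]" for u v w :: "complex^'k::finite"
        proof -
          have "trip u v w \<noteq> 0"
            using hp_nonzero on_common_chainD[OF that(1)] that(2)
            by (auto simp: trip_def tri_def simp del: mem_sphere)
          then show ?thesis using on_common_chainD(4)[OF that(1)] by (simp add: complex_eq_iff)
        qed
        have "Im (trip (\<psi> a) (\<psi> b) (\<psi> c)) < 0 \<longleftrightarrow> Im (trip a b c) < 0"
          using R'(3) positively_oriented_iff[OF R'(2,1)] positively_oriented_iff[OF occ d] by simp
        \<comment> \<open>Equivalent orientations mean equal signs, because neither imaginary part
          vanishes.\<close>
        then have "Im (trip (\<psi> a) (\<psi> b) (\<psi> c)) * Im (trip a b c) > 0"
          using nz[OF R'(2,1)] nz[OF occ d] by (smt (verit) mult_neg_neg mult_pos_pos)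
        then show ?thesis
          using on_common_chainD(4)[OF R'(2)] by (simp add: good_def a_def b_def c_def)
      qed
      show ?case using elim(1) tN
      proof eventually_elim
        case (elim s1)
        note e1 = elim(2)
        show ?case using elim(1) tN AE_lborel_singleton[of s1]
        proof eventually_elim
          case (elim s2)
          note e2 = elim(2,3)
          show ?case using elim(1) tN AE_lborel_singleton[of s1] AE_lborel_singleton[of s2]
          proof eventually_elim
            case (elim s3)
            show ?case by (rule step[OF e2(2)[symmetric] elim(3)[symmetric] elim(4)[symmetric] e1 e2(1) elim(2) elim(1)])
          qed
        qed
      qed
    qed
  qed
  then show ?thesis by (rule AE_good_reduce[OF \<psi>])
qed

section \<open>Normal vectors and generic triples off a chain\<close>

lemma sum_option: "(\<Sum>k\<in>UNIV. f k) = f None + (\<Sum>i\<in>UNIV. f (Some i))" for f :: "'n::finite option \<Rightarrow> 'a::comm_monoid_add"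
  by (simp add: UNIV_option_conv sum.reindex)

text \<open>The vectors of \<open>K\<close> and the zero vector become rows of a square matrix,
  which is then singular; a kernel vector, conjugated and with its \<open>None\<close> coordinate
  negated, is the normal.\<close>

lemma ex_herm_orthogonal:
  fixes K :: "(complex^('n::finite option)) set"
  assumes K: "finite K" "card K < CARD('n option)"
  obtains n where "n \<noteq> 0" "\<And>v. v \<in> K \<Longrightarrow> herm v n = 0"
proof -
  \<comment> \<open>The strict bound leaves a row for 0 beside the vectors of
    \<open>K\<close>.\<close>
  have "card (insert 0 K) \<le> CARD('n option)" using card_insert_le_m1[of "CARD('n option)" K 0] K by simp
  then obtain e :: "complex^('n option) \<Rightarrow> 'n option" where e: "inj_on e (insert 0 K)"
    using card_le_inj[of "insert 0 K" "UNIV :: 'n option set"] K by (metis finite finite_insert)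
  define r where "r i = (if i \<in> e ` insert 0 K then inv_into (insert 0 K) e i else 0)" for i
  have re: "r (e v) = v" if "v \<in> insert 0 K" for v using inv_into_f_f[OF e that] imageI[OF that, of e] by (simp only: r_def if_True)
  define A where "A = (\<chi> i. r i)"
  have "row (e 0) A = 0" using re[of 0] by (simp add: row_def A_def vec_eq_iff)
  then have "det A = 0" by (rule det_zero_row(1))
  then have "\<not> invertible A" by (simp add: invertible_det_nz)
  then have "\<not> (\<exists>B. B ** A = mat 1)" by (simp add: invertible_left_inverse)
  then obtain x where x: "A *v x = 0" "x \<noteq> 0" unfolding matrix_left_invertible_ker by blast
  define n where "n = (\<chi> k. cnj (x $ k) * (if k = None then - 1 else 1))"
  show ?thesis
  proof (rule that)
    obtain k where "x $ k \<noteq> 0" using x(2) by (auto simp: vec_eq_iff)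
    then have "n $ k \<noteq> 0" by (simp add: n_def)
    then show "n \<noteq> 0" by auto
    fix v assume "v \<in> K"
    then have "(A *v x) $ e v = (\<Sum>k\<in>UNIV. v $ k * x $ k)"
      using re[of v] by (simp add: matrix_vector_mult_def A_def)
    also have "\<dots> = herm v n" by (simp add: sum_option herm_def n_def)
    finally show "herm v n = 0" using x(1) by simp
  qed
qed

lemma on_common_chainI:
  assumes "x \<in> sphere 0 1" "y \<in> sphere 0 1" "z \<in> sphere 0 1" "Re (trip x y z) = 0"
  shows "on_common_chain x y z"
proof (cases "x = y")
  case False
  then have "x \<in> chain_through x y" "y \<in> chain_through x y" "z \<in> chain_through x y"
    using assms trip_same[of x y] by (auto simp: chain_through_def)
  then show ?thesis
    unfolding on_common_chain_def using is_chain_through[OF assms(1,2) False] by blast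
next
  case True
  \<comment> \<open>When the first two points coincide, any other point determines a chain with
    them; the antipode serves if all three coincide.\<close>
  obtain w where w: "w \<in> sphere 0 1" "w \<noteq> x" "z = x \<or> z = w"
  proof (cases "z = x")
    case True
    show ?thesis
    proof (rule that[of "- x"])
      show "- x \<noteq> x"
      proof
        assume "- x = x"
        then have "2 *\<^sub>R x = 0" by (metis add.left_inverse scaleR_2)
        then have "x = 0" by simp
        then show False using assms(1) by simp
      qed
    qed (use assms True in auto)
  qed (use assms that in auto)
  then have "x \<in> chain_through x w" "z \<in> chain_through x w" "is_chain (chain_through x w)"
    using assms is_chain_through[of x w] trip_same[of x w] by (auto simp: chain_through_def simp del: mem_sphere)
  with True show ?thesis unfolding on_common_chain_def by blast
qed

text \<open>Here the dimension enters: with at least three homogeneous coordinates the lifts of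
  \<open>x\<close> and \<open>y\<close> have a common normal \<open>n\<close>, and a generic
  \<open>z\<close> is not orthogonal to it, hence off their chain. So (ii) applies to generic
  triples.\<close>

lemma AE_not_on_chain:
  fixes \<phi> \<psi> :: "complex^'p::finite \<Rightarrow> complex^'q::finite"
  assumes "CARD('p) \<ge> 2"
    and "AE (\<xi>, \<eta>, \<zeta>) in sphere_lebesgue \<Otimes>\<^sub>M sphere_lebesgue \<Otimes>\<^sub>M sphere_lebesgue.
           \<not> on_common_chain \<xi> \<eta> \<zeta> \<longrightarrow> \<not> on_common_chain (\<phi> \<xi>) (\<phi> \<eta>) (\<phi> \<zeta>)"
    and \<psi>: "\<And>x. \<psi> x \<in> sphere 0 1" and eq: "AE x in sph. \<phi> x = \<psi> x"
  shows "AE x in sph. AE y in sph. AE z in sph. Re (trip (\<psi> x) (\<psi> y) (\<psi> z)) \<noteq> 0"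
  using AE_sphere_lebesgue_triple[OF assms(2)] eq AE_sphere
proof eventually_elim
  case (elim x)
  note ex = elim(2,3)
  show ?case using elim(1) eq AE_sphere AE_sph_neq[of x]
  proof eventually_elim
    case (elim y)
    note ey = elim(2,3,4)
    have "card {homog x, homog y} < CARD('p option)" using assms(1)
      by (simp add: card_insert_if)
    then obtain n where n: "n \<noteq> 0" "herm (homog x) n = 0" "herm (homog y) n = 0"
      by (rule ex_herm_orthogonal[of "{homog x, homog y}", rotated]) blast+
    show ?case using elim(1) eq AE_sphere AE_herm_nonzero[OF n(1)]
    proof eventually_elim
      case (elim z)
      have "Re (trip x y z) \<noteq> 0"
      proof
        assume "Re (trip x y z) = 0"
        then have "homog z = (hp z y / hp x y) *s homog x + (hp z x / hp y x) *s homog y"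
          unfolding trip_def using ex ey elim
          by (subst (asm) isotropic_triple(2)) (auto simp: hp_self herm_homog_eq_0_iff simp del: mem_sphere)
        then have "herm (homog z) n = (hp z y / hp x y) * herm (homog x) n + (hp z x / hp y x) * herm (homog y) n"
          by (metis herm_add_left herm_scale_left)
        then show False using n elim by simp
      qed
      then have "\<not> on_common_chain x y z" using on_common_chainD(4) by blast
      then have "\<not> on_common_chain (\<psi> x) (\<psi> y) (\<psi> z)" using elim ex ey by simp
      then show ?case using on_common_chainI \<psi> by blast
    qed
  qed
qed

section \<open>Collinearity and additivity\<close>

text \<open>For lifts whose product with \<open>e\<close> is 1, transvections about \<open>e\<close>
  are translations along \<open>e\<close>. Independence of \<open>e\<close>, \<open>x\<close>,
  \<open>y\<close> forces equal affine coefficients before and after, and comparison along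
  \<open>e\<close> writes \<open>c\<close> as the combination of \<open>a\<close> and
  \<open>b\<close> with weights \<open>\<alpha>\<close> and \<open>1 - \<alpha>\<close>. As
  \<open>\<alpha>\<close> is not real, the imaginary part gives \<open>a = b\<close>.\<close>

lemma isotropic_translation_eq:
  assumes e: "herm e e = 0" and x: "herm x x = 0" and y: "herm y y = 0" and v: "herm v v = 0"
    and norm: "herm x e = 1" "herm y e = 1" "herm v e = 1"
    and v1: "v = \<alpha> *s x + \<beta> *s y" and ne: "v \<noteq> x" "v \<noteq> y"
    and v2: "v + (\<i> * of_real c) *s e = \<alpha>' *s (x + (\<i> * of_real a) *s e) + \<beta>' *s (y + (\<i> * of_real b) *s e)"
    and indep: "Re (tri e x y) \<noteq> 0"
  shows "a = b"
proof -
  have s1: "\<alpha> + \<beta> = 1" using arg_cong[OF v1, of "\<lambda>w. herm w e"] by (simp add: herm_linear norm)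
  have s2: "\<alpha>' + \<beta>' = 1"
    using arg_cong[OF v2, of "\<lambda>w. herm w e"] by (simp add: herm_linear norm e)
  have b: "\<beta> = 1 - \<alpha>" "\<beta>' = 1 - \<alpha>'" using s1 s2 by (simp_all add: algebra_simps)
  have diff: "(\<alpha>' - \<alpha>) *s (x - y) = (\<i> * (of_real c - \<alpha>' * of_real a - \<beta>' * of_real b)) *s e"
    using v2 unfolding v1 b by (simp add: vec_eq_iff algebra_simps)
  have e0: "e \<noteq> 0" using norm(1) by auto
  have eq: "\<alpha>' = \<alpha>"
  proof (rule ccontr)
    assume "\<alpha>' \<noteq> \<alpha>"
    define m where "m = \<i> * (of_real c - \<alpha>' * of_real a - \<beta>' * of_real b) / (\<alpha>' - \<alpha>)"
    have "x - y = (1 / (\<alpha>' - \<alpha>)) *s ((\<alpha>' - \<alpha>) *s (x - y))"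
      using \<open>\<alpha>' \<noteq> \<alpha>\<close> by (simp only: vector_smult_assoc) simp
    also have "\<dots> = m *s e" unfolding diff by (simp add: m_def)
    finally have "y = (- m) *s e + 1 *s x" by (simp add: vec_eq_iff algebra_simps)
    then have "Re (tri e x y) = 0" by (rule Re_tri_span[OF e x y])
    with indep show False ..
  qed
  then have "(\<i> * (of_real c - \<alpha> * of_real a - (1 - \<alpha>) * of_real b)) *s e = 0"
    using diff by (simp add: b)
  then have "\<i> * (of_real c - \<alpha> * of_real a - (1 - \<alpha>) * of_real b) = 0"
    using e0 by (simp only: vector_mul_eq_0) simp
  then have "of_real c - \<alpha> * of_real a - (1 - \<alpha>) * of_real b = 0"
    by (simp only: mult_eq_0_iff) simp
  then have c: "of_real c = \<alpha> * of_real a + (1 - \<alpha>) * of_real b"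
    by (simp add: algebra_simps)
  have "Im \<alpha> * (a - b) = 0" using arg_cong[OF c, of Im] by (simp add: algebra_simps) (metis)
  \<comment> \<open>On the real line through two lifts only these two are isotropic: the combination
    with real weight \<open>r\<close> has product \<open>r * (1 - r)\<close> times a nonzero number
    with itself.\<close>
  moreover have "Im \<alpha> \<noteq> 0"
  proof
    assume "Im \<alpha> = 0"
    then have r: "\<alpha> = of_real (Re \<alpha>)" by (simp add: complex_eq_iff)
    define r where "r = Re \<alpha>"
    have ra: "\<alpha> = of_real r" using r by (simp add: r_def)
    have ex: "herm e x = 1" using norm(1) cnj_herm by (metis complex_cnj_one)
    have "0 = herm (\<alpha> *s x + \<beta> *s y) (\<alpha> *s x + \<beta> *s y)" using v unfolding v1 by simp
    also have "\<dots> = of_real (r * (1 - r)) * (herm x y + cnj (herm x y))"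
      by (simp add: herm_linear x y b ra cnj_herm algebra_simps)
    finally have "r * (1 - r) * (2 * Re (herm x y)) = 0"
      by (metis Re_complex_of_real complex_add_cnj of_real_0 of_real_mult)
    moreover have "Re (herm x y) \<noteq> 0" using indep by (simp add: tri_def ex norm)
    ultimately have "r = 0 \<or> r = 1" by simp
    then show False using ne v1 by (auto simp: b ra vec_eq_iff)
  qed
  ultimately show "a = b" by simp
qed

text \<open>Projective form of the previous lemma: every lift is divided by its product with that of
  \<open>E\<close>.\<close>

lemma transv_translation_eq:
  assumes S: "E \<in> sphere 0 1" "X \<in> sphere 0 1" "Y \<in> sphere 0 1" "V \<in> sphere 0 1"
    and indep: "Re (trip E X Y) \<noteq> 0" and col: "Re (trip X Y V) = 0" and ne: "V \<noteq> X" "V \<noteq> Y"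
    and col': "Re (trip (transv E a X) (transv E b Y) (transv E c V)) = 0"
    and ne': "transv E a X \<noteq> transv E b Y"
  shows "a = b"
proof -
  have neq: "X \<noteq> E" "Y \<noteq> E" "X \<noteq> Y"
    using indep S by (auto simp: trip_def tri_def hp_self simp del: mem_sphere)
  have VE: "V \<noteq> E" using col indep trip_rotate[of E X Y] by auto
  have nz: "hp X E \<noteq> 0" "hp Y E \<noteq> 0" "hp V E \<noteq> 0" "hp X Y \<noteq> 0"
    using hp_nonzero S neq VE by auto
  let ?n = "\<lambda>Z. (1 / hp Z E) *s homog Z"
  let ?t = "\<lambda>a Z. ?n Z + (\<i> * of_real a) *s homog E"
  have iso: "herm (?n Z) (?n Z) = 0" if "Z \<in> sphere 0 1" for Z
    using that by (simp add: herm_linear hp_self del: mem_sphere)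
  have tr: "\<exists>k. k \<noteq> 0 \<and> homog (transv E r Z) = k *s ?t r Z"
    if Z: "Z \<in> sphere 0 1" "hp Z E \<noteq> 0" for r Z
  proof -
    obtain k where k: "k \<noteq> 0" "homog (transv E r Z) = k *s tvec (homog E) r (homog Z)"
      using homog_transv[OF Z(1) S(1)] by blast
    have "tvec (homog E) r (homog Z) = hp Z E *s ?t r Z"
      using Z(2) by (simp add: tvec_def vec_eq_iff algebra_simps)
    then show ?thesis using k Z(2) by (intro exI[of _ "k * hp Z E"]) simp
  qed
  obtain kx where kx: "kx \<noteq> 0" "homog (transv E a X) = kx *s ?t a X" using tr[OF S(2) nz(1)] by blast
  obtain ky where ky: "ky \<noteq> 0" "homog (transv E b Y) = ky *s ?t b Y" using tr[OF S(3) nz(2)] by blast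
  obtain kv where kv: "kv \<noteq> 0" "homog (transv E c V) = kv *s ?t c V" using tr[OF S(4) nz(3)] by blast
  obtain A B where AB: "homog V = A *s homog X + B *s homog Y"
    using isotropic_triple(2)[OF hp_self[OF S(2)] hp_self[OF S(3)] hp_self[OF S(4)] nz(4)]
      col unfolding trip_def by blast
  have S': "transv E a X \<in> sphere 0 1" "transv E b Y \<in> sphere 0 1" "transv E c V \<in> sphere 0 1"
    using transv_sphere S by auto
  obtain A' B' where AB': "homog (transv E c V) = A' *s homog (transv E a X) + B' *s homog (transv E b Y)"
    using isotropic_triple(2)[OF hp_self[OF S'(1)] hp_self[OF S'(2)] hp_self[OF S'(3)]
        hp_nonzero[OF S'(1,2) ne']] col' unfolding trip_def by blast
  have inj: "Z = Z'" if "?n Z = ?n Z'" "hp Z E \<noteq> 0" "hp Z' E \<noteq> 0" for Z Z'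
    using arg_cong[OF that(1), of dehomog] that(2,3) by (simp add: dehomog_scale)
  show ?thesis
  proof (rule isotropic_translation_eq[of "homog E" "?n X" "?n Y" "?n V"
        "A * hp X E / hp V E" "B * hp Y E / hp V E" c "A' * kx / kv" a "B' * ky / kv" b])
    show "?n V = (A * hp X E / hp V E) *s ?n X + (B * hp Y E / hp V E) *s ?n Y"
      using AB nz by (simp add: vec_eq_iff field_simps)
    have "kv *s ?t c V = A' *s (kx *s ?t a X) + B' *s (ky *s ?t b Y)"
      using AB' unfolding kx(2) ky(2) kv(2) .
    then have "(1 / kv) *s (kv *s ?t c V) = (1 / kv) *s (A' *s (kx *s ?t a X) + B' *s (ky *s ?t b Y))" by simp
    then show "?t c V = (A' * kx / kv) *s ?t a X + (B' * ky / kv) *s ?t b Y"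
      using kv(1) by (simp add: vector_add_ldistrib mult.assoc)
    show "?n V \<noteq> ?n X" "?n V \<noteq> ?n Y" using inj nz ne by blast+
    show "herm (?n X) (homog E) = 1" "herm (?n Y) (homog E) = 1" "herm (?n V) (homog E) = 1"
      using nz by (simp_all add: herm_linear)
    have "tri (homog E) (?n X) (?n Y) =
        of_real ((cmod 1)\<^sup>2 * (cmod (1 / hp X E))\<^sup>2 * (cmod (1 / hp Y E))\<^sup>2) * tri (homog E) (homog X) (homog Y)"
      using tri_scale[of 1 "homog E" "1 / hp X E" "homog X" "1 / hp Y E" "homog Y"] by simp
    moreover have "(cmod 1)\<^sup>2 * (cmod (1 / hp X E))\<^sup>2 * (cmod (1 / hp Y E))\<^sup>2 \<noteq> 0" using nz by simp
    ultimately show "Re (tri (homog E) (?n X) (?n Y)) \<noteq> 0"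
      using indep by (simp add: trip_def del: of_real_power of_real_mult)
  qed (use S in \<open>simp_all add: iso hp_self del: mem_sphere\<close>)
qed

text \<open>Positivity makes \<open>f\<close> monotone. Squeezing \<open>real n * x\<close> between
  consecutive integers bounds \<open>real n\<close> times the deviation from linearity by
  \<open>f 1\<close>, for every \<open>n\<close>.\<close>

lemma additive_positive_linear:
  fixes f :: "real \<Rightarrow> real"
  assumes add: "\<And>x y. f (x + y) = f x + f y" and pos: "\<And>x. x > 0 \<Longrightarrow> f x > 0"
  shows "f x = f 1 * x"
proof -
  have f0: "f 0 = 0" using add[of 0 0] by simp
  have fn: "f (real n * x) = real n * f x" for n x
    by (induction n) (simp_all add: f0 add distrib_right)
  have neg: "f (- x) = - f x" for x using add[of x "- x"] f0 by simp
  have fi: "f (of_int m) = of_int m * f 1" for m :: int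
  proof (cases "m \<ge> 0")
    case True
    then show ?thesis using fn[of "nat m" 1] by simp
  next
    case False
    then show ?thesis using fn[of "nat (- m)" 1] neg[of "of_int m"] by simp
  qed
  have mono: "f u \<le> f v" if "u \<le> v" for u v
  proof (cases "u = v")
    case False
    then have "f (v - u) > 0" using pos that by simp
    then show ?thesis using add[of "v - u" u] by simp
  qed simp
  have bound: "real n * \<bar>f x - f 1 * x\<bar> \<le> f 1" for n
  proof -
    let ?m = "\<lfloor>real n * x\<rfloor>"
    have "of_int ?m \<le> real n * x" "real n * x \<le> of_int (?m + 1)" by linarith+
    then have "of_int ?m * f 1 \<le> real n * f x" "real n * f x \<le> (of_int ?m + 1) * f 1"
      using mono[of "of_int ?m" "real n * x"] mono[of "real n * x" "of_int (?m + 1)"]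
      unfolding fi fn by simp_all
    moreover have f1: "f 1 > 0" by (rule pos) simp
    have "of_int ?m * f 1 \<le> real n * x * f 1" "real n * x * f 1 \<le> (of_int ?m + 1) * f 1"
      using f1 by (intro mult_right_mono; linarith)+
    ultimately have "\<bar>real n * f x - real n * x * f 1\<bar> \<le> f 1"
      by (simp add: distrib_right abs_le_iff)
    moreover have "real n * f x - real n * x * f 1 = real n * (f x - f 1 * x)" by (simp add: algebra_simps)
    ultimately show ?thesis by (simp add: abs_mult)
  qed
  have "\<bar>f x - f 1 * x\<bar> = 0"
  proof (rule ccontr)
    assume "\<bar>f x - f 1 * x\<bar> \<noteq> 0"
    then obtain n where "f 1 < real n * \<bar>f x - f 1 * x\<bar>"
      using reals_Archimedean3[of "\<bar>f x - f 1 * x\<bar>"] by auto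
    then show False using bound[of n] by simp
  qed
  then show ?thesis by simp
qed

text \<open>\<open>D\<close> need not be measurable: it agrees almost everywhere with a function that is additive everywhere,
  and positivity makes that function linear.\<close>

lemma AE_additive_positive_linear:
  fixes D :: "real \<Rightarrow> real"
  assumes add: "AE s in lborel. AE u in lborel. D (s + u) = D s + D u"
    and pos: "AE s in lborel. D s * s > 0"
  shows "\<exists>\<kappa>>0. AE s in lborel. D s = \<kappa> * s"
proof -
  have minus: "AE s in lborel. P (r - s)" if "AE s in lborel. P s" for P and r :: real
    using AE_lborel_scale[OF AE_lborel_translate[OF that, of r], of "- 1"] by simp
  \<comment> \<open>\<open>r\<close> is split as \<open>s + (r - s)\<close> with both parts generic,
    so the increment exists for every \<open>r\<close> and not only for almost every one.\<close>
  have ex: "\<exists>c. AE u in lborel. D (r + u) = c + D u" for r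
  proof -
    obtain s where s: "AE u in lborel. D (s + u) = D s + D u" "AE u in lborel. D (r - s + u) = D (r - s) + D u"
      using AE_lborel_ex_in_interval[OF eventually_conj[OF add minus[OF add, of r]] zero_less_one] by blast
    have "AE u in lborel. D (s + (r - s + u)) = D s + D (r - s + u)"
      by (rule AE_lborel_translate[OF s(1)])
    with s(2) have "AE u in lborel. D (r + u) = (D s + D (r - s)) + D u"
      by eventually_elim simp
    then show ?thesis by blast
  qed
  then obtain f where f: "\<And>r. AE u in lborel. D (r + u) = f r + D u" by metis
  have uniq: "c = c'" if "AE u in lborel. D (r + u) = c + D u" "AE u in lborel. D (r + u) = c' + D u" for r c c'
  proof -
    have "AE u in (lborel :: real measure). c = c'" using that by eventually_elim simp
    then show ?thesis by (simp add: lborel_AE_const)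
  qed
  have fadd: "f (r + r') = f r + f r'" for r r'
  proof (rule uniq[OF f])
    have "AE u in lborel. D (r + (r' + u)) = f r + D (r' + u)" by (rule AE_lborel_translate[OF f])
    with f[of r'] show "AE u in lborel. D (r + r' + u) = f r + f r' + D u"
      by eventually_elim (simp add: add.assoc)
  qed
  have fD: "AE s in lborel. f s = D s"
    using add by eventually_elim (rule uniq[OF f])
  have fpos: "f r > 0" if r: "r > 0" for r
  proof -
    have "AE s in lborel. (f s = D s \<and> D s * s > 0) \<and> (f (r - s) = D (r - s) \<and> D (r - s) * (r - s) > 0)"
      by (intro eventually_conj fD pos minus[OF fD] minus[OF pos])
    from AE_lborel_ex_in_interval[OF this r] obtain s where s: "0 < s" "s < r"
      "(f s = D s \<and> D s * s > 0) \<and> (f (r - s) = D (r - s) \<and> D (r - s) * (r - s) > 0)" .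
    then have "f s > 0" "f (r - s) > 0" by (simp_all add: zero_less_mult_iff)
    then show ?thesis using fadd[of s "r - s"] by simp
  qed
  have "D s = f 1 * s" if "f s = D s" for s
    using additive_positive_linear[OF fadd fpos, of s] that by (rule trans[OF sym, rotated])
  then have "AE s in lborel. D s = f 1 * s" by (rule eventually_mono[OF fD])
  with fpos[of 1] show ?thesis by (intro exI[of _ "f 1"] conjI) simp_all
qed

section \<open>Rigidity of the displacement\<close>

text \<open>With vanishing real part the imaginary part carries the whole modulus of the triple
  product, so the size of the coordinate depends on pairwise products only.\<close>

lemma abs_tcoef:
  assumes "x \<in> sphere 0 1" "y \<in> sphere 0 1" "z \<in> sphere 0 1" "x \<noteq> y" "z \<noteq> y" "Re (trip x y z) = 0"
  shows "\<bar>tcoef y x z\<bar> * (cmod (hp z y) * cmod (hp y x)) = cmod (hp z x)"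
proof -
  have nz: "cmod (hp z y) > 0" "cmod (hp y x) > 0"
    using hp_nonzero assms by auto
  have "\<bar>Im (trip x y z)\<bar> = cmod (trip x y z)" using assms(6) by (simp add: cmod_def)
  also have "\<dots> = cmod (hp y x) * cmod (hp z y) * cmod (hp z x)"
    by (simp add: trip_def tri_def norm_mult cmod_herm_sym[of "homog x" "homog y"]
        cmod_herm_sym[of "homog y" "homog z"])
  finally show ?thesis
    unfolding tcoef_def using nz by (simp add: abs_divide field_simps power2_eq_square)
qed

context
  fixes f :: "complex^'p::finite \<Rightarrow> complex^'q::finite"
  assumes f_borel [measurable]: "f \<in> borel_measurable borel"
    and f_sphere: "\<And>x. f x \<in> sphere 0 1"
    and AE_good_f: "AE w in sph. AE x in sph. AE s in lborel. good f w x (transv w s x)"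
    and AE_noncollinear_f: "AE w in sph. AE x in sph. AE y in sph. Re (trip (f w) (f x) (f y)) \<noteq> 0"
begin

definition disp where "disp w x s = tcoef (f w) (f x) (f (transv w s x))"

lemma disp_measurable [measurable (raw)]:
  assumes [measurable]: "a \<in> borel_measurable M" "b \<in> borel_measurable M" "c \<in> borel_measurable M"
  shows "(\<lambda>w. disp (a w) (b w) (c w)) \<in> borel_measurable M"
  unfolding disp_def by measurable

lemma good_distinct:
  assumes "good f x y z"
  shows "f x \<noteq> f y" "f y \<noteq> f z" "f z \<noteq> f x"
  using assms f_sphere by (auto simp: good_def trip_def tri_def hp_self simp del: mem_sphere)

lemma good_transv:
  assumes w: "w \<in> sphere 0 1" and x: "x \<in> sphere 0 1" and ne: "x \<noteq> w"
    and good: "good f w x (transv w s x)"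
  shows "f (transv w s x) = transv (f w) (disp w x s) (f x)" "disp w x s * s > 0"
    "Re (trip (f x) (f w) (f (transv w s x))) = 0"
proof -
  let ?u = "transv w s x"
  note d = good_distinct[OF good]
  have g: "good f x w ?u" using good good_swap good_rotate by metis
  then show Re: "Re (trip (f x) (f w) (f ?u)) = 0" by (simp add: good_def)
  show "f ?u = transv (f w) (disp w x s) (f x)"
    unfolding disp_def using d Re by (intro transv_tcoef f_sphere) auto
  have u: "?u \<in> sphere 0 1" "?u \<noteq> w" using transv_sphere[OF x w] transv_ne[OF x w ne] by auto
  have "cmod (hp ?u w) > 0" "cmod (hp w x) > 0" "cmod (hp (f ?u) (f w)) > 0" "cmod (hp (f w) (f x)) > 0"
    using hp_nonzero w x ne u f_sphere d by (metis zero_less_norm_iff)+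
  moreover have "Im (trip (f x) (f w) (f ?u)) * Im (trip x w ?u) > 0" using g by (simp add: good_def)
  ultimately have "disp w x s * tcoef w x ?u > 0"
    by (simp add: disp_def tcoef_def zero_less_mult_iff zero_less_divide_iff divide_less_0_iff mult_less_0_iff)
  then show "disp w x s * s > 0" using trip_transv[OF x w ne] by simp
qed

lemma AE_good_swapped: "AE w in sph. AE s in lborel. AE x in sph. good f w x (transv w s x)"
  using AE_good_f by eventually_elim (rule AE_swap_sph_lborel[rotated], assumption, measurable)

text \<open>The third point of the chain of \<open>x\<close> and \<open>y\<close> is drawn as
  \<open>v = transv y l x\<close> with a generic \<open>l\<close>, which serves inside the argument
  only and is dropped at the end.\<close>

lemma AE_disp_eq: "AE w in sph. AE s in lborel. AE y in sph. AE x in sph. disp w y s = disp w x s"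
proof -
  have ev: "AE w in sph. AE s in lborel. AE x in sph. good f w x (transv w s x)"
    by (rule AE_good_swapped)
  have "AE w in sph. AE s in lborel. AE y in sph. AE l in (lborel :: real measure). AE x in sph. disp w y s = disp w x s"
    using ev AE_noncollinear_f AE_sphere
  proof eventually_elim
    case (elim w)
    note w = elim(3) and ind = elim(2)
    show ?case using elim(1)
    proof eventually_elim
      case (elim s)
      note g3 = elim
      let ?g = "tvec (homog w) s"
      have iso: "herm_iso ?g" by (rule herm_iso_tvec[OF hp_self[OF w]])
      have "AE y in sph. AE l in lborel. AE x in sph. good f (transv w s y) x (transv (transv w s y) l x)"
        by (rule AE_transv[OF w ev])
      then show ?case using ev g3 ind AE_sphere AE_sph_neq[of w]
      proof eventually_elim
        case (elim y)
        note gy = elim(3) and indy = elim(4) and y = elim(5) and yne = elim(6)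
        \<comment> \<open>Translation by \<open>s\<close> about \<open>w\<close> rescales parameters
          about \<open>y\<close> by this constant; with the factor included the translated triple is
          again a generic one.\<close>
        let ?c = "(cmod (?g (homog y) $ None))\<^sup>2"
        have c: "?c \<noteq> 0" using herm_iso_None[OF iso, of y] y by simp
        have "AE l in lborel. AE x in sph. good f (transv w s y) x (transv (transv w s y) (?c * l) x)"
          by (rule AE_lborel_scale[OF elim(1) c])
        then show ?case using elim(2)
        proof eventually_elim
          case (elim l)
          have "AE x in sph. good f (transv w s y) (transv w s x) (transv (transv w s y) (?c * l) (transv w s x))"
            by (rule AE_transv[OF w elim(1)])
          moreover have "AE x in sph. good f w (transv y l x) (transv w s (transv y l x))"
            by (rule AE_transv[OF y g3])
          moreover have "AE x in sph. transv y l x \<noteq> w"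
            by (rule AE_transv[OF y AE_sph_neq])
          ultimately show ?case using elim(2) g3 indy AE_sphere AE_sph_neq[of w] AE_sph_neq[of y]
          proof eventually_elim
            case (elim x)
            note x = elim(7)
            define v where "v = transv y l x"
            have v: "v \<in> sphere 0 1" unfolding v_def by (rule transv_sphere[OF x y])
            have tv: "transv (transv w s y) (?c * l) (transv w s x) = transv w s v"
              unfolding v_def using proj_act_transv[OF iso x y, of l]
              by (simp add: transv_def[of w] mult.commute)
            have g2: "good f (transv w s y) (transv w s x) (transv w s v)" using elim(1) unfolding tv .
            have g5: "good f w v (transv w s v)" using elim(2) by (simp add: v_def)
            have g1: "good f y x v" using elim(4) by (simp add: v_def)
            have vne: "v \<noteq> w" using elim(3) by (simp add: v_def)
            note Ty = good_transv(1)[OF w y yne gy] and Tx = good_transv(1)[OF w x elim(8,5)]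
              and Tv = good_transv(1)[OF w v vne g5]
            show ?case
            proof (rule transv_translation_eq[of "f w" "f y" "f x" "f v"])
              show "Re (trip (f w) (f y) (f x)) \<noteq> 0" by (rule elim(6))
              show "Re (trip (f y) (f x) (f v)) = 0" using g1 by (simp add: good_def)
              show "f v \<noteq> f y" "f v \<noteq> f x" using good_distinct[OF g1] by auto
              show "Re (trip (transv (f w) (disp w y s) (f y)) (transv (f w) (disp w x s) (f x))
                 (transv (f w) (disp w v s) (f v))) = 0"
                using g2 unfolding Ty[symmetric] Tx[symmetric] Tv[symmetric] by (simp add: good_def)
              show "transv (f w) (disp w y s) (f y) \<noteq> transv (f w) (disp w x s) (f x)"
                unfolding Ty[symmetric] Tx[symmetric] by (rule good_distinct[OF g2])
            qed (rule f_sphere)+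
          qed
        qed
      qed
    qed
  qed
  then show ?thesis by (simp only: lborel_AE_const)
qed

lemma AE_disp_linear_exists:
  "AE w in sph. \<exists>q>0. AE s in lborel. AE x in sph. disp w x s = q * s"
  using AE_disp_eq AE_good_swapped AE_sphere
proof eventually_elim
  case (elim w)
  note good = elim(2) and w = elim(3)
  have "AE s in lborel. \<exists>d. AE x in sph. disp w x s = d"
    using elim(1)
  proof eventually_elim
    case (elim s)
    then obtain y where "AE x in sph. disp w y s = disp w x s" using AE_sph_ex by blast
    then have "AE x in sph. disp w x s = disp w y s" by eventually_elim simp
    then show ?case by blast
  qed
  \<comment> \<open>One value for each \<open>s\<close>, picked without any measurability in
    \<open>s\<close>.\<close>
  then have "AE s in lborel. AE x in sph. disp w x s = (SOME d. AE x in sph. disp w x s = d)"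
    by eventually_elim (rule someI_ex)
  then obtain D where D: "AE s in lborel. AE x in sph. disp w x s = D s" by (rule that)
  have "AE s in lborel. D s * s > 0" using D good
  proof eventually_elim
    case (elim s)
    have "AE x in (sph :: (complex^'p) measure). D s * s > 0"
      using elim AE_sphere AE_sph_neq[of w]
      by eventually_elim (use good_transv(2)[OF w] in metis)
    then show ?case by (simp only: sph_AE_const)
  qed
  moreover have "AE s in lborel. AE u in lborel. D (s + u) = D s + D u"
    using D good
  proof eventually_elim
    case (elim s)
    note Ds = elim(1) and gs = elim(2)
    have "AE u in lborel. AE x in sph. disp w x (s + u) = D (s + u)" by (rule AE_lborel_translate[OF D])
    moreover have "AE u in lborel. AE x in sph. good f w x (transv w (s + u) x)" by (rule AE_lborel_translate[OF good])
    ultimately show ?case using D good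
    proof eventually_elim
      case (elim u)
      have "AE x in (sph :: (complex^'p) measure). D (s + u) = D s + D u"
        using elim(1,2) AE_transv[OF w elim(3), of s] AE_transv[OF w elim(4), of s] Ds gs AE_sphere AE_sph_neq[of w]
      proof eventually_elim
        case (elim x)
        note x = elim(7) and ne = elim(8)
        let ?x' = "transv w s x"
        have x': "?x' \<in> sphere 0 1" "?x' \<noteq> w" using transv_sphere[OF x w] transv_ne[OF x w ne] by auto
        \<comment> \<open>The second translation starts at the generic point \<open>?x'\<close>; its
          parameter is still \<open>D u\<close> because parameters do not depend on the starting
          point.\<close>
        have comp: "transv w u ?x' = transv w (s + u) x" using transv_add[OF x w] by (simp add: add.commute)
        have "f (transv w (s + u) x) = transv (f w) (D (s + u)) (f x)"
          using good_transv(1)[OF w x ne elim(2)] elim(1) by simp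
        moreover have "f (transv w (s + u) x) = transv (f w) (D u) (f ?x')"
          using good_transv(1)[OF w x' elim(4)] elim(3) by (simp add: comp)
        moreover have "f ?x' = transv (f w) (D s) (f x)"
          using good_transv(1)[OF w x ne elim(6)] elim(5) by simp
        ultimately have "transv (f w) (D (s + u)) (f x) = transv (f w) (D u + D s) (f x)"
          using transv_add[OF f_sphere f_sphere] by simp
        moreover have "f x \<noteq> f w" using good_distinct(1)[OF elim(2)] by simp
        ultimately have "D (s + u) = D u + D s"
          using trip_transv(2)[OF f_sphere f_sphere] by metis
        then show ?case by simp
      qed
      then show ?case by (simp only: sph_AE_const)
    qed
  qed
  ultimately obtain q where "q > 0" "AE s in lborel. D s = q * s"
    using AE_additive_positive_linear by blast
  moreover have "AE s in lborel. AE x in sph. disp w x s = q * s"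
    using D \<open>AE s in lborel. D s = q * s\<close> by eventually_elim simp
  ultimately show ?case by blast
qed

text \<open>Freezing a generic point \<open>y\<close> and parameter \<open>t\<close> exhibits the factor as a Borel function of \<open>w\<close>.\<close>

lemma measurable_scale_exists:
  obtains q where "q \<in> borel_measurable borel" "AE w in sph. q w > 0"
    "AE w in sph. AE s in lborel. AE x in sph. disp w x s = q w * s"
proof -
  have "AE w in sph. AE t in lborel. AE y in sph. disp w y t / t > 0 \<and>
      (AE s in lborel. AE x in sph. disp w x s = disp w y t / t * s)"
    using AE_disp_linear_exists
  proof eventually_elim
    case (elim w)
    then obtain k where k: "k > 0" "AE s in lborel. AE x in sph. disp w x s = k * s" by blast
    show ?case using k(2) AE_lborel_nonzero
    proof eventually_elim
      case (elim t)
      show ?case using elim(1) by eventually_elim (use elim(2) k in simp)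
    qed
  qed
  then have "AE t in lborel. AE w in sph. AE y in sph. disp w y t / t > 0 \<and>
      (AE s in lborel. AE x in sph. disp w x s = disp w y t / t * s)"
    by (rule AE_swap_sph_lborel[rotated]) measurable
  then obtain t where "AE w in sph. AE y in sph. disp w y t / t > 0 \<and>
      (AE s in lborel. AE x in sph. disp w x s = disp w y t / t * s)"
    using AE_ex_lborel by blast
  then have "AE y in sph. AE w in sph. disp w y t / t > 0 \<and>
      (AE s in lborel. AE x in sph. disp w x s = disp w y t / t * s)"
    by (rule AE_swap_sph_sph[rotated]) measurable
  then obtain y where y: "AE w in sph. disp w y t / t > 0 \<and>
      (AE s in lborel. AE x in sph. disp w x s = disp w y t / t * s)"
    using AE_sph_ex by blast
  show ?thesis
  proof (rule that[of "\<lambda>w. disp w y t / t"])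
    show "(\<lambda>w. disp w y t / t) \<in> borel_measurable borel" by measurable
  qed (use y in \<open>simp_all add: eventually_conj_iff\<close>)
qed

text \<open>A point \<open>u\<close> of the chain has coordinates about both ends, and the product
  of their sizes depends only on the distance of the ends: it is \<open>1 / (c * c)\<close> with
  \<open>c = cmod (hp x w)\<close>. The same holds for the images, where the two coordinates are
  multiplied by \<open>q w\<close> and \<open>q x\<close>.\<close>

lemma scaled_herm_exists:
  obtains q where "q \<in> borel_measurable borel" "AE w in sph. q w > 0"
    "AE w in sph. AE s in lborel. AE x in sph. disp w x s = q w * s"
    "AE w in sph. AE x in sph. q w * q x * (cmod (hp (f x) (f w)))\<^sup>2 = (cmod (hp x w))\<^sup>2"
proof -
  obtain q where km [measurable]: "q \<in> borel_measurable borel" and pos: "AE w in sph. q w > 0"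
    and disp: "AE w in sph. AE s in lborel. AE x in sph. disp w x s = q w * s"
    by (rule measurable_scale_exists)
  have 1: "AE w in sph. AE x in sph. AE s in lborel. disp w x s = q w * s"
    using disp by eventually_elim (rule AE_swap_lborel_sph[rotated], assumption, measurable)
  have 2: "AE w in sph. AE x in sph. AE s in lborel. disp x w s = q x * s \<and> good f x w (transv x s w)"
  proof (rule AE_swap_sph_sph)
    show "AE x in sph. AE w in sph. AE s in lborel. disp x w s = q x * s \<and> good f x w (transv x s w)"
      using 1 AE_good_f
    proof eventually_elim
      case (elim x)
      show ?case using elim
      proof eventually_elim
        case (elim y)
        then show ?case by eventually_elim simp
      qed
    qed
  qed measurable
  have "AE w in sph. AE x in sph. q w * q x * (cmod (hp (f x) (f w)))\<^sup>2 = (cmod (hp x w))\<^sup>2"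
    using 1 2 AE_good_f AE_sphere pos
  proof eventually_elim
    case (elim w)
    note w = elim(4) and kw = elim(5)
    show ?case using elim(1,2,3) AE_sphere AE_sph_neq[of w] pos
    proof eventually_elim
      case (elim x)
      note x = elim(4) and ne = elim(5) and kx = elim(6)
      have c: "- 1 / (cmod (hp x w))\<^sup>2 \<noteq> 0" using hp_nonzero[OF x w ne] by simp
      have "AE s in (lborel :: real measure). q w * q x * (cmod (hp (f x) (f w)))\<^sup>2 = (cmod (hp x w))\<^sup>2"
        using elim(1,3) AE_lborel_reciprocal[OF elim(2) c] AE_lborel_nonzero
      proof eventually_elim
        case (elim s)
        define u where "u = transv w s x"
        have u: "transv x (- 1 / (cmod (hp x w))\<^sup>2 / s) w = u"
          unfolding u_def using transv_reciprocal[OF x w ne elim(4)] by simp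
        let ?s' = "- 1 / (cmod (hp x w))\<^sup>2 / s"
        have uS: "u \<in> sphere 0 1" "u \<noteq> w" unfolding u_def using transv_sphere[OF x w] transv_ne[OF x w ne] by auto
        have "u \<noteq> x" unfolding u[symmetric] using transv_ne[OF w x] ne by auto
        have g: "good f w x u" using elim(2) by (simp add: u_def)
        note d = good_distinct[OF g]
        have R1: "Re (trip (f x) (f w) (f u)) = 0" "Re (trip (f w) (f x) (f u)) = 0"
          using g trip_swap[of "f u" "f w" "f x"] unfolding good_def
          by (simp_all add: trip_rotate[of "f u"])
        have R2: "Re (trip x w u) = 0" "Re (trip w x u) = 0"
          unfolding u_def using trip_transv(1)[OF x w ne] apply simp
          using trip_transv(1)[OF w x ne[symmetric], of ?s'] unfolding u u_def[symmetric] by simp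
        have s: "s = tcoef w x u" "?s' = tcoef x w u"
          using trip_transv(2)[OF x w ne, of s] trip_transv(2)[OF w x ne[symmetric], of ?s']
          unfolding u u_def[symmetric] by simp_all
        have D1: "tcoef (f w) (f x) (f u) = q w * tcoef w x u"
          using elim(1) unfolding disp_def u_def[symmetric] s(1)[symmetric] .
        have D2: "tcoef (f x) (f w) (f u) = q x * tcoef x w u"
          using elim(3) unfolding disp_def u s(2)[symmetric] by simp
        define a b c where "a = cmod (hp u x)" and "b = cmod (hp u w)" and "c = cmod (hp x w)"
        define a' b' c' where "a' = cmod (hp (f u) (f x))" and "b' = cmod (hp (f u) (f w))" and "c' = cmod (hp (f x) (f w))"
        have pos: "a > 0" "b > 0" "c > 0" "a' > 0" "b' > 0" "c' > 0"
          unfolding a_def b_def c_def a'_def b'_def c'_def zero_less_norm_iff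
          by (fact hp_nonzero[OF uS(1) x \<open>u \<noteq> x\<close>] hp_nonzero[OF uS(1) w uS(2)]
              hp_nonzero[OF x w ne] hp_nonzero[OF f_sphere f_sphere d(2)[symmetric]]
              hp_nonzero[OF f_sphere f_sphere d(3)] hp_nonzero[OF f_sphere f_sphere d(1)[symmetric]])+
        have e1: "\<bar>tcoef w x u\<bar> * (b * c) = a"
          using abs_tcoef[OF x w uS(1) ne uS(2) R2(1)] by (simp add: a_def b_def c_def cmod_herm_sym[of "homog w" "homog x"])
        have e2: "\<bar>tcoef x w u\<bar> * (a * c) = b"
          using abs_tcoef[OF w x uS(1) ne[symmetric] \<open>u \<noteq> x\<close> R2(2)] by (simp add: a_def b_def c_def)
        have e1': "q w * \<bar>tcoef w x u\<bar> * (b' * c') = a'"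
          using abs_tcoef[OF f_sphere f_sphere f_sphere d(1)[symmetric] d(3) R1(1)] kw
          by (simp add: D1 abs_mult a'_def b'_def c'_def cmod_herm_sym[of "homog (f w)" "homog (f x)"])
        have e2': "q x * \<bar>tcoef x w u\<bar> * (a' * c') = b'"
          using abs_tcoef[OF f_sphere f_sphere f_sphere d(1) d(2)[symmetric] R1(2)] kx
          by (simp add: D2 abs_mult a'_def b'_def c'_def)
        have "\<bar>tcoef w x u\<bar> * \<bar>tcoef x w u\<bar> * (c * c) * (a * b) = 1 * (a * b)"
          using arg_cong2[OF e1 e2, of "(*)"] by (simp only: mult_ac mult_1_left)
        then have 3: "\<bar>tcoef w x u\<bar> * \<bar>tcoef x w u\<bar> * (c * c) = 1" using pos by simp
        have "q w * q x * (\<bar>tcoef w x u\<bar> * \<bar>tcoef x w u\<bar>) * (c' * c') * (a' * b') = 1 * (a' * b')"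
          using arg_cong2[OF e1' e2', of "(*)"] by (simp only: mult_ac mult_1_left)
        then have 4: "q w * q x * (\<bar>tcoef w x u\<bar> * \<bar>tcoef x w u\<bar>) * (c' * c') = 1" using pos by simp
        have "q w * q x * (c' * c') = q w * q x * (c' * c') * (\<bar>tcoef w x u\<bar> * \<bar>tcoef x w u\<bar> * (c * c))"
          unfolding 3 by simp
        also have "\<dots> = (q w * q x * (\<bar>tcoef w x u\<bar> * \<bar>tcoef x w u\<bar>) * (c' * c')) * (c * c)"
          by (simp only: mult_ac)
        also have "\<dots> = c * c" unfolding 4 by simp
        finally show ?case unfolding c_def c'_def power2_eq_square .
      qed
      then show ?case by (simp only: lborel_AE_const)
    qed
  qed
  then show ?thesis by (rule that[OF km pos disp])
qed

text \<open>The pairwise relation is applied to \<open>y\<close> and the translate \<open>u\<close>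
  of \<open>x\<close> about \<open>w\<close>. Both sides are quadratic in \<open>s\<close>; constant
  and quadratic terms agree by the pairwise relation itself, so the linear ones give the imaginary
  part of the triple product. Its modulus is known and its real part is never positive.\<close>

lemma scaled_trip_exists:
  obtains q where "AE w in sph. q w > 0"
    "AE w in sph. AE x in sph. q w * q x * (cmod (hp (f x) (f w)))\<^sup>2 = (cmod (hp x w))\<^sup>2"
    "AE w in sph. AE x in sph. AE y in sph.
       of_real (q w * q x * q y) * trip (f x) (f w) (f y) = trip x w y"
proof -
  obtain q where km: "q \<in> borel_measurable borel" and pos: "AE w in sph. q w > 0"
    and disp: "AE w in sph. AE s in lborel. AE x in sph. disp w x s = q w * s"
    and pair: "AE w in sph. AE x in sph. q w * q x * (cmod (hp (f x) (f w)))\<^sup>2 = (cmod (hp x w))\<^sup>2"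
    by (rule scaled_herm_exists)
  have "AE w in sph. AE s in (lborel :: real measure). AE x in sph. AE y in sph.
       of_real (q w * q x * q y) * trip (f x) (f w) (f y) = trip x w y"
    using disp AE_good_swapped pair pos AE_sphere
  proof eventually_elim
    case (elim w)
    note pw = elim(3) and kw = elim(4) and w = elim(5)
    show ?case using elim(1,2) AE_lborel_nonzero
    proof eventually_elim
      case (elim s)
      note s0 = elim(3)
      show ?case using elim(1,2) AE_transv[OF w pair, of s] pair AE_transv[OF w pw, of s] pw AE_sphere AE_sph_neq[of w] pos
      proof eventually_elim
        case (elim x)
        note dx = elim(1) and gx = elim(2) and x = elim(7) and ne = elim(8) and kx = elim(9)
          and puw = elim(5) and pxw = elim(6)
        show ?case using elim(3,4) pw AE_sphere pos
        proof eventually_elim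
          case (elim y)
          note puy = elim(1) and pxy = elim(2) and pyw = elim(3) and y = elim(4) and ky = elim(5)
          define u where "u = transv w s x"
          define r where "r = q w * s"
          have fu: "f u = transv (f w) r (f x)"
            unfolding u_def r_def using good_transv(1)[OF w x ne gx] dx by simp
          obtain c where c: "c \<noteq> 0" "homog u = c *s tvec (homog w) s (homog x)"
            unfolding u_def using homog_transv[OF x w] by blast
          obtain c' where c': "c' \<noteq> 0" "homog (f u) = c' *s tvec (homog (f w)) r (homog (f x))"
            unfolding fu using homog_transv[OF f_sphere f_sphere] by blast
          define A B A' B' where "A = hp x y" and "B = hp x w * hp w y"
            and "A' = hp (f x) (f y)" and "B' = hp (f x) (f w) * hp (f w) (f y)"
          have h: "hp u w = c * hp x w" "hp u y = c * (A + \<i> * of_real s * B)"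
            unfolding c(2) by (simp_all add: tvec_def herm_linear hp_self[OF w] A_def B_def algebra_simps)
          have h': "hp (f u) (f w) = c' * hp (f x) (f w)" "hp (f u) (f y) = c' * (A' + \<i> * of_real r * B')"
            unfolding c'(2) by (simp_all add: tvec_def herm_linear hp_self[OF f_sphere] A'_def B'_def algebra_simps)
          have nx: "cmod (hp x w) \<noteq> 0" using hp_nonzero[OF x w ne] by simp
          have nx': "cmod (hp (f x) (f w)) \<noteq> 0" using pxw nx by auto
          have "q w * (q u * (cmod c')\<^sup>2) * (cmod (hp (f x) (f w)))\<^sup>2 = (cmod c)\<^sup>2 * (cmod (hp x w))\<^sup>2"
            using puw unfolding u_def[symmetric] h h' norm_mult power_mult_distrib by (simp only: mult_ac)
          also have "\<dots> = q w * ((cmod c)\<^sup>2 * q x) * (cmod (hp (f x) (f w)))\<^sup>2"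
            unfolding pxw[symmetric] by (simp only: mult_ac)
          \<comment> \<open>The unknown scalings \<open>c\<close> and \<open>c'\<close> of the lifts
            of \<open>u\<close> and \<open>f u\<close> are eliminated by the pairwise relation of
            \<open>u\<close> with \<open>w\<close>.\<close>
          finally have ku: "q u * (cmod c')\<^sup>2 = (cmod c)\<^sup>2 * q x"
            using nx' kw by simp
          have "(cmod c)\<^sup>2 * (cmod (A + \<i> * of_real s * B))\<^sup>2 = (q u * (cmod c')\<^sup>2) * q y * (cmod (A' + \<i> * of_real r * B'))\<^sup>2"
            using puy unfolding u_def[symmetric] cmod_herm_sym[of "homog y"] cmod_herm_sym[of "homog (f y)"]
              h h' norm_mult power_mult_distrib by (simp only: mult_ac)
          then have eq: "(cmod (A + \<i> * of_real s * B))\<^sup>2 = q x * q y * (cmod (A' + \<i> * of_real r * B'))\<^sup>2"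
            unfolding ku using c(1) by simp
          have exp: "(cmod (a + \<i> * of_real t * b))\<^sup>2 = (cmod a)\<^sup>2 + t\<^sup>2 * (cmod b)\<^sup>2 - 2 * t * Im (cnj a * b)" for a b t
            unfolding cmod_power2 by (simp add: power2_eq_square algebra_simps)
          have pA: "(cmod A)\<^sup>2 = q x * q y * (cmod A')\<^sup>2"
            using pxy unfolding A_def A'_def cmod_herm_sym[of "homog y"] cmod_herm_sym[of "homog (f y)"] by simp
          have pB: "(cmod B)\<^sup>2 = q x * q y * (q w)\<^sup>2 * (cmod B')\<^sup>2"
            unfolding B_def B'_def norm_mult power_mult_distrib cmod_herm_sym[of "homog w" "homog y"]
              cmod_herm_sym[of "homog (f w)" "homog (f y)"] pxw[symmetric] pyw[symmetric]
            by (simp add: power2_eq_square mult_ac)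
          have trip_AB: "trip x w y = cnj A * B" "trip (f x) (f w) (f y) = cnj A' * B'"
            by (simp_all add: A_def B_def A'_def B'_def trip_def tri_def cnj_herm)
          have "s * Im (cnj A * B) = s * (q w * q x * q y * Im (cnj A' * B'))"
            using eq unfolding exp pA pB r_def by (simp add: algebra_simps power2_eq_square)
          then have Im: "Im (cnj A * B) = q w * q x * q y * Im (cnj A' * B')" using s0 by simp
          define k where "k = q w * q x * q y"
          have k: "k > 0" using kw kx ky by (simp add: k_def)
          have "(cmod (cnj A * B))\<^sup>2 = (k * cmod (cnj A' * B'))\<^sup>2"
            unfolding norm_mult power_mult_distrib complex_mod_cnj pA pB k_def by (simp add: power2_eq_square mult_ac)
          then have "(Re (cnj A * B))\<^sup>2 + (Im (cnj A * B))\<^sup>2 = (k * Re (cnj A' * B'))\<^sup>2 + (k * Im (cnj A' * B'))\<^sup>2"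
            unfolding power_mult_distrib cmod_power2 by (simp only: distrib_left)
          then have "(Re (cnj A * B))\<^sup>2 = (k * Re (cnj A' * B'))\<^sup>2"
            unfolding Im k_def by (simp only: add_right_cancel)
          moreover have "Re (cnj A * B) \<le> 0" "k * Re (cnj A' * B') \<le> 0"
            using Re_trip_nonpos[OF x w y] Re_trip_nonpos[OF f_sphere f_sphere f_sphere, of x w y] k
            unfolding trip_AB by (simp_all add: mult_le_0_iff)
          ultimately have "Re (cnj A * B) = k * Re (cnj A' * B')"
            by (smt (verit) power2_eq_iff)
          then show ?case unfolding trip_AB k_def[symmetric] using Im
            by (simp add: complex_eq_iff k_def)
        qed
      qed
    qed
  qed
  then show ?thesis using that[of q] pos pair by (simp only: lborel_AE_const)
qed

lemma scaled_lift_exists: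
  obtains c where "AE x in sph. c x \<noteq> 0"
    "AE x in sph. AE y in sph. herm (c x *s homog (f x)) (c y *s homog (f y)) = hp x y"
proof -
  obtain q where pos: "AE w in sph. q w > 0"
    and pair: "AE w in sph. AE x in sph. q w * q x * (cmod (hp (f x) (f w)))\<^sup>2 = (cmod (hp x w))\<^sup>2"
    and trip: "AE w in sph. AE x in sph. AE y in sph.
       of_real (q w * q x * q y) * trip (f x) (f w) (f y) = trip x w y"
    by (rule scaled_trip_exists)
  have "AE w in sph. q w > 0 \<and> w \<in> sphere 0 1 \<and>
     (AE x in sph. q w * q x * (cmod (hp (f x) (f w)))\<^sup>2 = (cmod (hp x w))\<^sup>2) \<and>
     (AE x in sph. AE y in sph. of_real (q w * q x * q y) * trip (f x) (f w) (f y) = trip x w y)"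
    using pos pair trip AE_sphere by eventually_elim simp
  then obtain w where k: "q w > 0" and w: "w \<in> sphere 0 1"
    and pw: "AE x in sph. q w * q x * (cmod (hp (f x) (f w)))\<^sup>2 = (cmod (hp x w))\<^sup>2"
    and tw: "AE x in sph. AE y in sph. of_real (q w * q x * q y) * trip (f x) (f w) (f y) = trip x w y"
    using AE_sph_ex by blast
  \<comment> \<open>Chosen so that products with the lift of \<open>f w\<close> scaled by
    \<open>sqrt (q w)\<close> become those with \<open>homog w\<close>; triple products through
    \<open>w\<close> then transfer all other products.\<close>
  define c where "c x = hp x w / (of_real (sqrt (q w)) * hp (f x) (f w))" for x
  have nz: "AE x in sph. hp x w \<noteq> 0 \<and> hp (f x) (f w) \<noteq> 0"
    using pw AE_herm_nonzero[OF homog_nonzero[of w]] by eventually_elim auto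
  show ?thesis
  proof (rule that[of c])
    show "AE x in sph. c x \<noteq> 0" using nz by eventually_elim (use k in \<open>simp add: c_def\<close>)
    show "AE x in sph. AE y in sph. herm (c x *s homog (f x)) (c y *s homog (f y)) = hp x y"
      using tw nz pair
    proof eventually_elim
      case (elim x)
      note nx = elim(2)
      show ?case using elim(1,3) nz AE_herm_nonzero[OF homog_nonzero[of x]]
      proof eventually_elim
        case (elim y)
        have n: "hp w y \<noteq> 0" "hp (f w) (f y) \<noteq> 0" "hp x y \<noteq> 0"
          using elim(3,4) herm_eq_0_commute by blast+
        have p: "of_real (q x * q y) * (hp (f y) (f x) * hp (f x) (f y)) = hp y x * hp x y"
          unfolding herm_mult_commute of_real_mult[symmetric] elim(2) ..
        have t: "of_real (q w) * of_real (q x * q y) * (hp (f x) (f w) * hp (f w) (f y) * hp (f y) (f x)) =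
           hp x w * hp w y * hp y x"
          using elim(1) by (simp add: trip_def tri_def mult_ac)
        have "hp y x * (hp x w * hp w y * hp (f x) (f y)) =
           of_real (q w) * hp (f x) (f w) * hp (f w) (f y) * (of_real (q x * q y) * (hp (f y) (f x) * hp (f x) (f y)))"
          using arg_cong[OF t, of "\<lambda>w. w * hp (f x) (f y)"] by (simp only: mult_ac)
        then have "hp y x * (hp x w * hp w y * hp (f x) (f y)) =
           hp y x * (of_real (q w) * hp (f x) (f w) * hp (f w) (f y) * hp x y)"
          unfolding p by (simp only: mult_ac)
        then have e: "hp x w * hp w y * hp (f x) (f y) = of_real (q w) * hp (f x) (f w) * hp (f w) (f y) * hp x y"
          using elim(4) by simp
        have sq: "of_real (sqrt (q w)) * of_real (sqrt (q w)) = (of_real (q w) :: complex)"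
          using k by (simp flip: of_real_mult)
        have "c x * cnj (c y) = hp x w * hp w y / ((of_real (sqrt (q w)) * of_real (sqrt (q w))) * (hp (f x) (f w) * hp (f w) (f y)))"
          by (simp add: c_def cnj_herm mult_ac)
        then have "c x * cnj (c y) * hp (f x) (f y) = hp x w * hp w y * hp (f x) (f y) / (of_real (q w) * (hp (f x) (f w) * hp (f w) (f y)))"
          unfolding sq by simp
        also have "\<dots> = hp x y" unfolding e using k n nx by simp
        finally show ?case by (simp add: herm_linear mult_ac)
      qed
    qed
  qed
qed

end

section \<open>Reconstruction of the linear isometry\<close>

lemma herm_sum_left: "herm (\<Sum>k\<in>K. f k) y = (\<Sum>k\<in>K. herm (f k) y)"
  by (induction K rule: infinite_finite_induct) (simp_all add: herm_add_left)

lemma herm_sum_right: "herm y (\<Sum>k\<in>K. f k) = (\<Sum>k\<in>K. herm y (f k))"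
  by (induction K rule: infinite_finite_induct) (simp_all add: herm_add_right)

text \<open>Points \<open>b\<close> whose lifts form a basis are drawn one at a time: at each step the next point only has to
  avoid a null set.\<close>

lemma generic_basis:
  fixes \<Phi> :: "complex^'p::finite \<Rightarrow> complex^('q::finite option)"
  assumes gram: "AE x in sph. AE y in sph. herm (\<Phi> x) (\<Phi> y) = hp x y"
    and iso: "AE x in sph. herm (\<Phi> x) (\<Phi> x) = 0"
  obtains b :: "'p option \<Rightarrow> complex^'p" where
    "\<And>k. AE y in sph. herm (\<Phi> (b k)) (\<Phi> y) = hp (b k) y"
    "\<And>j k. herm (\<Phi> (b j)) (\<Phi> (b k)) = hp (b j) (b k)"
    "\<And>c. (\<Sum>k\<in>UNIV. c k *s homog (b k)) = 0 \<Longrightarrow> (\<forall>k. c k = 0)"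
proof -
  have "\<exists>b :: 'p option \<Rightarrow> complex^'p. (\<forall>k\<in>K. AE y in sph. herm (\<Phi> (b k)) (\<Phi> y) = hp (b k) y) \<and>
    (\<forall>j\<in>K. \<forall>k\<in>K. herm (\<Phi> (b j)) (\<Phi> (b k)) = hp (b j) (b k)) \<and>
    (\<forall>c. (\<Sum>k\<in>K. c k *s homog (b k)) = 0 \<longrightarrow> (\<forall>k\<in>K. c k = 0))" if "finite K" for K :: "'p option set"
    using that
  proof (induction K rule: finite_induct)
    case (insert k K)
    then obtain b :: "'p option \<Rightarrow> complex^'p" where b1: "\<forall>k\<in>K. AE y in sph. herm (\<Phi> (b k)) (\<Phi> y) = hp (b k) y"
      and b2: "\<forall>j\<in>K. \<forall>k\<in>K. herm (\<Phi> (b j)) (\<Phi> (b k)) = hp (b j) (b k)"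
      and b3: "\<And>c. (\<Sum>k\<in>K. c k *s homog (b k)) = 0 \<Longrightarrow> (\<forall>k\<in>K. c k = 0)" by blast
    have "card K < CARD('p option)"
      using insert.hyps psubset_card_mono[of UNIV K] by (metis UNIV_I finite psubsetI subset_UNIV)
    then have "card ((\<lambda>j. homog (b j)) ` K) < CARD('p option)"
      using card_image_le[OF insert.hyps(1), of "\<lambda>j. homog (b j)"] by simp
    \<comment> \<open>A lift that is not orthogonal to \<open>n\<close> is independent of those
      already drawn.\<close>
    then obtain n where n: "n \<noteq> 0" "\<And>v. v \<in> (\<lambda>j. homog (b j)) ` K \<Longrightarrow> herm v n = 0"
      using ex_herm_orthogonal[of "(\<lambda>j. homog (b j)) ` K"] insert.hyps(1) by blast
    have "AE y in sph. \<forall>j\<in>K. herm (\<Phi> (b j)) (\<Phi> y) = hp (b j) y"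
      using b1 insert.hyps(1) by (intro AE_finite_allI) auto
    then have "AE y in sph. (AE z in sph. herm (\<Phi> y) (\<Phi> z) = hp y z) \<and> herm (\<Phi> y) (\<Phi> y) = 0 \<and>
        y \<in> sphere 0 1 \<and> herm (homog y) n \<noteq> 0 \<and> (\<forall>j\<in>K. herm (\<Phi> (b j)) (\<Phi> y) = hp (b j) y)"
      using gram iso AE_sphere AE_herm_nonzero[OF n(1)] by eventually_elim simp
    then obtain y where y: "AE z in sph. herm (\<Phi> y) (\<Phi> z) = hp y z" "herm (\<Phi> y) (\<Phi> y) = 0"
        "y \<in> sphere 0 1" "herm (homog y) n \<noteq> 0" "\<forall>j\<in>K. herm (\<Phi> (b j)) (\<Phi> y) = hp (b j) y"
      using AE_sph_ex by blast
    have y': "\<forall>j\<in>K. herm (\<Phi> y) (\<Phi> (b j)) = hp y (b j)" using y(5) by (metis cnj_herm)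
    let ?b = "b(k := y)"
    have bK: "?b j = b j" if "j \<in> K" for j using that insert.hyps by auto
    show ?case
    proof (intro exI[of _ ?b] conjI allI impI)
      show "\<forall>j\<in>insert k K. AE z in sph. herm (\<Phi> (?b j)) (\<Phi> z) = hp (?b j) z"
        using b1 y(1) bK by auto
      show "\<forall>i\<in>insert k K. \<forall>j\<in>insert k K. herm (\<Phi> (?b i)) (\<Phi> (?b j)) = hp (?b i) (?b j)"
        using b2 y(2,3,5) y' bK by (auto simp: hp_self simp del: mem_sphere)
      fix c assume "(\<Sum>j\<in>insert k K. c j *s homog (?b j)) = 0"
      moreover have "(\<Sum>j\<in>K. c j *s homog (?b j)) = (\<Sum>j\<in>K. c j *s homog (b j))"
        using bK by (intro sum.cong) auto
      ultimately have eq: "c k *s homog y + (\<Sum>j\<in>K. c j *s homog (b j)) = 0"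
        using insert.hyps by simp
      have "herm (\<Sum>j\<in>K. c j *s homog (b j)) n = 0"
        unfolding herm_sum_left herm_scale_left using n(2) by (intro sum.neutral) auto
      then have "c k * herm (homog y) n = 0"
        using arg_cong[OF eq, of "\<lambda>v. herm v n"] by (simp add: herm_add_left herm_scale_left)
      then have ck: "c k = 0" using y(4) by simp
      then have "(\<Sum>j\<in>K. c j *s homog (b j)) = 0" using eq by simp
      then show "\<forall>j\<in>insert k K. c j = 0" using b3 ck by auto
    qed
  qed simp
  from this[of UNIV] show ?thesis using that by auto
qed

text \<open>\<open>f\<close> is the linear map that agrees with \<open>\<Phi>\<close> on the basis;
  equal Gram matrices make it an isometry. The difference of \<open>\<Phi> y\<close> and
  \<open>f (homog y)\<close> is orthogonal to the image of \<open>f\<close>, which contains a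
  negative vector, and it is isotropic, so it is 0. Isotropy of \<open>\<Phi> y\<close> is asked for
  separately because a relation for almost every pair says nothing on the diagonal.\<close>

lemma isometry_from_gram:
  fixes \<Phi> :: "complex^'p::finite \<Rightarrow> complex^('q::finite option)"
  assumes gram: "AE x in sph. AE y in sph. herm (\<Phi> x) (\<Phi> y) = hp x y"
    and iso: "AE x in sph. herm (\<Phi> x) (\<Phi> x) = 0"
  obtains f where "herm_iso f" "AE x in sph. \<Phi> x = f (homog x)"
proof (rule generic_basis[OF gram iso])
  fix b :: "'p option \<Rightarrow> complex^'p"
  assume b1: "\<And>k. AE y in sph. herm (\<Phi> (b k)) (\<Phi> y) = hp (b k) y"
    and b2: "\<And>j k. herm (\<Phi> (b j)) (\<Phi> (b k)) = hp (b j) (b k)"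
    and b3: "\<And>c. (\<Sum>k\<in>UNIV. c k *s homog (b k)) = 0 \<Longrightarrow> (\<forall>k. c k = 0)"
  define M where "M = (\<chi> i k. homog (b k) $ i)"
  define M' where "M' = (\<chi> i k. \<Phi> (b k) $ i)"
  have Ma: "M *v a = (\<Sum>k\<in>UNIV. a $ k *s homog (b k))" for a
    unfolding matrix_mult_sum by (simp add: M_def column_def)
  have M'a: "M' *v a = (\<Sum>k\<in>UNIV. a $ k *s \<Phi> (b k))" for a
    unfolding matrix_mult_sum by (simp add: M'_def column_def)
  have "\<exists>B. B ** M = mat 1"
    unfolding matrix_left_invertible_ker
  proof (intro allI impI)
    fix a assume "M *v a = 0"
    then have "\<forall>k. a $ k = 0" using b3[of "\<lambda>k. a $ k"] by (simp add: Ma)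
    then show "a = 0" by (simp add: vec_eq_iff)
  qed
  then obtain B where B: "B ** M = mat 1" by blast
  then have B': "M ** B = mat 1" by (simp add: matrix_left_right_inverse)
  define f where "f v = M' *v (B *v v)" for v
  have MB: "M *v (B *v v) = v" for v using B' by (simp add: matrix_vector_mul_assoc)
  have fM: "f (M *v a) = M' *v a" for a using B by (simp add: f_def matrix_vector_mul_assoc)
  have f: "herm_iso f"
    unfolding herm_iso_def
  proof (intro conjI allI)
    fix u v
    have "herm (M' *v a) (M' *v a') = herm (M *v a) (M *v a')" for a a'
      unfolding Ma M'a herm_sum_left herm_sum_right herm_scale_left herm_scale_right b2 ..
    from this[of "B *v u" "B *v v"] show "herm (f u) (f v) = herm u v" by (simp add: f_def MB)
  qed (simp_all add: f_def matrix_vector_right_distrib vector_scalar_commute)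
  have fb: "f (homog (b k)) = \<Phi> (b k)" for k
  proof -
    have "homog (b k) = M *v axis k 1" "\<Phi> (b k) = M' *v axis k 1"
      by (simp_all add: vec_eq_iff matrix_vector_mult_def M_def M'_def axis_def if_distrib cong: if_cong)
    then show ?thesis by (simp only: fM)
  qed
  have "AE y in sph. \<forall>k\<in>UNIV. herm (\<Phi> (b k)) (\<Phi> y) = hp (b k) y"
    by (intro AE_finite_allI b1) simp
  then have "AE y in sph. \<Phi> y = f (homog y)" using iso AE_sphere
  proof eventually_elim
    case (elim y)
    define R where "R = \<Phi> y - f (homog y)"
    have Rb: "herm R (\<Phi> (b k)) = 0" for k
    proof -
      have "herm (f (homog y)) (\<Phi> (b k)) = hp y (b k)"
        unfolding fb[symmetric] by (rule herm_iso_herm[OF f])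
      moreover have "herm (\<Phi> y) (\<Phi> (b k)) = hp y (b k)" using elim(1) by (metis UNIV_I cnj_herm)
      ultimately show ?thesis by (simp add: R_def herm_diff_left)
    qed
    have Rf: "herm R (f v) = 0" for v
      unfolding f_def M'a herm_sum_right herm_scale_right Rb by simp
    have fR: "herm (f v) R = 0" for v using Rf herm_eq_0_commute by blast
    have "herm (\<Phi> y) (\<Phi> y) = herm (R + f (homog y)) (R + f (homog y))" by (simp add: R_def)
    also have "\<dots> = herm R R + hp y y"
      by (simp add: herm_add_left herm_add_right Rf fR herm_iso_herm[OF f])
    finally have "herm R R = 0" using elim(2) hp_self[OF elim(3)] by simp
    moreover have "Re (herm (f (homog 0)) (f (homog 0))) < 0"
      by (simp add: herm_iso_herm[OF f] herm_homog_self)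
    ultimately have "R = 0" using orthogonal_to_timelike(2)[of "f (homog 0)" R] Rf by simp
    then show ?case by (simp add: R_def)
  qed
  with f show ?thesis by (rule that)
qed

theorem theorem12:
  fixes \<phi> :: "complex^'p::finite \<Rightarrow> complex^'q::finite"
  assumes "CARD('p) \<ge> 2"
    and "\<phi> \<in> completion sphere_lebesgue \<rightarrow>\<^sub>M restrict_space borel (sphere 0 1)"
    and "almost_every_chain (\<lambda>C. almost_every_triple_on C (\<lambda>\<xi> \<eta> \<zeta>. distinct [\<xi>, \<eta>, \<zeta>] \<longrightarrow>
           distinct [\<phi> \<xi>, \<phi> \<eta>, \<phi> \<zeta>] \<and> on_common_chain (\<phi> \<xi>) (\<phi> \<eta>) (\<phi> \<zeta>) \<and>
           (positively_oriented (\<phi> \<xi>) (\<phi> \<eta>) (\<phi> \<zeta>) \<longleftrightarrow> positively_oriented \<xi> \<eta> \<zeta>)))"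
    and "AE (\<xi>, \<eta>, \<zeta>) in sphere_lebesgue \<Otimes>\<^sub>M sphere_lebesgue \<Otimes>\<^sub>M sphere_lebesgue.
           \<not> on_common_chain \<xi> \<eta> \<zeta> \<longrightarrow> \<not> on_common_chain (\<phi> \<xi>) (\<phi> \<eta>) (\<phi> \<zeta>)"
  shows "\<exists>F :: complex^'p \<Rightarrow> complex^'q. isometric_holomorphic_embedding F \<and>
           (AE \<xi> in sphere_lebesgue. boundary_map F \<xi> = \<phi> \<xi>)"
proof -
  obtain \<psi> where \<psi>: "\<psi> \<in> borel_measurable borel" "\<And>x. \<psi> x \<in> sphere 0 1" and eq: "AE x in sph. \<phi> x = \<psi> x"
    by (rule measurable_completion_sphere[OF assms(2)]) blast
  obtain c where c: "AE x in sph. c x \<noteq> 0"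
    "AE x in sph. AE y in sph. herm (c x *s homog (\<psi> x)) (c y *s homog (\<psi> y)) = hp x y"
    by (rule scaled_lift_exists[OF \<psi> AE_good[OF assms(3) \<psi>(1) eq] AE_not_on_chain[OF assms(1,4) \<psi>(2) eq]])
  obtain f where f: "herm_iso f" "AE x in sph. c x *s homog (\<psi> x) = f (homog x)"
    by (rule isometry_from_gram[OF c(2)]) (simp_all add: herm_scale_left herm_scale_right hp_self[OF \<psi>(2)])
  have "AE x in sph. boundary_map (proj_act f) x = \<phi> x"
    using f(2) c(1) eq AE_sphere
  proof eventually_elim
    case (elim x)
    have "boundary_map (proj_act f) x = dehomog (c x *s homog (\<psi> x))"
      using boundary_map_proj_act[OF f(1) _ elim(4), of "proj_act f"] elim(1) by (simp add: proj_act_def)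
    then show ?case using elim(2,3) by (simp add: dehomog_scale)
  qed
  then show ?thesis
    using embedding_proj_act[OF f(1)] by (auto simp: AE_sphere_lebesgue_iff)
qed

end
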